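(* Consider the $N$-queue cyclic polling model with retrials and glue periods described in the context, and let $h=(h_1,\dots,h_N)$ and $K$ be the functions defined there. If $\sum_{i=1}^N\rho_i<1$, where $\rho_i=\lambda_i\,\mathbb{E}[B_i]$, then the generating function $$X(z)=\mathbb{E}\Bigl[\prod_{j=1}^{N}z_j^{X_j^{(1)}}\Bigr],\qquad z=(z_1,\dots,z_N),\ |z_j|\le1,$$ of the steady-state numbers of customers of types $1,\dots,N$ in the system at the start of a glue period of $Q_1$ is given by $$X(z)=\prod_{m=0}^{\infty}K\bigl(h_1^{(m)}(z),h_2^{(m)}(z),\dots,h_N^{(m)}(z)\bigr),$$ where, for $i=1,\dots,N$, $h_i^{(0)}(z)=z_i$ and $h_i^{(n)}(z)=h_i\bigl(h_1^{(n-1)}(z),\dots,h_N^{(n-1)}(z)\bigr)$ for $n\ge1$.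
   Context: Model. A single server serves queues $Q_1,\dots,Q_N$ in cyclic order ($Q_{i+1}$ after $Q_i$, and $Q_1$ after $Q_N$). Type-$i$ customers arrive at $Q_i$ according to a Poisson process with rate $\lambda_i>0$. Service times at $Q_i$ are i.i.d., distributed as a generic nonnegative random variable $B_i$ with $0<\mathbb{E}[B_i]<\infty$ and Laplace-Stieltjes transform (LST) $\tilde B_i(s)=\mathbb{E}[e^{-sB_i}]$. For each $i$ the server goes through a glue period of deterministic length $G_i>0$ of $Q_i$, then a visit period of $Q_i$, then a switchover time from $Q_i$ to $Q_{i+1}$; these switchover times are i.i.d., distributed as a generic nonnegative random variable $S_i$ with $\mathbb{E}[S_i]<\infty$ and LST $\tilde S_i(s)=\mathbb{E}[e^{-sS_i}]$. All arrivals, service times, switchover times and retrial times are independent. Type-$i$ customers (new arrivals and retrials) who arrive at $Q_i$ during a glue period of $Q_i$ stick, i.e. join the queue of $Q_i$. Type-$i$ customers who arrive in any other period immediately leave to the orbit and retry after an exponentially distributed time with rate $\nu_i>0$, independent of everything else; each further unsuccessful retrial is again followed by an independent exponential($\nu_i$) retrial interval. Service is gated: during a visit period of $Q_i$ the server serves exactly those type-$i$ customers who are in the queue of $Q_i$ at the end of the preceding glue period (none of those in orbit and no new arrivals). $(X_1^{(1)},\dots,X_N^{(1)})$ is a random vector having the limiting (steady-state) distribution, as $n\to\infty$, of the vector of numbers of customers of types $1,\dots,N$ in the system (all in orbit) at the start of the $n$th glue period of $Q_1$. Functions. For $z=(z_1,\dots,z_N)$ with $|z_j|\le1$ put $$\beta_i(z)=\tilde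 B_i\Bigl(\sum_{j=1}^N\lambda_j(1-z_j)\Bigr),\quad \sigma_i(z)=\tilde S_i\Bigl(\sum_{j=1}^N\lambda_j(1-z_j)\Bigr),\quad f_i(z)=(1-e^{-\nu_iG_i})\beta_i(z)+e^{-\nu_iG_i}z_i .$$ Define recursively $h_N(z)=f_N(z_1,\dots,z_N)$ and, for $i=N-1,\dots,1$, $$h_i(z)=f_i\bigl(z_1,\dots,z_i,h_{i+1}(z),\dots,h_N(z)\bigr).$$ Also, for $i=1,\dots,N$ (with no $h$-arguments when $i=N$), $$\beta^{(i)}(z)=\beta_i\bigl(z_1,\dots,z_i,h_{i+1}(z),\dots,h_N(z)\bigr),\qquad \sigma^{(i)}(z)=\sigma_i\bigl(z_1,\dots,z_i,h_{i+1}(z),\dots,h_N(z)\bigr),$$ $$D_i(z)=\sum_{j=1}^{i-1}\lambda_j(1-z_j)+\lambda_i\bigl(1-\beta^{(i)}(z)\bigr)+\sum_{j=i+1}^{N}\lambda_j\bigl(1-h_j(z)\bigr),$$ and $$K(z)=\prod_{i=1}^N\sigma^{(i)}(z)\,\prod_{i=1}^Ne^{-G_iD_i(z)}.$$ *)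

theory Defs
  imports "HOL-Probability.Probability"
begin

section \<open>Parameters and the functions \<open>h_fun\<close> and \<open>K_fun\<close>\<close>

text \<open>
  Queues and customer types are numbered \<open>1, \<dots>, nq P\<close>; parameters with other indices play no role.
  Service and switchover times are given by their distributions on the reals.
  Vectors \<open>z = (z\<^sub>1, \<dots>, z\<^sub>N)\<close> are functions on \<open>nat\<close> of which only the components
  \<open>1, \<dots>, N\<close> are used.
\<close>

record polling =
  nq :: nat
  arr_rate :: "nat \<Rightarrow> real"
  retr_rate :: "nat \<Rightarrow> real"
  glue :: "nat \<Rightarrow> real"
  serv :: "nat \<Rightarrow> real measure"
  switch :: "nat \<Rightarrow> real measure"

definition nonneg_dist :: "real measure \<Rightarrow> bool" where
  "nonneg_dist D \<longleftrightarrow> prob_space D \<and> sets D = sets borel \<and> (AE x in D. 0 \<le> x) \<and> integrable D (\<lambda>x. x)"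

definition mean :: "real measure \<Rightarrow> real" where
  "mean D = (LINT x|D. x)"

definition valid_polling :: "polling \<Rightarrow> bool" where
  "valid_polling P \<longleftrightarrow> 1 \<le> nq P \<and>
     (\<forall>i\<in>{1..nq P}. 0 < arr_rate P i \<and> 0 < retr_rate P i \<and> 0 < glue P i \<and>
        nonneg_dist (serv P i) \<and> 0 < mean (serv P i) \<and> nonneg_dist (switch P i))"

definition load :: "polling \<Rightarrow> nat \<Rightarrow> real" where
  "load P i = arr_rate P i * mean (serv P i)"

definition lst :: "real measure \<Rightarrow> complex \<Rightarrow> complex" where
  "lst D s = (LINT x|D. exp (- s * of_real x))"

definition beta :: "polling \<Rightarrow> nat \<Rightarrow> (nat \<Rightarrow> complex) \<Rightarrow> complex" where
  "beta P i z = lst (serv P i) (\<Sum>j=1..nq P. of_real (arr_rate P j) * (1 - z j))"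

definition sigma :: "polling \<Rightarrow> nat \<Rightarrow> (nat \<Rightarrow> complex) \<Rightarrow> complex" where
  "sigma P i z = lst (switch P i) (\<Sum>j=1..nq P. of_real (arr_rate P j) * (1 - z j))"

definition f_fun :: "polling \<Rightarrow> nat \<Rightarrow> (nat \<Rightarrow> complex) \<Rightarrow> complex" where
  "f_fun P i z = of_real (1 - exp (- retr_rate P i * glue P i)) * beta P i z
     + of_real (exp (- retr_rate P i * glue P i)) * z i"

function h_fun :: "polling \<Rightarrow> nat \<Rightarrow> (nat \<Rightarrow> complex) \<Rightarrow> complex" where
  "h_fun P i z = f_fun P i (\<lambda>j. if i < j \<and> j \<le> nq P then h_fun P j z else z j)"
  by auto
termination
  by (relation "Wellfounded.measure (\<lambda>(P, i, z). nq P - i)") auto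

declare h_fun.simps [simp del]

text \<open>\<open>hvec P i z\<close> is the vector \<open>(z\<^sub>1, \<dots>, z\<^sub>i, h\<^sub>i\<^sub>+\<^sub>1(z), \<dots>, h\<^sub>N(z))\<close>.\<close>

definition hvec :: "polling \<Rightarrow> nat \<Rightarrow> (nat \<Rightarrow> complex) \<Rightarrow> nat \<Rightarrow> complex" where
  "hvec P i z = (\<lambda>j. if i < j \<and> j \<le> nq P then h_fun P j z else z j)"

definition D_fun :: "polling \<Rightarrow> nat \<Rightarrow> (nat \<Rightarrow> complex) \<Rightarrow> complex" where
  "D_fun P i z = (\<Sum>j\<in>{1..<i}. of_real (arr_rate P j) * (1 - z j))
     + of_real (arr_rate P i) * (1 - beta P i (hvec P i z))
     + (\<Sum>j\<in>{i<..nq P}. of_real (arr_rate P j) * (1 - h_fun P j z))"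

definition K_fun :: "polling \<Rightarrow> (nat \<Rightarrow> complex) \<Rightarrow> complex" where
  "K_fun P z = (\<Prod>i=1..nq P. sigma P i (hvec P i z)) * (\<Prod>i=1..nq P. exp (- of_real (glue P i) * D_fun P i z))"

primrec hiter :: "polling \<Rightarrow> nat \<Rightarrow> (nat \<Rightarrow> complex) \<Rightarrow> nat \<Rightarrow> complex" where
  "hiter P 0 z = z"
| "hiter P (Suc n) z = (\<lambda>i. h_fun P i (hiter P n z))"


section \<open>The polling process\<close>

text \<open>
  The process is constructed path by path from independent real random variables
  \<open>W s\<close>, one for each source of randomness \<open>s\<close>:
  \<^item> \<open>Arr i n\<close>: the \<open>n\<close>-th interarrival time of the Poisson process of type-\<open>i\<close> arrivals;
  \<^item> \<open>Retr i c m\<close>: the \<open>m\<close>-th retrial interval of type-\<open>i\<close> customer number \<open>c\<close>;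
  \<^item> \<open>Serv i c\<close>: the service time of type-\<open>i\<close> customer number \<open>c\<close>;
  \<^item> \<open>Switch k\<close>: the switchover time at the end of stage \<open>k\<close>.

  A stage consists of a glue period, a visit period and the switchover time following it.
  Stage \<open>k = n N + (i - 1)\<close> is the one of \<open>Q\<^sub>i\<close> in the \<open>n\<close>-th cycle (\<open>n = 0, 1, \<dots>\<close>).
  Time 0 is the start of stage 0, when an arbitrary number \<open>x0 i\<close> of type-\<open>i\<close> customers are in
  orbit, each at the beginning of a retrial interval; these are numbered \<open>c < x0 i\<close>, and
  the customers \<open>c \<ge> x0 i\<close> are the later arrivals in order of arrival.
\<close>

datatype source = Arr nat nat | Retr nat nat nat | Serv nat nat | Switch nat

definition queue :: "polling \<Rightarrow> nat \<Rightarrow> nat" where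
  "queue P k = Suc (k mod nq P)"

fun source_law :: "polling \<Rightarrow> source \<Rightarrow> real measure" where
  "source_law P (Arr i n) = density lborel (exponential_density (arr_rate P i))"
| "source_law P (Retr i c m) = density lborel (exponential_density (retr_rate P i))"
| "source_law P (Serv i c) = serv P i"
| "source_law P (Switch k) = switch P (queue P k)"

definition sources :: "polling \<Rightarrow> source set" where
  "sources P = (\<Union>i\<in>{1..nq P}. range (Arr i) \<union> (\<Union>c. range (Retr i c)) \<union> range (Serv i)) \<union> range Switch"

definition polling_sources :: "polling \<Rightarrow> 'a measure \<Rightarrow> (source \<Rightarrow> 'a \<Rightarrow> real) \<Rightarrow> bool" where
  "polling_sources P M W \<longleftrightarrow> prob_space M \<and>
     prob_space.indep_vars M (\<lambda>_. borel) W (sources P) \<and>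
     (\<forall>s\<in>sources P. distr M borel (W s) = source_law P s)"

text \<open>
  In the path-wise definitions \<open>w s\<close> is a realization of \<open>W s\<close>.
  The attempts of a customer to join the queue are the arrival itself (except for customers in
  orbit at time 0) and the ends of the successive retrial intervals. Attempts after the first
  one that falls into a glue period of the customer's queue are fictitious and are ignored in
  the definition of \<open>stage\<close>.
\<close>

definition entry :: "(nat \<Rightarrow> nat) \<Rightarrow> (source \<Rightarrow> real) \<Rightarrow> nat \<Rightarrow> nat \<Rightarrow> real" where
  "entry x0 w i c = (if c < x0 i then 0 else (\<Sum>n\<le>c - x0 i. w (Arr i n)))"

definition attempt :: "(nat \<Rightarrow> nat) \<Rightarrow> (source \<Rightarrow> real) \<Rightarrow> nat \<Rightarrow> nat \<Rightarrow> nat \<Rightarrow> real" where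
  "attempt x0 w i c m = entry x0 w i c +
     (if c < x0 i then (\<Sum>l\<le>m. w (Retr i c l)) else (\<Sum>l<m. w (Retr i c l)))"

text \<open>
  \<open>stage P x0 w k = (t, J)\<close>: stage \<open>k\<close> starts at time \<open>t\<close>, and \<open>J\<close> is the set of
  customers \<open>(i, c)\<close> that joined their queue during stages \<open>0, \<dots>, k - 1\<close>; under gated service
  these are exactly the customers whose service is completed by time \<open>t\<close>.
  The set \<open>C\<close> below is almost surely finite.
\<close>

primrec stage :: "polling \<Rightarrow> (nat \<Rightarrow> nat) \<Rightarrow> (source \<Rightarrow> real) \<Rightarrow> nat \<Rightarrow> real \<times> (nat \<times> nat) set" where
  "stage P x0 w 0 = (0, {})"
| "stage P x0 w (Suc k) =
    (let (t, J) = stage P x0 w k;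
         i = queue P k;
         C = {c. (i, c) \<notin> J \<and> (\<exists>m. t \<le> attempt x0 w i c m \<and> attempt x0 w i c m < t + glue P i)}
     in (t + glue P i + (\<Sum>c\<in>C. w (Serv i c)) + w (Switch k), J \<union> {i} \<times> C))"

text \<open>Number of type-\<open>i\<close> customers in the system at the start of stage \<open>k\<close>.\<close>

definition num_at :: "polling \<Rightarrow> (nat \<Rightarrow> nat) \<Rightarrow> (source \<Rightarrow> real) \<Rightarrow> nat \<Rightarrow> nat \<Rightarrow> nat" where
  "num_at P x0 w k i =
     (let (t, J) = stage P x0 w k in card {c. entry x0 w i c \<le> t \<and> (i, c) \<notin> J})"

text \<open>
  \<open>X = (X\<^sub>1, \<dots>, X\<^sub>N)\<close> is a random vector on a probability space \<open>M'\<close> having the limiting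
  distribution of the numbers of customers at the starts of the glue periods of \<open>Q\<^sub>1\<close>, i.e. of
  the stages \<open>n N\<close>. Convergence in distribution to a random vector of natural numbers is
  convergence of all point probabilities.
\<close>

definition steady_state ::
  "polling \<Rightarrow> 'a measure \<Rightarrow> (source \<Rightarrow> 'a \<Rightarrow> real) \<Rightarrow> (nat \<Rightarrow> nat) \<Rightarrow> 'b measure \<Rightarrow> (nat \<Rightarrow> 'b \<Rightarrow> nat) \<Rightarrow> bool" where
  "steady_state P M W x0 M' X \<longleftrightarrow> prob_space M' \<and>
     (\<forall>i\<in>{1..nq P}. X i \<in> measurable M' (count_space UNIV)) \<and>
     (\<forall>x :: nat \<Rightarrow> nat.
        (\<lambda>n. measure M {\<omega>\<in>space M. \<forall>i\<in>{1..nq P}. num_at P x0 (\<lambda>s. W s \<omega>) (n * nq P) i = x i})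
        \<longlonglongrightarrow> measure M' {\<omega>\<in>space M'. \<forall>i\<in>{1..nq P}. X i \<omega> = x i})"

definition gen_fun :: "polling \<Rightarrow> 'b measure \<Rightarrow> (nat \<Rightarrow> 'b \<Rightarrow> nat) \<Rightarrow> (nat \<Rightarrow> complex) \<Rightarrow> complex" where
  "gen_fun P M' X z = (LINT \<omega>|M'. (\<Prod>j=1..nq P. z j ^ X j \<omega>))"

end

theory Submission
  imports Defs
begin

text \<open>
  Let \<open>E\<^sub>k\<close> be the generating function of the numbers of customers at the start of stage \<open>k\<close>
  (\<open>num_gf\<close> below). One stage, serving \<open>Q\<^sub>i\<close>, acts on it by a substitution and a factor: \<open>E\<^sub>k\<^sub>+\<^sub>1(z)\<close>
  is \<open>stage_factor k z\<close> times \<open>E\<^sub>k\<close> at the point \<open>z\<close> with \<open>z\<^sub>i\<close> replaced by \<open>f\<^sub>i(z)\<close>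
  (\<open>stage_recursion\<close>). Going backwards through the \<open>N\<close> stages of a cycle, the substitutions compose
  to \<open>h\<close> and the factors multiply to \<open>K\<close> (\<open>cycle_recursion\<close>). So after \<open>n\<close> cycles the generating
  function is the product of the \<open>K(h\<^sup>(\<^sup>m\<^sup>)(z))\<close> for \<open>m < n\<close>, times the monomial of the initial numbers
  at \<open>h\<^sup>(\<^sup>n\<^sup>)(z)\<close>. When the load is below 1, \<open>h\<close> contracts towards the point \<open>(1, \<dots>, 1)\<close> in the maximum
  norm weighted by the mean service times (\<open>near_one_h_fun\<close>), and \<open>K\<close> differs from 1 by at most a
  multiple of the distance to that point (\<open>near_one_K_fun\<close>). Hence the product converges absolutely
  and the monomial tends to 1. On the other side, convergence of point probabilities to those of a
  probability distribution is convergence in total variation, by Scheffe's lemma, so the generating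
  functions at the starts of the cycles converge to that of the limit (\<open>steady_state_num_gf\<close>).

  The recursion over one stage has to be derived for a process built path by path from independent
  variables. Look at the start of stage \<open>k\<close>, and let \<open>A\<close> be the finite set of the variables that are
  used up by then: the interarrival and retrial intervals that have ended, the service times of the
  customers that have joined, and the earlier switchover times. There are countably many
  possibilities for \<open>A\<close>, and for a fixed one the schedule so far is a function of the variables in
  \<open>A\<close>. That \<open>A\<close> is the set used up then says two things: a condition on the variables in \<open>A\<close>, and,
  for each interval in progress, that it is longer than its current age, which is again a function
  of the variables in \<open>A\<close> (\<open>in_progress_iff\<close>). By the memoryless property, the residual intervals
  and the unused variables together are a fresh copy of the family, independent of the condition on
  \<open>A\<close> (\<open>memoryless\<close>). The numbers of customers one stage later are expressed by this fresh copy
  (\<open>one_step\<close>): a customer in the orbit of the served queue sticks if its residual retrial interval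
  is shorter than the glue period, and arrivals form Poisson processes, whose increments after the
  glue period are independent of the lengths of the visit and the switchover. Averaging gives the substitution and the factor
  (\<open>integral_resolved_weight\<close>), with the binomial theorem over the customers that stick and the
  exponential series over the arrivals in the glue period.
\<close>

section \<open>Resampling and memorylessness in product spaces\<close>

definition depends_on :: "'i set \<Rightarrow> (('i \<Rightarrow> 'a) \<Rightarrow> 'b) \<Rightarrow> bool" where
  "depends_on A f \<longleftrightarrow> (\<forall>w w'. (\<forall>s\<in>A. w s = w' s) \<longrightarrow> f w = f w')"

lemma depends_onD: "depends_on A f \<Longrightarrow> (\<And>s. s \<in> A \<Longrightarrow> w s = w' s) \<Longrightarrow> f w = f w'"
  unfolding depends_on_def by blast

lemma depends_onI: "(\<And>w w'. (\<And>s. s \<in> A \<Longrightarrow> w s = w' s) \<Longrightarrow> f w = f w') \<Longrightarrow> depends_on A f"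
  unfolding depends_on_def by blast

definition splice :: "'i set \<Rightarrow> ('i \<Rightarrow> 'a) \<Rightarrow> ('i \<Rightarrow> 'a) \<Rightarrow> 'i \<Rightarrow> 'a" where
  "splice A w w' = (\<lambda>s. if s \<in> A then w s else w' s)"

context product_prob_space
begin

lemma measurable_splice [measurable]:
  "(\<lambda>x. splice A (fst x) (snd x)) \<in> measurable (PiM I M \<Otimes>\<^sub>M PiM I M) (PiM I M)"
  unfolding splice_def
proof (rule measurable_PiM_single')
  fix i assume "i \<in> I"
  then show "(\<lambda>x. if i \<in> A then fst x i else snd x i) \<in> measurable (PiM I M \<Otimes>\<^sub>M PiM I M) (M i)"
    by simp
qed (auto simp: space_pair_measure space_PiM PiE_def Pi_def extensional_def)

text \<open>
  Taking the coordinates in \<open>A\<close> from one point and the others from an independent point reproduces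
  the product law. Both independence of disjoint sets of coordinates and the resampling of a single
  coordinate are instances.
\<close>
lemma distr_splice:
  "distr (PiM I M \<Otimes>\<^sub>M PiM I M) (PiM I M) (\<lambda>x. splice A (fst x) (snd x)) = PiM I M" (is "?D = _")
proof (rule PiM_eq)
  show "sets ?D = sets (PiM I M)" by simp
  fix J F assume J: "finite J" "J \<subseteq> I" and F: "\<And>j. j \<in> J \<Longrightarrow> F j \<in> sets (M j)"
  let ?P = "PiM I M"
  let ?E1 = "prod_emb I M (J \<inter> A) (\<Pi>\<^sub>E j\<in>J \<inter> A. F j)" and ?E2 = "prod_emb I M (J - A) (\<Pi>\<^sub>E j\<in>J - A. F j)"
  have E: "?E1 \<in> sets ?P" "?E2 \<in> sets ?P"
    using J F by (auto intro!: sets_PiM_I)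
  have eq: "(\<lambda>x. splice A (fst x) (snd x)) -` prod_emb I M J (\<Pi>\<^sub>E j\<in>J. F j) \<inter> space (?P \<Otimes>\<^sub>M ?P) = ?E1 \<times> ?E2"
    using J by (auto simp: splice_def prod_emb_def space_pair_measure space_PiM PiE_iff extensional_def
        split: if_splits)
  have "emeasure ?D (prod_emb I M J (\<Pi>\<^sub>E j\<in>J. F j)) = emeasure (?P \<Otimes>\<^sub>M ?P) (?E1 \<times> ?E2)"
    using J F by (subst emeasure_distr) (auto simp: eq intro!: sets_PiM_I)
  also have "\<dots> = emeasure ?P ?E1 * emeasure ?P ?E2"
    by (rule P.emeasure_pair_measure_Times[OF E])
  also have "\<dots> = (\<Prod>j\<in>J \<inter> A. emeasure (M j) (F j)) * (\<Prod>j\<in>J - A. emeasure (M j) (F j))"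
    using J F by (subst (1 2) emeasure_PiM_emb) auto
  also have "\<dots> = (\<Prod>j\<in>J. emeasure (M j) (F j))"
    using J by (subst prod.union_disjoint[symmetric]) (auto intro!: prod.cong)
  finally show "emeasure ?D (prod_emb I M J (\<Pi>\<^sub>E j\<in>J. F j)) = (\<Prod>j\<in>J. emeasure (M j) (F j))" .
qed

lemma integral_splice:
  fixes f :: "('i \<Rightarrow> 'a) \<Rightarrow> 'b::{banach, second_countable_topology}"
  assumes f: "integrable (PiM I M) f"
  shows "(\<integral>w. f w \<partial>PiM I M) = (\<integral>w. \<integral>w'. f (splice A w w') \<partial>PiM I M \<partial>PiM I M)"
proof -
  interpret PP: pair_prob_space "PiM I M" "PiM I M" ..
  note [measurable] = borel_measurable_integrable[OF f]
  have "(\<integral>w. f w \<partial>PiM I M) = (\<integral>x. f (splice A (fst x) (snd x)) \<partial>(PiM I M \<Otimes>\<^sub>M PiM I M))"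
    by (subst (1) distr_splice[of A, symmetric], rule integral_distr) auto
  also have "\<dots> = (\<integral>w. \<integral>w'. f (splice A w w') \<partial>PiM I M \<partial>PiM I M)"
  proof -
    have "integrable (PiM I M \<Otimes>\<^sub>M PiM I M) (\<lambda>x. f (splice A (fst x) (snd x)))"
      using f by (subst (asm) distr_splice[of A, symmetric], subst (asm) integrable_distr_eq) auto
    from PP.integral_fst'[OF this] show ?thesis by simp
  qed
  finally show ?thesis .
qed

lemma integral_indep:
  fixes f g :: "('i \<Rightarrow> 'a) \<Rightarrow> 'b::{real_normed_field, banach, second_countable_topology}"
  assumes "integrable (PiM I M) (\<lambda>w. f w * g w)" "depends_on A f" "depends_on B g" "A \<inter> B = {}"
  shows "(\<integral>w. f w * g w \<partial>PiM I M) = (\<integral>w. f w \<partial>PiM I M) * (\<integral>w. g w \<partial>PiM I M)"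
proof -
  have "f (splice A w w') = f w" "g (splice A w w') = g w'" for w w'
    using assms(4) by (auto intro!: depends_onD[OF assms(2)] depends_onD[OF assms(3)] simp: splice_def)
  then show ?thesis
    by (subst integral_splice[OF assms(1), of A]) simp
qed

lemma integral_component:
  fixes g :: "'a \<Rightarrow> 'b::{banach, second_countable_topology}"
  assumes "i \<in> I" "g \<in> borel_measurable (M i)"
  shows "(\<integral>w. g (w i) \<partial>PiM I M) = (\<integral>x. g x \<partial>M i)"
  using assms by (subst PiM_component[OF assms(1), symmetric], subst integral_distr) auto

lemma integral_resample:
  fixes f :: "('i \<Rightarrow> 'a) \<Rightarrow> 'b::{banach, second_countable_topology}"
  assumes f: "integrable (PiM I M) f" and i: "i \<in> I"
  shows "(\<integral>w. f w \<partial>PiM I M) = (\<integral>w. \<integral>x. f (w(i := x)) \<partial>M i \<partial>PiM I M)"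
proof -
  have *: "splice (- {i}) w w' = w(i := w' i)" for w w' :: "'i \<Rightarrow> 'a"
    by (auto simp: splice_def fun_eq_iff)
  have "(\<integral>w. f w \<partial>PiM I M) = (\<integral>w. \<integral>w'. f (w(i := w' i)) \<partial>PiM I M \<partial>PiM I M)"
    by (subst integral_splice[OF f, of "- {i}"]) (simp add: *)
  also have "\<dots> = (\<integral>w. \<integral>x. f (w(i := x)) \<partial>M i \<partial>PiM I M)"
  proof (rule Bochner_Integration.integral_cong[OF refl])
    fix w assume w: "w \<in> space (PiM I M)"
    have [measurable]: "f \<in> borel_measurable (PiM I M)" using f by auto
    have "(\<lambda>x. w(i := x)) \<in> measurable (M i) (PiM I M)"
    proof (rule measurable_PiM_single')
      fix j assume "j \<in> I"
      then show "(\<lambda>x. (w(i := x)) j) \<in> measurable (M i) (M j)"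
        using w by (cases "i = j") (auto simp: space_PiM PiE_iff)
    qed (use w i in \<open>auto simp: space_PiM PiE_iff extensional_def\<close>)
    then have "(\<lambda>x. f (w(i := x))) \<in> borel_measurable (M i)" by measurable
    from integral_component[OF i this]
    show "(\<integral>w'. f (w(i := w' i)) \<partial>PiM I M) = (\<integral>x. f (w(i := x)) \<partial>M i)" .
  qed
  finally show ?thesis .
qed

lemma indep_coordinates: "P.indep_vars M (\<lambda>i w. w i) I"
proof (cases "I = {}")
  case True
  show ?thesis unfolding P.indep_vars_def2 P.indep_sets_def by (auto simp: True)
next
  case False
  have "distr (PiM I M) (PiM I M) (\<lambda>w. \<lambda>i\<in>I. w i) = distr (PiM I M) (PiM I M) (\<lambda>w. w)"
    by (rule distr_cong) (auto simp: space_PiM PiE_def extensional_def fun_eq_iff)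
  also have "\<dots> = (\<Pi>\<^sub>M i\<in>I. distr (PiM I M) (M i) (\<lambda>w. w i))"
    by (simp add: PiM_component cong: PiM_cong)
  finally show ?thesis
    using False by (subst P.indep_vars_iff_distr_eq_PiM') auto
qed

end

text \<open>
  The density at \<open>g + y\<close> is \<open>exp (- r * g)\<close> times the density at \<open>y\<close>.
\<close>
lemma exponential_memoryless_integral:
  fixes h :: "real \<Rightarrow> 'b::{banach, second_countable_topology}"
  assumes h: "h \<in> borel_measurable borel" and g: "0 \<le> g" and r: "0 < r"
  shows "(\<integral>x. (if g < x then h (x - g) else 0) \<partial>density lborel (exponential_density r))
       = exp (- r * g) *\<^sub>R (\<integral>x. h x \<partial>density lborel (exponential_density r))"
proof -
  note [measurable] = h
  let ?e = "exponential_density r"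
  have e0: "?e x \<ge> 0" for x using r by (simp add: exponential_density_nonneg)
  have "(\<integral>x. (if g < x then h (x - g) else 0) \<partial>density lborel ?e)
      = (\<integral>x. ?e x *\<^sub>R (if g < x then h (x - g) else 0) \<partial>lborel)"
    using e0 by (subst integral_density) auto
  also have "\<dots> = (\<integral>x. ?e (g + 1 * x) *\<^sub>R (if g < g + 1 * x then h (g + 1 * x - g) else 0) \<partial>lborel)"
    by (subst lborel_integral_real_affine[where c=1 and t=g]) auto
  also have "\<dots> = (\<integral>x. exp (- r * g) *\<^sub>R (?e x *\<^sub>R h x) \<partial>lborel)"
  proof (rule integral_cong_AE)
    show "AE x in lborel. ?e (g + 1 * x) *\<^sub>R (if g < g + 1 * x then h (g + 1 * x - g) else 0)
       = exp (- r * g) *\<^sub>R (?e x *\<^sub>R h x)"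
      using AE_lborel_singleton[of "0::real"]
    proof eventually_elim
      case (elim x)
      then show ?case using g
        by (cases "x < 0") (auto simp: exponential_density_def exp_add[symmetric] algebra_simps)
    qed
  qed auto
  also have "\<dots> = exp (- r * g) *\<^sub>R (\<integral>x. ?e x *\<^sub>R h x \<partial>lborel)"
    by (subst integral_scaleR_right) auto
  also have "(\<integral>x. ?e x *\<^sub>R h x \<partial>lborel) = (\<integral>x. h x \<partial>density lborel ?e)"
    using e0 by (subst integral_density) auto
  finally show ?thesis .
qed

text \<open>
  The coordinates in \<open>V\<close> are lengths of intervals in progress, and \<open>g s\<close> is the age of interval \<open>s\<close>;
  the shifted point contains the residual lengths.
\<close>
definition age_shift :: "'i set \<Rightarrow> ('i \<Rightarrow> ('i \<Rightarrow> real) \<Rightarrow> real) \<Rightarrow> ('i \<Rightarrow> real) \<Rightarrow> 'i \<Rightarrow> real" where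
  "age_shift V g w = (\<lambda>s. if s \<in> V then w s - g s w else w s)"

locale real_product_prob_space = product_prob_space M I
  for M :: "'i \<Rightarrow> real measure" and I :: "'i set" +
  assumes sets_M: "\<And>i. sets (M i) = sets borel"
begin

lemma measurable_coordinate [measurable]: "i \<in> I \<Longrightarrow> (\<lambda>w. w i) \<in> borel_measurable (PiM I M)"
  using measurable_component_singleton[of i I M] sets_M[of i] by (simp cong: measurable_cong_sets)

lemma measurable_into_PiM:
  assumes "\<And>i. i \<in> I \<Longrightarrow> (\<lambda>x. f x i) \<in> borel_measurable N"
    and "\<And>x i. x \<in> space N \<Longrightarrow> i \<notin> I \<Longrightarrow> f x i = undefined"
  shows "f \<in> measurable N (PiM I M)"
proof -
  have "(\<lambda>x i. f x i) \<in> measurable N (PiM I M)"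
    using assms sets_eq_imp_space_eq[OF sets_M]
    by (intro measurable_PiM_single')
      (auto simp: PiE_def extensional_def sets_M cong: measurable_cong_sets)
  then show ?thesis by simp
qed

lemma space_undefined: "w \<in> space (PiM I M) \<Longrightarrow> i \<notin> I \<Longrightarrow> w i = undefined"
  by (auto simp: space_PiM PiE_def extensional_def)

lemma measurable_age_shift:
  assumes "\<And>v. v \<in> V \<Longrightarrow> g v \<in> borel_measurable (PiM I M)" "V \<subseteq> I"
  shows "age_shift V g \<in> measurable (PiM I M) (PiM I M)"
proof (rule measurable_into_PiM)
  fix i assume "i \<in> I"
  then show "(\<lambda>w. age_shift V g w i) \<in> borel_measurable (PiM I M)"
    using assms by (cases "i \<in> V") (auto simp: age_shift_def)
qed (use assms in \<open>auto simp: age_shift_def space_undefined\<close>)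

text \<open>
  Resample the coordinates in \<open>V\<close> one at a time. The ages depend on the coordinates in \<open>A\<close> only, so
  they stay fixed, and each coordinate contributes the probability that its interval reaches its age.
\<close>
lemma memoryless_weight:
  fixes Q F :: "('i \<Rightarrow> real) \<Rightarrow> complex"
  assumes V: "finite V" "V \<subseteq> I" "V \<inter> A = {}"
    and rate: "\<And>v. v \<in> V \<Longrightarrow> 0 < rate v"
    and law: "\<And>v. v \<in> V \<Longrightarrow> M v = density lborel (exponential_density (rate v))"
    and Q: "Q \<in> borel_measurable (PiM I M)" "depends_on A Q" "\<And>w. norm (Q w) \<le> BQ"
    and g: "\<And>v. v \<in> V \<Longrightarrow> g v \<in> borel_measurable (PiM I M)" "\<And>v. v \<in> V \<Longrightarrow> depends_on A (g v)"
    and g0: "\<And>v w. v \<in> V \<Longrightarrow> Q w \<noteq> 0 \<Longrightarrow> 0 \<le> g v w"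
    and F: "F \<in> borel_measurable (PiM I M)" "\<And>w. norm (F w) \<le> BF"
  shows "(\<integral>w. (if \<forall>v\<in>V. g v w < w v then Q w * F (age_shift V g w) else 0) \<partial>PiM I M)
       = (\<integral>w. Q w * of_real (exp (- (\<Sum>v\<in>V. rate v * g v w))) * F w \<partial>PiM I M)"
  using V rate law Q g g0
proof (induction V arbitrary: Q BQ rule: finite_induct)
  case empty
  then show ?case by (simp add: age_shift_def)
next
  case (insert v V)
  have vI: "v \<in> I" and vA: "v \<notin> A" and VI: "V \<subseteq> I" using insert.prems by auto
  have vrate: "0 < rate v" and vlaw: "M v = density lborel (exponential_density (rate v))"
    and gv: "depends_on A (g v)" "g v \<in> borel_measurable (PiM I M)" using insert.prems by auto
  note [measurable] = F(1) insert.prems(5) gv(2) 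
  have gm[measurable]: "u \<in> V \<Longrightarrow> g u \<in> borel_measurable (PiM I M)" for u
    using insert.prems by auto
  have as_m[measurable]: "age_shift V g \<in> measurable (PiM I M) (PiM I M)"
    "age_shift (insert v V) g \<in> measurable (PiM I M) (PiM I M)"
    using VI vI by (auto intro!: measurable_age_shift simp: gv)
  have BQ0: "0 \<le> BQ" using insert.prems(7)[of undefined] norm_ge_zero order_trans by blast
  have BF0: "0 \<le> BF" using F(2)[of undefined] norm_ge_zero order_trans by blast
  define Q' where "Q' w = Q w * of_real (exp (- (rate v * g v w)))" for w
  have Q'm[measurable]: "Q' \<in> borel_measurable (PiM I M)" unfolding Q'_def by measurable
  have Q'nz: "Q w \<noteq> 0" if "Q' w \<noteq> 0" for w
    using that by (simp add: Q'_def)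
  have Q'd: "depends_on A Q'"
    using insert.prems(6) gv unfolding depends_on_def Q'_def by metis
  have Q'b: "norm (Q' w) \<le> BQ" for w
  proof (cases "Q w = 0")
    case False
    then have "0 \<le> g v w" using insert.prems(10)[of v w] by simp
    then have "exp (- (rate v * g v w)) \<le> 1" using vrate by simp
    then have "norm (Q w) * exp (- (rate v * g v w)) \<le> BQ * 1"
      using insert.prems(7)[of w] BQ0 by (intro mult_mono) auto
    then show ?thesis by (simp add: Q'_def norm_mult)
  qed (auto simp: Q'_def BQ0)
  let ?c = "\<lambda>w. \<forall>u\<in>V. g u w < w u"
  let ?L = "\<lambda>w. if \<forall>u\<in>insert v V. g u w < w u then Q w * F (age_shift (insert v V) g w) else 0"
  let ?R = "\<lambda>w. if ?c w then Q' w * F (age_shift V g w) else 0"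
  have cm[measurable]: "Measurable.pred (PiM I M) ?c"
    by (intro pred_intros_finite insert(1) borel_measurable_pred_less gm measurable_coordinate) (use VI in auto)
  have intL: "integrable (PiM I M) ?L"
  proof (rule P.integrable_const_bound[where B="BQ * BF"])
    show "AE w in PiM I M. norm (?L w) \<le> BQ * BF"
      using insert.prems(7) F(2) BQ0 BF0 by (auto simp: norm_mult intro!: mult_mono)
    have *: "?L = (\<lambda>w. if g v w < w v \<and> ?c w then Q w * F (age_shift (insert v V) g w) else 0)"
      by (auto simp: fun_eq_iff)
    show "?L \<in> borel_measurable (PiM I M)"
      unfolding * using vI by measurable
  qed
  have intR: "integrable (PiM I M) ?R"
    using Q'b F(2) BQ0 BF0
    by (intro P.integrable_const_bound[where B="BQ * BF"])
       (auto simp: norm_mult intro!: mult_mono)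
  have dep: "f (w(v := x)) = f w" if "depends_on A f" for f :: "('i \<Rightarrow> real) \<Rightarrow> 'z" and w x
    using vA by (intro depends_onD[OF that]) auto
  have dQ: "Q (w(v:=x)) = Q w" "Q' (w(v:=x)) = Q' w" for w x
    by (rule dep[OF insert.prems(6)], rule dep[OF Q'd])
  have dg: "g u (w(v:=x)) = g u w" if "u \<in> insert v V" for u w x
    by (rule dep) (use insert.prems that in auto)
  have dc: "?c (w(v:=x)) = ?c w" for w x
    using insert(2) dg by auto
  have *: "(\<integral>x. ?L (w(v:=x)) \<partial>M v) = (\<integral>x. ?R (w(v:=x)) \<partial>M v)" if w: "w \<in> space (PiM I M)" for w
  proof (cases "Q w = 0 \<or> \<not> ?c w")
    case True
    have "?L (w(v:=x)) = 0" "?R (w(v:=x)) = 0" for x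
    proof -
      have *: "(Q (w(v:=x)) = 0 \<and> Q' (w(v:=x)) = 0) \<or> \<not> ?c (w(v:=x))"
        unfolding dQ dc using True by (auto simp: Q'_def)
      show "?L (w(v:=x)) = 0" using * by (metis (no_types, lifting) insertI2 mult_zero_left)
      show "?R (w(v:=x)) = 0" using * by (metis (no_types, lifting) mult_zero_left)
    qed
    then show ?thesis by simp
  next
    case False
    define h where "h x = Q w * F ((age_shift V g w)(v := x))" for x
    have asw: "age_shift V g w \<in> space (PiM I M)"
      using measurable_space[OF as_m(1) w] .
    have "(\<lambda>x. (age_shift V g w)(v := x)) \<in> measurable borel (PiM I M)"
      using asw vI by (intro measurable_into_PiM) (auto simp: space_undefined)
    then have hm: "h \<in> borel_measurable borel" unfolding h_def by measurable
    have a1: "age_shift (insert v V) g (w(v:=x)) = (age_shift V g w)(v := x - g v w)" for x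
      using insert(2) dg by (auto simp: age_shift_def fun_eq_iff)
    have a2: "age_shift V g (w(v:=x)) = (age_shift V g w)(v := x)" for x
      using insert(2) dg by (auto simp: age_shift_def fun_eq_iff)
    have "(\<integral>x. ?L (w(v:=x)) \<partial>M v) = (\<integral>x. (if g v w < x then h (x - g v w) else 0) \<partial>M v)"
      using False dc dg[of v] insert(2) by (intro Bochner_Integration.integral_cong) (auto simp: a1 h_def dQ dg)
    also have "\<dots> = exp (- rate v * g v w) *\<^sub>R (\<integral>x. h x \<partial>M v)"
      unfolding vlaw using False insert.prems vrate
      by (intro exponential_memoryless_integral[OF hm]) auto
    also have "\<dots> = (\<integral>x. exp (- rate v * g v w) *\<^sub>R h x \<partial>M v)" by simp
    also have "\<dots> = (\<integral>x. ?R (w(v:=x)) \<partial>M v)"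
      using False dc
      by (intro Bochner_Integration.integral_cong) (auto simp: a2 h_def dQ Q'_def dg scaleR_conv_of_real)
    finally show ?thesis .
  qed
  have "(\<integral>w. ?L w \<partial>PiM I M) = (\<integral>w. ?R w \<partial>PiM I M)"
    unfolding integral_resample[OF intL vI] integral_resample[OF intR vI]
    by (intro Bochner_Integration.integral_cong * refl)
  also have "\<dots> = (\<integral>w. Q' w * of_real (exp (- (\<Sum>v\<in>V. rate v * g v w))) * F w \<partial>PiM I M)"
    using insert.prems Q'd Q'b Q'm Q'nz by (intro insert.IH) auto
  also have "\<dots> = (\<integral>w. Q w * of_real (exp (- (\<Sum>v\<in>insert v V. rate v * g v w))) * F w \<partial>PiM I M)"
    using insert(1,2) by (simp add: Q'_def exp_add[symmetric] mult.assoc flip: of_real_mult)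
  finally show ?case .
qed

text \<open>
  The form in which the Markov property is used: \<open>Q\<close> describes the history through the coordinates
  in \<open>A\<close>, and the intervals in \<open>V\<close> have outlived their ages. A function \<open>F\<close> of the residual
  intervals and the untouched coordinates is then independent of all this and has the expectation it
  has for the original family, because the survival factor of \<open>memoryless_weight\<close> depends on \<open>A\<close> only.
\<close>
lemma memoryless:
  fixes Q F :: "('i \<Rightarrow> real) \<Rightarrow> complex"
  assumes V: "finite V" "V \<subseteq> I" "V \<inter> A = {}"
    and rate: "\<And>v. v \<in> V \<Longrightarrow> 0 < rate v"
    and law: "\<And>v. v \<in> V \<Longrightarrow> M v = density lborel (exponential_density (rate v))"
    and Q: "Q \<in> borel_measurable (PiM I M)" "depends_on A Q" "\<And>w. norm (Q w) \<le> BQ"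
    and g: "\<And>v. v \<in> V \<Longrightarrow> g v \<in> borel_measurable (PiM I M)" "\<And>v. v \<in> V \<Longrightarrow> depends_on A (g v)"
    and g0: "\<And>v w. v \<in> V \<Longrightarrow> Q w \<noteq> 0 \<Longrightarrow> 0 \<le> g v w"
    and F: "F \<in> borel_measurable (PiM I M)" "\<And>w. norm (F w) \<le> BF" "depends_on (- A) F"
  shows "(\<integral>w. (if \<forall>v\<in>V. g v w < w v then Q w * F (age_shift V g w) else 0) \<partial>PiM I M)
       = (\<integral>w. (if \<forall>v\<in>V. g v w < w v then Q w else 0) \<partial>PiM I M) * (\<integral>w. F w \<partial>PiM I M)"
proof -
  let ?q = "\<lambda>w. Q w * of_real (exp (- (\<Sum>v\<in>V. rate v * g v w)))"
  have qd: "depends_on A ?q"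
  proof (rule depends_onI)
    fix w w' :: "'i \<Rightarrow> real" assume *: "\<And>s. s \<in> A \<Longrightarrow> w s = w' s"
    have "Q w = Q w'" "\<And>v. v \<in> V \<Longrightarrow> g v w = g v w'"
      using depends_onD[OF Q(2)] depends_onD[OF g(2)] * by blast+
    then show "?q w = ?q w'" by simp
  qed
  have BQ0: "0 \<le> BQ" using Q(3)[of undefined] norm_ge_zero order_trans by blast
  have qb: "norm (?q w * F w) \<le> BQ * BF" for w
  proof (cases "Q w = 0")
    case False
    then have "exp (- (\<Sum>v\<in>V. rate v * g v w)) \<le> 1" using g0 rate by (auto intro!: sum_nonneg simp: less_imp_le)
    then have "norm (Q w) * exp (- (\<Sum>v\<in>V. rate v * g v w)) * norm (F w) \<le> BQ * 1 * BF"
      using BQ0 Q(3) F(2) by (intro mult_mono) auto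
    then show ?thesis by (simp add: norm_mult)
  next
    case True
    then show ?thesis using BQ0 order_trans[OF norm_ge_zero F(2)[of w]] by simp
  qed
  note [measurable] = Q(1) g(1) F(1)
  have int: "integrable (PiM I M) (\<lambda>w. ?q w * F w)"
    using qb by (intro P.integrable_const_bound[where B="BQ * BF"]) auto
  have "(\<integral>w. (if \<forall>v\<in>V. g v w < w v then Q w * F (age_shift V g w) else 0) \<partial>PiM I M)
      = (\<integral>w. ?q w * F w \<partial>PiM I M)"
    by (rule memoryless_weight[OF V rate law Q g g0 F(1,2)]) auto
  also have "\<dots> = (\<integral>w. ?q w \<partial>PiM I M) * (\<integral>w. F w \<partial>PiM I M)"
    by (rule integral_indep[OF int qd F(3)]) auto
  also have "(\<integral>w. ?q w \<partial>PiM I M) = (\<integral>w. (if \<forall>v\<in>V. g v w < w v then Q w else 0) \<partial>PiM I M)"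
    by (subst memoryless_weight[OF V rate law Q g g0, where F="\<lambda>_. 1" and BF=1, simplified, symmetric]) (simp_all cong: if_cong)
  finally show ?thesis .
qed

lemma integral_prod_components:
  fixes f :: "'i \<Rightarrow> real \<Rightarrow> complex"
  assumes "finite J" "J \<subseteq> I" "\<And>i. i \<in> J \<Longrightarrow> f i \<in> borel_measurable borel"
    and "\<And>i. i \<in> J \<Longrightarrow> integrable (M i) (f i)"
  shows "(\<integral>w. (\<Prod>i\<in>J. f i (w i)) \<partial>PiM I M) = (\<Prod>i\<in>J. \<integral>x. f i x \<partial>M i)"
proof -
  have [measurable]: "i \<in> J \<Longrightarrow> f i \<in> borel_measurable (M i)" for i
    using assms(3) sets_M by (simp cong: measurable_cong_sets)
  have "P.indep_vars M (\<lambda>i w. w i) J"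
    by (rule P.indep_vars_subset[OF indep_coordinates assms(2)])
  then have ind: "P.indep_vars (\<lambda>_. borel) (\<lambda>i w. f i (w i)) J"
    by (rule P.indep_vars_compose2) simp
  have "(\<integral>w. (\<Prod>i\<in>J. f i (w i)) \<partial>PiM I M) = (\<Prod>i\<in>J. \<integral>w. f i (w i) \<partial>PiM I M)"
  proof (rule P.indep_vars_lebesgue_integral[OF assms(1) ind])
    fix i assume "i \<in> J"
    then have "integrable (distr (PiM I M) (M i) (\<lambda>w. w i)) (f i)"
      using assms PiM_component[of i] by auto
    then show "integrable (PiM I M) (\<lambda>w. f i (w i))"
      by (rule integrable_distr[rotated]) (use \<open>i \<in> J\<close> assms in auto)
  qed
  also have "\<dots> = (\<Prod>i\<in>J. \<integral>x. f i x \<partial>M i)"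
    using assms(2) by (intro prod.cong integral_component refl) auto
  finally show ?thesis .
qed

end

section \<open>The past of a sample path at the start of a stage\<close>

text \<open>
  The entry of a customer and the ends of its retrial intervals. For a customer present at time 0 the
  entry is no attempt, but counting it as point 0 lets retrial interval \<open>q\<close> run from point \<open>q\<close> to
  point \<open>q + 1\<close> for all customers alike.
\<close>
definition point :: "(nat \<Rightarrow> nat) \<Rightarrow> (source \<Rightarrow> real) \<Rightarrow> nat \<Rightarrow> nat \<Rightarrow> nat \<Rightarrow> real" where
  "point x0 w j c q = entry x0 w j c + (\<Sum>l<q. w (Retr j c l))"

text \<open>
  Interarrival and retrial intervals are clocks, which run from their start over their duration.
  The value 0 for the other sources is a dummy.
\<close>
fun start :: "(nat \<Rightarrow> nat) \<Rightarrow> source \<Rightarrow> (source \<Rightarrow> real) \<Rightarrow> real" where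
  "start x0 (Arr j n) w = (\<Sum>l<n. w (Arr j l))"
| "start x0 (Retr j c q) w = point x0 w j c q"
| "start x0 (Serv j c) w = 0"
| "start x0 (Switch k) w = 0"

lemma attempt_point: "attempt x0 w j c m = point x0 w j c (if c < x0 j then Suc m else m)"
  by (simp add: attempt_def point_def lessThan_Suc_atMost)

lemma ex_attempt_iff: "(\<exists>m. R (attempt x0 w j c m)) \<longleftrightarrow> (\<exists>q. (q = 0 \<longrightarrow> x0 j \<le> c) \<and> R (point x0 w j c q))"
proof
  assume "\<exists>m. R (attempt x0 w j c m)"
  then obtain m where m: "R (attempt x0 w j c m)" by (elim exE)
  define q where "q = (if c < x0 j then Suc m else m)"
  have "q = 0 \<longrightarrow> x0 j \<le> c" unfolding q_def by (cases "c < x0 j") simp_all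
  moreover have "R (point x0 w j c q)" using m unfolding attempt_point q_def .
  ultimately show "\<exists>q. (q = 0 \<longrightarrow> x0 j \<le> c) \<and> R (point x0 w j c q)"
    by (intro exI[of _ q] conjI)
next
  assume "\<exists>q. (q = 0 \<longrightarrow> x0 j \<le> c) \<and> R (point x0 w j c q)"
  then obtain q where q: "q = 0 \<longrightarrow> x0 j \<le> c" "R (point x0 w j c q)" by (elim exE conjE)
  define m where "m = (if c < x0 j then q - 1 else q)"
  have "(if c < x0 j then Suc m else m) = q" using q(1) by (cases q) (auto simp: m_def)
  then have "R (attempt x0 w j c m)" unfolding attempt_point using q(2) by simp
  then show "\<exists>m. R (attempt x0 w j c m)" by (rule exI)
qed

lemma entry_arr: "entry x0 w j (x0 j + n) = start x0 (Arr j (Suc n)) w"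
  by (simp add: entry_def lessThan_Suc_atMost)

lemma entry_old: "c < x0 j \<Longrightarrow> entry x0 w j c = 0"
  by (simp add: entry_def)

lemma point_Suc: "point x0 w j c (Suc q) = point x0 w j c q + w (Retr j c q)"
  by (simp add: point_def)

text \<open>
  The sources consumed by the start of stage \<open>k\<close> if there have been \<open>a j\<close> arrivals of type \<open>j\<close> and
  \<open>r j c\<close> retrial intervals of customer \<open>(j, c)\<close>, and the customers in \<open>J\<close> have joined.
\<close>
definition used :: "polling \<Rightarrow> (nat \<Rightarrow> nat) \<Rightarrow> (nat \<Rightarrow> nat \<Rightarrow> nat) \<Rightarrow> (nat \<times> nat) set \<Rightarrow> nat \<Rightarrow> source set" where
  "used P a r J k = {Arr j n |j n. n < a j} \<union> {Retr j c q |j c q. q < r j c} \<union> {Serv j c |j c. (j, c) \<in> J} \<union> Switch ` {..<k}"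

text \<open>
  The clocks that run at that time. Those of customers who have already joined are included: their
  later attempts are fictitious, but they are still part of the definition of the process.
\<close>
definition running :: "polling \<Rightarrow> (nat \<Rightarrow> nat) \<Rightarrow> (nat \<Rightarrow> nat) \<Rightarrow> (nat \<Rightarrow> nat \<Rightarrow> nat) \<Rightarrow> source set" where
  "running P x0 a r = (\<lambda>j. Arr j (a j)) ` {1..nq P} \<union> (\<Union>j\<in>{1..nq P}. (\<lambda>c. Retr j c (r j c)) ` {..<x0 j + a j})"

text \<open>
  The conditions on \<open>(a, r, J)\<close> which make the set of used sources finite, so that there are only
  countably many cases.
\<close>
definition snapshot :: "polling \<Rightarrow> (nat \<Rightarrow> nat) \<Rightarrow> (nat \<Rightarrow> nat) \<Rightarrow> (nat \<Rightarrow> nat \<Rightarrow> nat) \<Rightarrow> (nat \<times> nat) set \<Rightarrow> bool" where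
  "snapshot P x0 a r J \<longleftrightarrow> finite J \<and> (\<forall>j. j \<notin> {1..nq P} \<longrightarrow> a j = 0) \<and>
     (\<forall>j c. j \<notin> {1..nq P} \<or> x0 j + a j \<le> c \<longrightarrow> r j c = 0) \<and>
     (\<forall>(j, c)\<in>J. j \<in> {1..nq P} \<and> c < x0 j + a j)"

definition stage_time :: "polling \<Rightarrow> (nat \<times> nat) set \<Rightarrow> nat \<Rightarrow> (source \<Rightarrow> real) \<Rightarrow> real" where
  "stage_time P J k w = (\<Sum>l<k. glue P (queue P l)) + (\<Sum>(j, c)\<in>J. w (Serv j c)) + (\<Sum>l<k. w (Switch l))"

definition past :: "polling \<Rightarrow> (nat \<Rightarrow> nat) \<Rightarrow> (source \<Rightarrow> real) \<Rightarrow> nat \<Rightarrow> source set" where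
  "past P x0 w k = {Arr j n |j n. j \<in> {1..nq P} \<and> start x0 (Arr j n) w + w (Arr j n) \<le> fst (stage P x0 w k)}
     \<union> {Retr j c q |j c q. j \<in> {1..nq P} \<and> start x0 (Retr j c q) w + w (Retr j c q) \<le> fst (stage P x0 w k)}
     \<union> {Serv j c |j c. (j, c) \<in> snd (stage P x0 w k)} \<union> Switch ` {..<k}"

text \<open>
  Properties of almost all paths which ensure that only finitely many clocks ring in bounded time.
\<close>
definition regular :: "polling \<Rightarrow> (source \<Rightarrow> real) \<Rightarrow> bool" where
  "regular P w \<longleftrightarrow> (\<forall>s\<in>sources P. 0 \<le> w s) \<and>
     (\<forall>j\<in>{1..nq P}. (\<forall>n. 0 < w (Arr j n)) \<and> (\<forall>B. \<exists>n. B < (\<Sum>l<n. w (Arr j l))) \<and>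
       (\<forall>c. (\<forall>q. 0 < w (Retr j c q)) \<and> (\<forall>B. \<exists>n. B < (\<Sum>l<n. w (Retr j c l)))))"

text \<open>
  No clock rings exactly when stage \<open>k\<close> starts. Such a ring would belong to the past as the end of an
  interval, but to the new glue period as an attempt.
\<close>
definition untied :: "polling \<Rightarrow> (nat \<Rightarrow> nat) \<Rightarrow> (source \<Rightarrow> real) \<Rightarrow> nat \<Rightarrow> bool" where
  "untied P x0 w k \<longleftrightarrow> (\<forall>j\<in>{1..nq P}. \<forall>n. start x0 (Arr j (Suc n)) w \<noteq> fst (stage P x0 w k) \<and>
      (\<forall>c. start x0 (Retr j c (Suc n)) w \<noteq> fst (stage P x0 w k)))"

lemma sources_simps [simp]:
  "Arr j n \<in> sources P \<longleftrightarrow> j \<in> {1..nq P}" "Retr j c q \<in> sources P \<longleftrightarrow> j \<in> {1..nq P}"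
  "Serv j c \<in> sources P \<longleftrightarrow> j \<in> {1..nq P}" "Switch k \<in> sources P"
  unfolding sources_def by blast+

lemma used_simps [simp]:
  "Arr j n \<in> used P a r J k \<longleftrightarrow> n < a j" "Retr j c q \<in> used P a r J k \<longleftrightarrow> q < r j c"
  "Serv j c \<in> used P a r J k \<longleftrightarrow> (j, c) \<in> J" "Switch l \<in> used P a r J k \<longleftrightarrow> l < k"
  unfolding used_def by auto

lemma running_simps [simp]:
  "Arr j n \<in> running P x0 a r \<longleftrightarrow> j \<in> {1..nq P} \<and> n = a j"
  "Retr j c q \<in> running P x0 a r \<longleftrightarrow> j \<in> {1..nq P} \<and> c < x0 j + a j \<and> q = r j c"
  "Serv j c \<notin> running P x0 a r" "Switch l \<notin> running P x0 a r"
  unfolding running_def by auto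

lemma past_simps [simp]:
  "Arr j n \<in> past P x0 w k \<longleftrightarrow> j \<in> {1..nq P} \<and> start x0 (Arr j (Suc n)) w \<le> fst (stage P x0 w k)"
  "Retr j c q \<in> past P x0 w k \<longleftrightarrow> j \<in> {1..nq P} \<and> point x0 w j c (Suc q) \<le> fst (stage P x0 w k)"
  "Serv j c \<in> past P x0 w k \<longleftrightarrow> (j, c) \<in> snd (stage P x0 w k)" "Switch l \<in> past P x0 w k \<longleftrightarrow> l < k"
  unfolding past_def by (auto simp: point_Suc)

lemma finite_running: "finite (running P x0 a r)"
  unfolding running_def by auto

lemma running_sources: "running P x0 a r \<subseteq> sources P"
  unfolding running_def by auto

lemma running_used_disjoint: "running P x0 a r \<inter> used P a r J k = {}"
  unfolding running_def by auto

lemma used_inject: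
  assumes "used P a r J k = used P a' r' J' k"
  shows "a = a'" "r = r'" "J = J'"
proof -
  have *: "\<And>s. s \<in> used P a r J k \<longleftrightarrow> s \<in> used P a' r' J' k" using assms by simp
  show "a = a'"
  proof
    fix j show "a j = a' j" using *[of "Arr j (a j)"] *[of "Arr j (a' j)"] by simp
  qed
  show "r = r'"
  proof (intro ext)
    fix j c show "r j c = r' j c" using *[of "Retr j c (r j c)"] *[of "Retr j c (r' j c)"] by simp
  qed
  show "J = J'" using *[of "Serv _ _"] by (auto simp: set_eq_iff)
qed

lemma finite_used:
  assumes "snapshot P x0 a r J" shows "finite (used P a r J k)"
proof -
  have "used P a r J k \<subseteq> (\<Union>j\<in>{1..nq P}. Arr j ` {..<a j}) \<union> (\<Union>j\<in>{1..nq P}. \<Union>c\<in>{..<x0 j + a j}. Retr j c ` {..<r j c})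
    \<union> (\<lambda>(j,c). Serv j c) ` J \<union> Switch ` {..<k}"
  proof
    fix s assume s: "s \<in> used P a r J k"
    note S = assms[unfolded snapshot_def]
    show "s \<in> (\<Union>j\<in>{1..nq P}. Arr j ` {..<a j}) \<union> (\<Union>j\<in>{1..nq P}. \<Union>c\<in>{..<x0 j + a j}. Retr j c ` {..<r j c})
    \<union> (\<lambda>(j,c). Serv j c) ` J \<union> Switch ` {..<k}"
    proof (cases s)
      case (Arr j n)
      with s have "n < a j" by simp
      moreover from this S have "j \<in> {1..nq P}" by (metis not_less0)
      ultimately have "n < a j" "j \<in> {1..nq P}" by auto
      then show ?thesis using Arr by blast
    next
      case (Retr j c q)
      with s have q: "q < r j c" by simp
      then have "r j c \<noteq> 0" by simp
      with S have "j \<in> {1..nq P}" "c < x0 j + a j" by (meson not_le)+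
      then show ?thesis using Retr q by blast
    next
      case (Serv j c)
      then show ?thesis using s by force
    next
      case (Switch l)
      then show ?thesis using s by auto
    qed
  qed
  moreover have "finite \<dots>" using assms by (auto simp: snapshot_def)
  ultimately show ?thesis by (rule finite_subset)
qed

locale polling_system =
  fixes P :: polling and x0 :: "nat \<Rightarrow> nat"
  assumes valid: "valid_polling P"
begin

abbreviation "types \<equiv> {1..nq P}"

lemma queue_types: "queue P k \<in> types"
  using valid by (auto simp: valid_polling_def queue_def Suc_le_eq)

lemma glue_pos: "j \<in> types \<Longrightarrow> 0 < glue P j"
  using valid by (auto simp: valid_polling_def)

definition joining :: "(source \<Rightarrow> real) \<Rightarrow> nat \<Rightarrow> nat set" where
  "joining w k = {c. (queue P k, c) \<notin> snd (stage P x0 w k) \<and>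
     (\<exists>m. fst (stage P x0 w k) \<le> attempt x0 w (queue P k) c m \<and>
        attempt x0 w (queue P k) c m < fst (stage P x0 w k) + glue P (queue P k))}"

lemma stage_Suc:
  "stage P x0 w (Suc k) = (fst (stage P x0 w k) + glue P (queue P k) + (\<Sum>c\<in>joining w k. w (Serv (queue P k) c)) + w (Switch k),
     snd (stage P x0 w k) \<union> {queue P k} \<times> joining w k)"
  by (simp add: joining_def Let_def case_prod_beta)

declare stage.simps(2) [simp del]

lemma stage_types: "(j, c) \<in> snd (stage P x0 w k) \<Longrightarrow> j \<in> types"
  by (induction k) (use queue_types in \<open>auto simp: stage_Suc\<close>)

lemma stage_finite_mono: "l \<le> k \<Longrightarrow> snd (stage P x0 w l) \<subseteq> snd (stage P x0 w k)"
  by (induction rule: dec_induct) (auto simp: stage_Suc)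

lemma fst_stage:
  assumes "finite (snd (stage P x0 w k))"
  shows "fst (stage P x0 w k) = stage_time P (snd (stage P x0 w k)) k w"
  using assms
proof (induction k)
  case 0
  then show ?case by (simp add: stage_time_def)
next
  case (Suc k)
  let ?i = "queue P k"
  have fin: "finite (snd (stage P x0 w k))" and fin2: "finite ({?i} \<times> joining w k)"
    using Suc.prems by (auto simp: stage_Suc)
  have "snd (stage P x0 w k) \<inter> ({?i} \<times> joining w k) = {}"
    by (auto simp: joining_def)
  then have "(\<Sum>(j, c)\<in>snd (stage P x0 w (Suc k)). w (Serv j c))
    = (\<Sum>(j, c)\<in>snd (stage P x0 w k). w (Serv j c)) + (\<Sum>c\<in>joining w k. w (Serv ?i c))"
    using fin fin2 by (simp add: stage_Suc sum.union_disjoint sum.cartesian_product[symmetric])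
  then show ?case
    using Suc.IH[OF fin] by (simp add: stage_Suc stage_time_def algebra_simps)
qed

context
  fixes w :: "source \<Rightarrow> real" assumes nonneg: "\<forall>s\<in>sources P. 0 \<le> w s"
begin

lemma stage_step_le: "fst (stage P x0 w k) + glue P (queue P k) \<le> fst (stage P x0 w (Suc k))"
  using queue_types nonneg by (auto simp: stage_Suc intro!: add_nonneg_nonneg sum_nonneg)

lemma stage_mono: "l \<le> k \<Longrightarrow> fst (stage P x0 w l) \<le> fst (stage P x0 w k)"
proof (induction rule: dec_induct)
  case (step n)
  then show ?case using stage_step_le[of n] glue_pos[OF queue_types, of n] by linarith
qed simp

lemma stage_nonneg: "0 \<le> fst (stage P x0 w k)"
  using stage_mono[of 0 k] by simp

lemma start_Arr_mono: "j \<in> types \<Longrightarrow> n \<le> n' \<Longrightarrow> start x0 (Arr j n) w \<le> start x0 (Arr j n') w"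
  using nonneg by (auto intro!: sum_mono2)

lemma point_mono: "j \<in> types \<Longrightarrow> q \<le> q' \<Longrightarrow> point x0 w j c q \<le> point x0 w j c q'"
  using nonneg by (auto simp: point_def intro!: sum_mono2)

lemma entry_mono: "j \<in> types \<Longrightarrow> c \<le> c' \<Longrightarrow> entry x0 w j c \<le> entry x0 w j c'"
  using nonneg by (auto simp: entry_def intro!: sum_mono2 sum_nonneg)

lemma entry_le_point: "j \<in> types \<Longrightarrow> entry x0 w j c \<le> point x0 w j c q"
  using point_mono[of j 0 q c] by (simp add: point_def)

lemma entry_nonneg: "j \<in> types \<Longrightarrow> 0 \<le> entry x0 w j c"
  using nonneg by (auto simp: entry_def intro!: sum_nonneg)

lemma start_nonneg: "s \<in> sources P \<Longrightarrow> 0 \<le> start x0 s w"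
proof (cases s)
  case (Retr j c q)
  assume "s \<in> sources P"
  then have "j \<in> types" using Retr by simp
  from entry_le_point[OF this, of c q] entry_nonneg[OF this, of c] show "0 \<le> start x0 s w"
    using Retr by simp
qed (use nonneg in \<open>auto intro!: sum_nonneg\<close>)

text \<open>
  A point up to time \<open>T\<close> is built from used sources only, because the running clocks ring after \<open>T\<close>.
\<close>
lemma point_before:
  assumes run: "\<forall>v\<in>running P x0 a r. T < start x0 v w + w v"
    and j: "j \<in> types" and le: "point x0 w j c q \<le> T"
  shows "c < x0 j + a j" "q \<le> r j c"
proof -
  show c: "c < x0 j + a j"
  proof (rule ccontr)
    assume "\<not> ?thesis"
    then have "start x0 (Arr j (Suc (a j))) w \<le> entry x0 w j c"
      using entry_mono[of j "x0 j + a j" c] j unfolding entry_arr by simp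
    moreover have "T < start x0 (Arr j (Suc (a j))) w"
      using bspec[OF run, of "Arr j (a j)"] j by simp
    ultimately show False using entry_le_point[OF j, of c q] le by linarith
  qed
  show "q \<le> r j c"
  proof (rule ccontr)
    assume "\<not> ?thesis"
    then have "point x0 w j c (Suc (r j c)) \<le> point x0 w j c q"
      by (intro point_mono j) simp
    moreover have "T < point x0 w j c (Suc (r j c))"
      using bspec[OF run, of "Retr j c (r j c)"] j c by (simp add: point_Suc)
    ultimately show False using le by linarith
  qed
qed

end

lemma entry_used:
  assumes "\<forall>s\<in>used P a r J k. w s = w' s" "c < x0 j + a j"
  shows "entry x0 w j c = entry x0 w' j c"
  unfolding entry_def using assms by (auto intro!: sum.cong)

lemma point_used:
  assumes "\<forall>s\<in>used P a r J k. w s = w' s" "c < x0 j + a j" "q \<le> r j c"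
  shows "point x0 w j c q = point x0 w' j c q"
  using entry_used[OF assms(1,2)] assms(1,3) unfolding point_def by (auto intro!: sum.cong)

lemma start_used:
  assumes "\<forall>s\<in>used P a r J k. w s = w' s" "v \<in> running P x0 a r"
  shows "start x0 v w = start x0 v w'"
  using assms(2) point_used[OF assms(1)] assms(1)
  by (cases v) (auto intro!: sum.cong)

lemma stage_time_used:
  assumes "\<forall>s\<in>used P a r J k. w s = w' s"
  shows "stage_time P J k w = stage_time P J k w'"
proof -
  have "(\<Sum>(j, c)\<in>J. w (Serv j c)) = (\<Sum>(j, c)\<in>J. w' (Serv j c))"
    using assms by (intro sum.cong) auto
  moreover have "(\<Sum>l<k. w (Switch l)) = (\<Sum>l<k. w' (Switch l))"
    using assms by (intro sum.cong) auto
  ultimately show ?thesis by (simp add: stage_time_def)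
qed

text \<open>
  If two paths agree on the used sources and the running clocks of both ring after the start of
  stage \<open>k\<close>, then they have the same attempts before that time, hence the same stages.
\<close>
lemma stage_determined:
  assumes nn: "\<forall>s\<in>sources P. 0 \<le> w s" "\<forall>s\<in>sources P. 0 \<le> w' s"
    and eq: "\<forall>s\<in>used P a r J k. w s = w' s"
    and J: "snd (stage P x0 w' k) = J" "finite J"
    and run: "\<forall>v\<in>running P x0 a r. stage_time P J k w < start x0 v w + w v"
      "\<forall>v\<in>running P x0 a r. stage_time P J k w < start x0 v w' + w' v"
    and l: "l \<le> k"
  shows "stage P x0 w l = stage P x0 w' l"
  using l
proof (induction l)
  case (Suc l)
  let ?i = "queue P l" and ?T = "stage_time P J k w"
  have IH: "stage P x0 w l = stage P x0 w' l" using Suc by simp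
  define t where "t = fst (stage P x0 w' l)"
  have tG: "t + glue P ?i \<le> ?T"
  proof -
    have "t + glue P ?i \<le> fst (stage P x0 w' (Suc l))" unfolding t_def by (rule stage_step_le[OF nn(2)])
    also have "\<dots> \<le> fst (stage P x0 w' k)" by (rule stage_mono[OF nn(2) Suc.prems])
    also have "\<dots> = stage_time P J k w'" using fst_stage[of w' k] J by simp
    finally show ?thesis using stage_time_used[OF eq] by simp
  qed
  have pt: "point x0 w ?i c q = point x0 w' ?i c q"
    if "point x0 w ?i c q \<le> ?T \<or> point x0 w' ?i c q \<le> ?T" for c q
  proof -
    have "c < x0 ?i + a ?i" "q \<le> r ?i c"
      using that point_before[OF nn(1) run(1) queue_types, of l c q] point_before[OF nn(2) run(2) queue_types, of l c q]
      by blast+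
    from point_used[OF eq this] show ?thesis by simp
  qed
  have pt': "t \<le> point x0 w ?i c q \<and> point x0 w ?i c q < t + glue P ?i \<longleftrightarrow>
      t \<le> point x0 w' ?i c q \<and> point x0 w' ?i c q < t + glue P ?i" for c q
    using pt[of c q] tG by linarith
  have jw: "joining w l = joining w' l"
    unfolding joining_def IH t_def[symmetric] ex_attempt_iff[of "\<lambda>x. t \<le> x \<and> x < t + glue P ?i"] pt' ..
  have "joining w' l \<subseteq> {c. (?i, c) \<in> J}"
    using stage_finite_mono[OF Suc.prems, of w'] J(1) by (auto simp: stage_Suc)
  then have "(\<Sum>c\<in>joining w' l. w (Serv ?i c)) = (\<Sum>c\<in>joining w' l. w' (Serv ?i c))"
    using eq by (intro sum.cong) auto
  moreover have "w (Switch l) = w' (Switch l)" using bspec[OF eq, of "Switch l"] Suc.prems by simp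
  ultimately show ?case by (simp add: stage_Suc IH jw)
qed simp

lemma regular_nonneg: "regular P w \<Longrightarrow> \<forall>s\<in>sources P. 0 \<le> w s"
  by (simp add: regular_def)

lemma regular_Arr: "regular P w \<Longrightarrow> j \<in> types \<Longrightarrow> 0 < w (Arr j n)"
  by (simp add: regular_def)

lemma regular_Retr: "regular P w \<Longrightarrow> j \<in> types \<Longrightarrow> 0 < w (Retr j c n)"
  by (simp add: regular_def)

lemma regular_Arr_unbounded: "regular P w \<Longrightarrow> j \<in> types \<Longrightarrow> \<exists>n. B < start x0 (Arr j n) w"
  by (auto simp: regular_def)

lemma regular_point_unbounded: 
  assumes "regular P w" "j \<in> types" shows "\<exists>q. B < point x0 w j c q"
proof -
  obtain q where "B < (\<Sum>l<q. w (Retr j c l))" using assms unfolding regular_def by blast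
  moreover have "0 \<le> entry x0 w j c" by (rule entry_nonneg[OF regular_nonneg[OF assms(1)] assms(2)])
  ultimately have "B < point x0 w j c q" by (simp add: point_def)
  then show ?thesis by blast
qed

text \<open>
  The path is in the situation \<open>(a, r, J)\<close> at the start of stage \<open>k\<close>. The alternative
  \<open>start x0 v w = 0\<close> is for clocks that run since time 0, as all of them do when \<open>k = 0\<close>.
\<close>
definition in_progress :: "(nat \<Rightarrow> nat) \<Rightarrow> (nat \<Rightarrow> nat \<Rightarrow> nat) \<Rightarrow> (nat \<times> nat) set \<Rightarrow> nat \<Rightarrow> (source \<Rightarrow> real) \<Rightarrow> bool" where
  "in_progress a r J k w \<longleftrightarrow> stage P x0 w k = (stage_time P J k w, J) \<and>
     (\<forall>v\<in>running P x0 a r. (start x0 v w = 0 \<or> start x0 v w < stage_time P J k w) \<and>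
        stage_time P J k w < start x0 v w + w v)"

lemma finite_entries:
  assumes "regular P w" "j \<in> types" shows "finite {c. entry x0 w j c \<le> t}"
proof -
  obtain n where n: "t < start x0 (Arr j n) w" using regular_Arr_unbounded[OF assms] by blast
  have "c < x0 j + n" if "entry x0 w j c \<le> t" for c
  proof (rule ccontr)
    assume "\<not> ?thesis"
    then have "entry x0 w j (x0 j + n) \<le> t"
      using entry_mono[OF regular_nonneg[OF assms(1)] assms(2), of "x0 j + n" c] that by simp
    then show False using n start_Arr_mono[OF regular_nonneg[OF assms(1)] assms(2), of n "Suc n"]
      unfolding entry_arr by simp
  qed
  then have "{c. entry x0 w j c \<le> t} \<subseteq> {..<x0 j + n}" by blast
  then show ?thesis by (rule finite_subset) simp
qed

lemma joining_entry:
  assumes "regular P w" "c \<in> joining w k"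
  shows "entry x0 w (queue P k) c < fst (stage P x0 w k) + glue P (queue P k)"
proof -
  obtain m where "attempt x0 w (queue P k) c m < fst (stage P x0 w k) + glue P (queue P k)"
    using assms(2) by (auto simp: joining_def)
  then show ?thesis
    unfolding attempt_point using entry_le_point[OF regular_nonneg[OF assms(1)] queue_types]
    by (meson le_less_trans)
qed

lemma stage_entry:
  assumes "regular P w"
  shows "snd (stage P x0 w k) \<subseteq> (SIGMA j:types. {c. entry x0 w j c \<le> fst (stage P x0 w k)})"
proof (induction k)
  case (Suc k)
  have le: "fst (stage P x0 w k) + glue P (queue P k) \<le> fst (stage P x0 w (Suc k))"
    by (rule stage_step_le[OF regular_nonneg[OF assms]])
  show ?case
  proof (rule subrelI)
    fix j c assume *: "(j, c) \<in> snd (stage P x0 w (Suc k))"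
    have "entry x0 w j c \<le> fst (stage P x0 w (Suc k))"
    proof (cases "(j, c) \<in> snd (stage P x0 w k)")
      case True
      then have "entry x0 w j c \<le> fst (stage P x0 w k)" using Suc by blast
      then show ?thesis using le glue_pos[OF queue_types, of k] by linarith
    next
      case False
      then have "j = queue P k" "c \<in> joining w k" using * by (auto simp: stage_Suc)
      then show ?thesis using joining_entry[OF assms, of c k] le by simp
    qed
    then show "(j, c) \<in> (SIGMA j:types. {c. entry x0 w j c \<le> fst (stage P x0 w (Suc k))})"
      using stage_types[OF *] by simp
  qed
qed simp

lemma finite_stage: "regular P w \<Longrightarrow> finite (snd (stage P x0 w k))"
  by (rule finite_subset[OF stage_entry]) (auto intro!: finite_entries)

text \<open>
  Take for \<open>a\<close> and \<open>r\<close> the numbers of clocks that have rung; they are finite on regular paths, and on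
  untied paths no such clock rings at the start of the stage itself.
\<close>
lemma in_progress_exists:
  assumes reg: "regular P w" and unt: "untied P x0 w k"
  obtains a r J where "snapshot P x0 a r J" "in_progress a r J k w"
proof -
  note nn = regular_nonneg[OF reg]
  define t J where "t = fst (stage P x0 w k)" and "J = snd (stage P x0 w k)"
  have t: "t = stage_time P J k w" unfolding t_def J_def by (rule fst_stage[OF finite_stage[OF reg]])
  define a where "a j = (if j \<in> types then LEAST n. t < start x0 (Arr j (Suc n)) w else 0)" for j
  define r where "r j c = (if j \<in> types \<and> c < x0 j + a j then LEAST q. t < point x0 w j c (Suc q) else 0)" for j c
  have a1: "t < start x0 (Arr j (Suc (a j))) w" if j: "j \<in> types" for j
  proof -
    obtain n where "t < start x0 (Arr j n) w" using regular_Arr_unbounded[OF reg j] by blast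
    then have "t < start x0 (Arr j (Suc n)) w" using start_Arr_mono[OF nn j, of n "Suc n"] by simp
    then have "t < start x0 (Arr j (Suc (LEAST n. t < start x0 (Arr j (Suc n)) w))) w" by (rule LeastI)
    then show ?thesis using j unfolding a_def by simp
  qed
  have a2: "start x0 (Arr j (Suc n)) w < t" if j: "j \<in> types" and n: "n < a j" for j n
  proof -
    have "\<not> t < start x0 (Arr j (Suc n)) w" using n j unfolding a_def by (auto dest: not_less_Least)
    moreover have "start x0 (Arr j (Suc n)) w \<noteq> t" using unt j unfolding untied_def t_def by blast
    ultimately show ?thesis by linarith
  qed
  have c_less: "c < x0 j + a j \<longleftrightarrow> entry x0 w j c \<le> t" if j: "j \<in> types" for j c
  proof
    assume c: "c < x0 j + a j"
    show "entry x0 w j c \<le> t"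
    proof (cases "c < x0 j")
      case True
      then show ?thesis using stage_nonneg[OF nn, of k] by (simp add: entry_old t_def)
    next
      case False
      then have "entry x0 w j c = start x0 (Arr j (Suc (c - x0 j))) w" using entry_arr[of x0 w j "c - x0 j"] by simp
      also have "\<dots> < t" using False c by (intro a2 j) auto
      finally show ?thesis by simp
    qed
  next
    assume le: "entry x0 w j c \<le> t"
    show "c < x0 j + a j"
    proof (rule ccontr)
      assume "\<not> ?thesis"
      then have "entry x0 w j (x0 j + a j) \<le> t"
        using entry_mono[OF nn j, of "x0 j + a j" c] le by simp
      then show False using a1[OF j] unfolding entry_arr by simp
    qed
  qed
  have r1: "t < point x0 w j c (Suc (r j c))" if j: "j \<in> types" "c < x0 j + a j" for j c
  proof -
    obtain q where "t < point x0 w j c q" using regular_point_unbounded[OF reg j(1)] by blast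
    then have "t < point x0 w j c (Suc q)" using point_mono[OF nn j(1), of q "Suc q" c] by simp
    then have "t < point x0 w j c (Suc (LEAST q. t < point x0 w j c (Suc q)))" by (rule LeastI)
    then show ?thesis using j by (simp add: r_def)
  qed
  have r2: "point x0 w j c (Suc q) < t" if j: "j \<in> types" "c < x0 j + a j" and q: "q < r j c" for j c q
  proof -
    have "\<not> t < point x0 w j c (Suc q)" using q j unfolding r_def by (auto dest: not_less_Least)
    moreover have "point x0 w j c (Suc q) \<noteq> t" using unt j unfolding untied_def t_def by auto
    ultimately show ?thesis by linarith
  qed
  have st: "start x0 v w = 0 \<or> start x0 v w < t" if v: "v \<in> running P x0 a r" for v
  proof (cases v)
    case (Arr j n)
    then have jn: "j \<in> types" "n = a j" using v by auto
    show ?thesis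
    proof (cases "a j")
      case (Suc m)
      then show ?thesis using a2[OF jn(1), of m] jn Arr by auto
    qed (use jn Arr in auto)
  next
    case (Retr j c q)
    then have jn: "j \<in> types" "c < x0 j + a j" "q = r j c" using v by auto
    show ?thesis
    proof (cases "r j c")
      case (Suc m)
      then show ?thesis using r2[OF jn(1,2), of m] jn Retr by auto
    next
      case 0
      then have s: "start x0 v w = entry x0 w j c" using Retr jn by (simp add: point_def)
      show ?thesis
      proof (cases "c < x0 j")
        case True
        then show ?thesis by (simp add: s entry_old)
      next
        case False
        then have "entry x0 w j c = start x0 (Arr j (Suc (c - x0 j))) w" using entry_arr[of x0 w j "c - x0 j"] by simp
        also have "\<dots> < t" using False jn by (intro a2 jn) auto
        finally show ?thesis by (simp add: s)
      qed
    qed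
  qed (use v in auto)
  have en: "t < start x0 v w + w v" if v: "v \<in> running P x0 a r" for v
  proof (cases v)
    case (Arr j n)
    then show ?thesis using v a1[of j] by auto
  next
    case (Retr j c q)
    then show ?thesis using v r1[of j c] by (auto simp: point_Suc)
  qed (use v in auto)
  have "\<forall>(j, c)\<in>J. j \<in> types \<and> c < x0 j + a j"
  proof (intro ballI, clarify)
    fix j c assume "(j, c) \<in> J"
    then have "j \<in> types" "entry x0 w j c \<le> t" using stage_entry[OF reg, of k] by (auto simp: J_def t_def)
    then show "j \<in> types \<and> c < x0 j + a j" using c_less by blast
  qed
  moreover have "\<forall>j. j \<notin> types \<longrightarrow> a j = 0" by (simp add: a_def)
  moreover have "\<forall>j c. j \<notin> types \<or> x0 j + a j \<le> c \<longrightarrow> r j c = 0" by (auto simp: r_def)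
  ultimately have "snapshot P x0 a r J"
    unfolding snapshot_def using finite_stage[OF reg, of k] by (simp add: J_def)
  moreover have "in_progress a r J k w"
    unfolding in_progress_def t[symmetric] using st en by (auto simp: t_def J_def)
  ultimately show ?thesis by (rule that)
qed

lemma in_progress_past:
  assumes reg: "regular P w" and snap: "snapshot P x0 a r J" and ip: "in_progress a r J k w"
  shows "past P x0 w k = used P a r J k"
proof -
  note nn = regular_nonneg[OF reg]
  let ?T = "stage_time P J k w"
  have T: "fst (stage P x0 w k) = ?T" "snd (stage P x0 w k) = J" using ip by (auto simp: in_progress_def)
  have T0: "0 \<le> ?T" using stage_nonneg[OF nn, of k] T by simp
  have run1: "start x0 v w \<le> ?T" if "v \<in> running P x0 a r" for v
  proof -
    have "(start x0 v w = 0 \<or> start x0 v w < ?T) \<and> ?T < start x0 v w + w v"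
      using ip that unfolding in_progress_def by blast
    then show "start x0 v w \<le> ?T" using T0 by auto
  qed
  have run: "\<forall>v\<in>running P x0 a r. ?T < start x0 v w + w v" using ip by (simp add: in_progress_def)
  have "s \<in> past P x0 w k \<longleftrightarrow> s \<in> used P a r J k" for s
  proof (cases s)
    case (Arr j n)
    show ?thesis
    proof (cases "j \<in> types")
      case True
      have "start x0 (Arr j (Suc n)) w \<le> ?T \<longleftrightarrow> n < a j"
      proof
        assume *: "start x0 (Arr j (Suc n)) w \<le> ?T"
        show "n < a j"
        proof (rule ccontr)
          assume "\<not> ?thesis"
          then have "start x0 (Arr j (Suc (a j))) w \<le> start x0 (Arr j (Suc n)) w"
            by (intro start_Arr_mono[OF nn True]) auto
          then show False using * bspec[OF run, of "Arr j (a j)"] True by simp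
        qed
      next
        assume "n < a j"
        then have "start x0 (Arr j (Suc n)) w \<le> start x0 (Arr j (a j)) w"
          by (intro start_Arr_mono[OF nn True]) auto
        then show "start x0 (Arr j (Suc n)) w \<le> ?T" using run1[of "Arr j (a j)"] True by simp
      qed
      then show ?thesis using Arr True T by (simp del: start.simps)
    next
      case False
      then have "a j = 0" using snap unfolding snapshot_def by blast
      with False show ?thesis using Arr by (auto simp del: start.simps)
    qed
  next
    case (Retr j c q)
    show ?thesis
    proof (cases "j \<in> types \<and> c < x0 j + a j")
      case True
      then have j: "j \<in> types" and c: "c < x0 j + a j" by auto
      have "point x0 w j c (Suc q) \<le> ?T \<longleftrightarrow> q < r j c"
      proof
        assume *: "point x0 w j c (Suc q) \<le> ?T"
        show "q < r j c"
          using point_before(2)[OF nn run j *] by simp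
      next
        assume "q < r j c"
        then have "point x0 w j c (Suc q) \<le> point x0 w j c (r j c)"
          by (intro point_mono[OF nn j]) auto
        then show "point x0 w j c (Suc q) \<le> ?T" using run1[of "Retr j c (r j c)"] j c by simp
      qed
      then show ?thesis using Retr j T by simp
    next
      case False
      then have "r j c = 0" using snap unfolding snapshot_def by (meson not_le)
      moreover have "\<not> point x0 w j c (Suc q) \<le> ?T" if "j \<in> types"
        using point_before(1)[OF nn run that, of c "Suc q"] False that by blast
      ultimately show ?thesis using Retr T by auto
    qed
  qed (use T in auto)
  then show ?thesis by blast
qed

text \<open>
  A path with the given past on which all other clocks ring too late to matter for the first \<open>k\<close>
  stages. Through it, these stages become a function of the used sources.
\<close>
definition stopped :: "(nat \<Rightarrow> nat) \<Rightarrow> (nat \<Rightarrow> nat \<Rightarrow> nat) \<Rightarrow> (nat \<times> nat) set \<Rightarrow> nat \<Rightarrow> (source \<Rightarrow> real) \<Rightarrow> source \<Rightarrow> real" where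
  "stopped a r J k w = (\<lambda>s. if s \<in> used P a r J k then w s else 1 + stage_time P J k w)"

text \<open>
  What \<open>in_progress\<close> says about the used sources alone.
\<close>
definition past_cond :: "(nat \<Rightarrow> nat) \<Rightarrow> (nat \<Rightarrow> nat \<Rightarrow> nat) \<Rightarrow> (nat \<times> nat) set \<Rightarrow> nat \<Rightarrow> (source \<Rightarrow> real) \<Rightarrow> bool" where
  "past_cond a r J k w \<longleftrightarrow> 0 \<le> stage_time P J k w \<and>
     (\<forall>v\<in>running P x0 a r. start x0 v w = 0 \<or> start x0 v w < stage_time P J k w) \<and>
     snd (stage P x0 (stopped a r J k w) k) = J"

text \<open>
  The situation at the start of stage \<open>k\<close> splits into a condition on the used sources and the
  survival of the running clocks up to their ages. This is the event to which \<open>memoryless\<close> applies.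
\<close>
lemma in_progress_iff:
  assumes reg: "regular P w" and snap: "snapshot P x0 a r J"
  shows "in_progress a r J k w \<longleftrightarrow> past_cond a r J k w \<and>
    (\<forall>v\<in>running P x0 a r. stage_time P J k w - start x0 v w < w v)"
proof -
  note nn = regular_nonneg[OF reg]
  let ?T = "stage_time P J k w" and ?w = "stopped a r J k w"
  have finJ: "finite J" using snap by (simp add: snapshot_def)
  have T0: "0 \<le> ?T"
  proof -
    have "(\<Sum>(j, c)\<in>J. w (Serv j c)) \<ge> 0" using snap nn by (auto simp: snapshot_def intro!: sum_nonneg)
    moreover have "(\<Sum>l<k. glue P (queue P l)) \<ge> 0" by (intro sum_nonneg less_imp_le glue_pos queue_types)
    moreover have "(\<Sum>l<k. w (Switch l)) \<ge> 0" using nn by (auto intro!: sum_nonneg)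
    ultimately show ?thesis unfolding stage_time_def by linarith
  qed
  have nn': "\<forall>s\<in>sources P. 0 \<le> ?w s" using nn T0 by (auto simp: stopped_def)
  have eq: "\<forall>s\<in>used P a r J k. w s = ?w s" and eq': "\<forall>s\<in>used P a r J k. ?w s = w s" by (simp_all add: stopped_def)
  \<comment> \<open>the other coordinates of the stopped path exceed the start of the stage by 1\<close>
  have run': "?T < start x0 v ?w + ?w v" if v: "v \<in> running P x0 a r" for v
  proof -
    have "v \<notin> used P a r J k" using v running_used_disjoint by blast
    then have "?w v = 1 + ?T" by (simp add: stopped_def)
    moreover have "0 \<le> start x0 v ?w" using start_nonneg[OF nn'] v running_sources by blast
    ultimately show ?thesis by linarith
  qed
  show ?thesis
  proof
    assume ip: "in_progress a r J k w"
    have "stage P x0 ?w k = stage P x0 w k"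
    proof (rule stage_determined[OF nn' nn eq' _ finJ])
      show "\<forall>v\<in>running P x0 a r. stage_time P J k ?w < start x0 v ?w + ?w v"
        using run' stage_time_used[OF eq] by simp
      show "\<forall>v\<in>running P x0 a r. stage_time P J k ?w < start x0 v w + w v"
        using ip stage_time_used[OF eq] unfolding in_progress_def by simp
    qed (use ip in \<open>auto simp: in_progress_def\<close>)
    then show "past_cond a r J k w \<and> (\<forall>v\<in>running P x0 a r. ?T - start x0 v w < w v)"
      using ip T0 by (auto simp: in_progress_def past_cond_def)
  next
    assume *: "past_cond a r J k w \<and> (\<forall>v\<in>running P x0 a r. ?T - start x0 v w < w v)"
    have st: "stage P x0 w k = stage P x0 ?w k"
    proof (rule stage_determined[OF nn nn' eq _ finJ])
      show "\<forall>v\<in>running P x0 a r. ?T < start x0 v ?w + ?w v" using run' by blast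
      show "\<forall>v\<in>running P x0 a r. ?T < start x0 v w + w v" using * by force
    qed (use * in \<open>auto simp: past_cond_def\<close>)
    have J: "snd (stage P x0 w k) = J" using * st by (simp add: past_cond_def)
    then have "fst (stage P x0 w k) = ?T" using fst_stage[of w k] finJ by simp
    with J have "stage P x0 w k = (?T, J)" by (metis prod.collapse)
    then show "in_progress a r J k w" unfolding in_progress_def using * by (force simp: past_cond_def)
  qed
qed

text \<open>
  The situations correspond to the values of \<open>past\<close>, which partition the regular untied paths.
\<close>
lemma past_eq_used_iff:
  assumes reg: "regular P w" and unt: "untied P x0 w k" and snap: "snapshot P x0 a r J"
  shows "past P x0 w k = used P a r J k \<longleftrightarrow> in_progress a r J k w"
proof
  assume *: "past P x0 w k = used P a r J k"
  obtain a' r' J' where s: "snapshot P x0 a' r' J'" "in_progress a' r' J' k w"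
    using in_progress_exists[OF reg unt] by blast
  have "used P a r J k = used P a' r' J' k" using in_progress_past[OF reg s] * by simp
  from used_inject[OF this] show "in_progress a r J k w" using s by simp
qed (rule in_progress_past[OF reg snap])

end

section \<open>One stage of a sample path\<close>

lemma initial_segment:
  fixes A :: "nat set"
  assumes "finite A" and down: "\<And>m n. n \<in> A \<Longrightarrow> m \<le> n \<Longrightarrow> m \<in> A"
  shows "A = {..<card A}"
proof -
  define m where "m = (LEAST n. n \<notin> A)"
  have "\<exists>n. n \<notin> A" using assms(1) ex_new_if_finite[OF infinite_UNIV_nat] by blast
  then have m: "m \<notin> A" unfolding m_def by (rule LeastI_ex)
  have "A = {..<m}"
  proof (intro equalityI subsetI)
    fix n assume "n \<in> A"
    then show "n \<in> {..<m}" using down[of n m] m by (cases "n < m") auto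
  next
    fix n assume "n \<in> {..<m}"
    then show "n \<in> A" using not_less_Least[of n "\<lambda>n. n \<notin> A"] by (auto simp: m_def)
  qed
  then show ?thesis by simp
qed

definition renewals :: "(nat \<Rightarrow> real) \<Rightarrow> real \<Rightarrow> nat" where
  "renewals x \<tau> = card {n. (\<Sum>l\<le>n. x l) \<le> \<tau>}"

definition renewals_before :: "(nat \<Rightarrow> real) \<Rightarrow> real \<Rightarrow> nat" where
  "renewals_before x \<tau> = card {n. (\<Sum>l\<le>n. x l) < \<tau>}"

definition new_arrivals :: "(nat \<Rightarrow> nat) \<Rightarrow> nat \<Rightarrow> real \<Rightarrow> (source \<Rightarrow> real) \<Rightarrow> nat" where
  "new_arrivals a j \<tau> w = renewals (\<lambda>l. w (Arr j (a j + l))) \<tau>"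

definition new_arrivals_before :: "(nat \<Rightarrow> nat) \<Rightarrow> nat \<Rightarrow> real \<Rightarrow> (source \<Rightarrow> real) \<Rightarrow> nat" where
  "new_arrivals_before a j \<tau> w = renewals_before (\<lambda>l. w (Arr j (a j + l))) \<tau>"

context polling_system
begin

text \<open>
  The customers in the system at the start of the stage, all of them in orbit.
\<close>
definition orbit :: "(nat \<Rightarrow> nat) \<Rightarrow> (nat \<times> nat) set \<Rightarrow> nat \<Rightarrow> nat set" where
  "orbit a J j = {c. c < x0 j + a j \<and> (j, c) \<notin> J}"

definition residual :: "(nat \<Rightarrow> nat) \<Rightarrow> (nat \<Rightarrow> nat \<Rightarrow> nat) \<Rightarrow> (nat \<times> nat) set \<Rightarrow> nat \<Rightarrow> (source \<Rightarrow> real) \<Rightarrow> source \<Rightarrow> real" where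
  "residual a r J k = age_shift (running P x0 a r) (\<lambda>v w. stage_time P J k w - start x0 v w)"

text \<open>
  In this and the following definitions \<open>w\<close> stands for the residual path, in which the running clocks
  have been set back to the start of stage \<open>k\<close>.
\<close>
definition sticking :: "(nat \<Rightarrow> nat) \<Rightarrow> (nat \<Rightarrow> nat \<Rightarrow> nat) \<Rightarrow> (nat \<times> nat) set \<Rightarrow> nat \<Rightarrow> (source \<Rightarrow> real) \<Rightarrow> nat set" where
  "sticking a r J k w = {c \<in> orbit a J (queue P k). w (Retr (queue P k) c (r (queue P k) c)) < glue P (queue P k)}"

definition joined :: "(nat \<Rightarrow> nat) \<Rightarrow> nat \<Rightarrow> nat set \<Rightarrow> nat \<Rightarrow> nat set" where
  "joined a k D m = D \<union> {x0 (queue P k) + a (queue P k)..<x0 (queue P k) + a (queue P k) + m}"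

definition busy :: "nat \<Rightarrow> nat set \<Rightarrow> (source \<Rightarrow> real) \<Rightarrow> real" where
  "busy k B w = (\<Sum>c\<in>B. w (Serv (queue P k) c)) + w (Switch k)"

text \<open>
  The numbers of customers one stage later, when the customers in \<open>D\<close> stick, \<open>m\<close> customers of the
  served type arrive during the glue period, and visit and switchover last \<open>u\<close> together. The three
  are arguments so that the arrivals can be averaged with them held fixed.
\<close>
definition next_num :: "(nat \<Rightarrow> nat) \<Rightarrow> (nat \<times> nat) set \<Rightarrow> nat \<Rightarrow> nat set \<Rightarrow> nat \<Rightarrow> real \<Rightarrow> nat \<Rightarrow> (source \<Rightarrow> real) \<Rightarrow> nat" where
  "next_num a J k D m u j w =
     (if j = queue P k then card (orbit a J j - D) + (new_arrivals a j (glue P (queue P k) + u) w - m)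
      else card (orbit a J j) + new_arrivals a j (glue P (queue P k) + u) w)"

lemma entries_at_stage:
  assumes reg: "regular P w" and ip: "in_progress a r J k w" and j: "j \<in> types"
  shows "{c. entry x0 w j c \<le> stage_time P J k w} = {..<x0 j + a j}"
proof -
  note nn = regular_nonneg[OF reg]
  let ?T = "stage_time P J k w"
  have T0: "0 \<le> ?T" using stage_nonneg[OF nn, of k] ip by (simp add: in_progress_def)
  have v: "Arr j (a j) \<in> running P x0 a r" using j by simp
  have run: "start x0 (Arr j (a j)) w \<le> ?T" "?T < start x0 (Arr j (Suc (a j))) w"
    using ip v T0 unfolding in_progress_def by fastforce+
  show ?thesis
  proof (intro equalityI subsetI, goal_cases)
    case (1 c)
    then have le: "entry x0 w j c \<le> ?T" by simp
    have "\<not> x0 j + a j \<le> c"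
      using entry_mono[OF nn j, of "x0 j + a j" c] le run(2) unfolding entry_arr by linarith
    then show ?case by simp
  next
    case (2 c)
    show ?case
    proof (cases "c < x0 j")
      case False
      then have "entry x0 w j c = start x0 (Arr j (Suc (c - x0 j))) w" using entry_arr[of x0 w j "c - x0 j"] by simp
      also have "\<dots> \<le> start x0 (Arr j (a j)) w" using 2 False by (intro start_Arr_mono[OF nn j]) auto
      finally show ?thesis using run(1) by simp
    qed (use T0 in \<open>simp add: entry_old\<close>)
  qed
qed

lemma num_at_in_progress:
  assumes "regular P w" "in_progress a r J k w" "j \<in> types"
  shows "num_at P x0 w k j = card (orbit a J j)"
proof -
  have "{c. entry x0 w j c \<le> stage_time P J k w \<and> (j, c) \<notin> J} = orbit a J j"
    using entries_at_stage[OF assms] by (auto simp: orbit_def)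
  then show ?thesis using assms(2) by (simp add: num_at_def in_progress_def)
qed

lemma residual_Arr_sum:
  assumes j: "j \<in> types"
  shows "stage_time P J k w + (\<Sum>l\<le>n. residual a r J k w (Arr j (a j + l))) = entry x0 w j (x0 j + a j + n)"
proof (induction n)
  case 0
  then show ?case using j unfolding add.assoc entry_arr by (simp add: residual_def age_shift_def)
next
  case (Suc n)
  have "residual a r J k w (Arr j (a j + Suc n)) = w (Arr j (a j + Suc n))"
    by (simp add: residual_def age_shift_def)
  with Suc show ?case unfolding add.assoc entry_arr by simp
qed

text \<open>
  For an old customer, the ring of its running retrial clock is its first attempt from the start of
  the stage on, so it joins exactly if this ring falls into the glue period. A new customer makes its first
  attempt when it arrives, and the later ones come later still, so it joins exactly if it arrives in the
  glue period.
\<close>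
lemma one_step:
  fixes w :: "source \<Rightarrow> real"
  assumes reg: "regular P w" and snap: "snapshot P x0 a r J" and ip: "in_progress a r J k w"
  defines "v \<equiv> residual a r J k w"
  defines "D \<equiv> sticking a r J k v" and "m \<equiv> new_arrivals_before a (queue P k) (glue P (queue P k)) v"
  assumes j: "j \<in> types"
  shows "num_at P x0 w (Suc k) j = next_num a J k D m (busy k (joined a k D m) v) j v"
proof -
  note nn = regular_nonneg[OF reg]
  let ?T = "stage_time P J k w" and ?i = "queue P k"
  let ?G = "glue P ?i" and ?X = "x0 ?i + a ?i"
  have st: "stage P x0 w k = (?T, J)" using ip by (simp add: in_progress_def)
  have T0: "0 \<le> ?T" using stage_nonneg[OF nn, of k] st by simp
  have i: "?i \<in> types" by (rule queue_types)
  have G: "0 < ?G" by (rule glue_pos[OF i])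
  have e: "entry x0 w j' (x0 j' + a j' + n) = ?T + (\<Sum>l\<le>n. v (Arr j' (a j' + l)))" if "j' \<in> types" for j' n
    unfolding v_def using residual_Arr_sum[OF that] by simp
  have fin: "finite {n. (\<Sum>l\<le>n. v (Arr j' (a j' + l))) \<le> \<tau>}" if j': "j' \<in> types" for j' \<tau>
  proof -
    have "finite {c. entry x0 w j' c \<le> ?T + \<tau>}" by (rule finite_entries[OF reg j'])
    then have "finite ((\<lambda>n. x0 j' + a j' + n) -` {c. entry x0 w j' c \<le> ?T + \<tau>})"
      by (rule finite_vimageI) (simp add: inj_on_def)
    then show ?thesis by (simp add: vimage_def e[OF j'])
  qed
  have mono: "(\<Sum>l\<le>n. v (Arr j' (a j' + l))) \<le> (\<Sum>l\<le>n'. v (Arr j' (a j' + l)))" if "j' \<in> types" "n \<le> n'" for j' n n'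
    using entry_mono[OF nn that(1), of "x0 j' + a j' + n" "x0 j' + a j' + n'"] that(2) e[OF that(1)] by simp
  have seg: "{n. (\<Sum>l\<le>n. v (Arr j' (a j' + l))) \<le> \<tau>} = {..<new_arrivals a j' \<tau> v}" if "j' \<in> types" for j' \<tau>
    unfolding new_arrivals_def renewals_def using fin[OF that] mono[OF that] order_trans
    by (intro initial_segment) blast+
  have seg': "{n. (\<Sum>l\<le>n. v (Arr ?i (a ?i + l))) < ?G} = {..<m}"
    unfolding m_def new_arrivals_before_def renewals_before_def
  proof (rule initial_segment)
    show "finite {n. (\<Sum>l\<le>n. v (Arr ?i (a ?i + l))) < ?G}"
      by (rule finite_subset[OF _ fin[OF i, of ?G]]) auto
    show "m \<in> {n. (\<Sum>l\<le>n. v (Arr ?i (a ?i + l))) < ?G}"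
      if "n \<in> {n. (\<Sum>l\<le>n. v (Arr ?i (a ?i + l))) < ?G}" "m \<le> n" for m n
      using mono[OF i that(2)] that(1) by simp
  qed
  have jo: "joining w k = joined a k D m"
  proof -
    have "c \<in> joining w k \<longleftrightarrow> c \<in> joined a k D m" for c
    proof (cases "c < ?X")
      case True
      let ?q = "r ?i c"
      have run: "Retr ?i c ?q \<in> running P x0 a r" using i True by simp
      then have run': "start x0 (Retr ?i c ?q) w = 0 \<or> point x0 w ?i c ?q < ?T" "?T < point x0 w ?i c (Suc ?q)"
      proof -
        have "(start x0 (Retr ?i c ?q) w = 0 \<or> start x0 (Retr ?i c ?q) w < ?T) \<and>
            ?T < start x0 (Retr ?i c ?q) w + w (Retr ?i c ?q)"
          using ip run unfolding in_progress_def by blast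
        then show "start x0 (Retr ?i c ?q) w = 0 \<or> point x0 w ?i c ?q < ?T" "?T < point x0 w ?i c (Suc ?q)"
          by (auto simp: point_Suc)
      qed
      have vS: "?T + v (Retr ?i c ?q) = point x0 w ?i c (Suc ?q)"
        using run by (simp add: v_def residual_def age_shift_def point_Suc)
      \<comment> \<open>all points up to the start of the running clock lie before the stage, or are entries at time 0\<close>
      have old: "\<not> ?T \<le> point x0 w ?i c q" if "q = 0 \<longrightarrow> x0 ?i \<le> c" "q \<le> ?q" for q
      proof (cases "point x0 w ?i c ?q < ?T")
        case True
        then show ?thesis using point_mono[OF nn i that(2), of c] by simp
      next
        case False
        then have z: "point x0 w ?i c ?q = 0" using run' by simp
        have "0 < point x0 w ?i c ?q"
        proof (cases "x0 ?i \<le> c")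
          case True
          have "0 < w (Arr ?i 0)" by (rule regular_Arr[OF reg i])
          also have "\<dots> = entry x0 w ?i (x0 ?i)" using entry_arr[of x0 w ?i 0] by simp
          also have "\<dots> \<le> entry x0 w ?i c" by (rule entry_mono[OF nn i True])
          also have "\<dots> \<le> point x0 w ?i c ?q" by (rule entry_le_point[OF nn i])
          finally show ?thesis .
        next
          case False
          then have "?q \<noteq> 0" using that by auto
          then have "point x0 w ?i c 1 \<le> point x0 w ?i c ?q" by (intro point_mono[OF nn i]) auto
          moreover have "0 < w (Retr ?i c 0)" by (rule regular_Retr[OF reg i])
          then have "0 < point x0 w ?i c 1" using entry_nonneg[OF nn i, of c] by (simp add: point_def)
          ultimately show ?thesis by linarith
        qed
        then show ?thesis using z by simp
      qed
      have "c \<in> joining w k \<longleftrightarrow> (?i, c) \<notin> J \<and> (\<exists>q. (q = 0 \<longrightarrow> x0 ?i \<le> c) \<and> (?T \<le> point x0 w ?i c q \<and> point x0 w ?i c q < ?T + ?G))"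
        unfolding joining_def st by (simp add: ex_attempt_iff[of "\<lambda>x. ?T \<le> x \<and> x < ?T + ?G"])
      also have "(\<exists>q. (q = 0 \<longrightarrow> x0 ?i \<le> c) \<and> (?T \<le> point x0 w ?i c q \<and> point x0 w ?i c q < ?T + ?G))
         \<longleftrightarrow> point x0 w ?i c (Suc ?q) < ?T + ?G"
      proof
        assume "\<exists>q. (q = 0 \<longrightarrow> x0 ?i \<le> c) \<and> (?T \<le> point x0 w ?i c q \<and> point x0 w ?i c q < ?T + ?G)"
        then obtain q where q: "q = 0 \<longrightarrow> x0 ?i \<le> c" "?T \<le> point x0 w ?i c q" "point x0 w ?i c q < ?T + ?G"
          by (elim exE conjE)
        then have "Suc ?q \<le> q" using old[of q] by linarith
        then show "point x0 w ?i c (Suc ?q) < ?T + ?G"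
          using point_mono[OF nn i, of "Suc ?q" q c] q(3) by linarith
      next
        assume "point x0 w ?i c (Suc ?q) < ?T + ?G"
        then show "\<exists>q. (q = 0 \<longrightarrow> x0 ?i \<le> c) \<and> (?T \<le> point x0 w ?i c q \<and> point x0 w ?i c q < ?T + ?G)"
          using run'(2) by (intro exI[of _ "Suc ?q"]) auto
      qed
      also have "\<dots> \<longleftrightarrow> v (Retr ?i c ?q) < ?G" using vS by linarith
      finally show ?thesis using True by (simp add: joined_def D_def sticking_def orbit_def)
    next
      case False
      then obtain n where n: "c = ?X + n" using le_Suc_ex not_less by blast
      have nJ: "(?i, c) \<notin> J" using snap False unfolding snapshot_def by blast
      have "c \<in> joining w k \<longleftrightarrow> entry x0 w ?i c < ?T + ?G"
      proof
        show "entry x0 w ?i c < ?T + ?G" if "c \<in> joining w k"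
          using joining_entry[OF reg that] st by simp
      next
        assume *: "entry x0 w ?i c < ?T + ?G"
        have "c \<notin> {c. entry x0 w ?i c \<le> ?T}"
          using entries_at_stage[OF reg ip i] False by simp
        then have "?T \<le> attempt x0 w ?i c 0 \<and> attempt x0 w ?i c 0 < ?T + ?G"
          using * False by (simp add: attempt_point point_def)
        then show "c \<in> joining w k" using nJ unfolding joining_def st by auto
      qed
      also have "\<dots> \<longleftrightarrow> n < m" using seg' e[OF i, of n] n by auto
      finally show ?thesis using False n by (auto simp: joined_def D_def sticking_def orbit_def)
    qed
    then show ?thesis by blast
  qed
  have vS: "v (Serv ?i c) = w (Serv ?i c)" "v (Switch k) = w (Switch k)" for c
    by (simp_all add: v_def residual_def age_shift_def)
  define u where "u = busy k (joined a k D m) v"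
  have u: "u = (\<Sum>c\<in>joining w k. w (Serv ?i c)) + w (Switch k)"
    by (simp add: u_def busy_def jo vS)
  have u0: "0 \<le> u" unfolding u using nn i by (auto intro!: add_nonneg_nonneg sum_nonneg)
  have st': "stage P x0 w (Suc k) = (?T + (?G + u), J \<union> {?i} \<times> joined a k D m)"
    by (simp add: stage_Suc st jo u)
  have ent: "{c. entry x0 w j c \<le> ?T + (?G + u)} = {..<x0 j + a j} \<union> (\<lambda>n. x0 j + a j + n) ` {..<new_arrivals a j (?G + u) v}"
    (is "?E = ?A \<union> ?B")
  proof -
    have "c \<in> ?E \<longleftrightarrow> c \<in> ?A \<union> ?B" for c
    proof (cases "c < x0 j + a j")
      case True
      then have "entry x0 w j c \<le> ?T" using entries_at_stage[OF reg ip j] by blast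
      then show ?thesis using True u0 G by auto
    next
      case False
      then obtain n where n: "c = x0 j + a j + n" using le_Suc_ex not_less by blast
      have "c \<in> ?E \<longleftrightarrow> n \<in> {n. (\<Sum>l\<le>n. v (Arr j (a j + l))) \<le> ?G + u}" using e[OF j, of n] n by simp
      then show ?thesis unfolding seg[OF j] using n by auto
    qed
    then show ?thesis by blast
  qed
  have Jin: "(j, c) \<notin> J" if "x0 j + a j \<le> c" for c
    using snap that unfolding snapshot_def by fastforce
  have fo: "finite (orbit a J j)" by (simp add: orbit_def)
  show ?thesis
  proof (cases "j = ?i")
    case False
    have "{c. entry x0 w j c \<le> ?T + (?G + u) \<and> (j, c) \<notin> J \<union> {?i} \<times> joined a k D m}
      = orbit a J j \<union> (\<lambda>n. x0 j + a j + n) ` {..<new_arrivals a j (?G + u) v}"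
      unfolding Collect_conj_eq ent using False Jin by (auto simp: orbit_def)
    moreover have "card \<dots> = card (orbit a J j) + new_arrivals a j (?G + u) v"
      by (subst card_Un_disjoint) (auto simp: fo orbit_def card_image inj_on_def)
    ultimately show ?thesis using False
      by (simp add: num_at_def st' next_num_def u_def)
  next
    case True
    have mle: "m \<le> new_arrivals a j (?G + u) v"
    proof -
      have "{..<m} \<subseteq> {..<new_arrivals a ?i (?G + u) v}"
        unfolding seg'[symmetric] seg[OF i, symmetric] using u0 by auto
      then show ?thesis using True by simp
    qed
    have "{c. entry x0 w j c \<le> ?T + (?G + u) \<and> (j, c) \<notin> J \<union> {?i} \<times> joined a k D m}
      = (orbit a J j - D) \<union> (\<lambda>n. x0 j + a j + n) ` {m..<new_arrivals a j (?G + u) v}"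
      unfolding Collect_conj_eq ent using True Jin by (auto simp: orbit_def joined_def D_def sticking_def lessThan_atLeast0)
    moreover have "card \<dots> = card (orbit a J j - D) + (new_arrivals a j (?G + u) v - m)"
      by (subst card_Un_disjoint) (auto simp: fo orbit_def card_image inj_on_def)
    ultimately show ?thesis using True
      by (simp add: num_at_def st' next_num_def u_def)
  qed
qed

end

section \<open>Counting exponential renewals\<close>

context
  fixes x :: "nat \<Rightarrow> real" and \<tau> :: real
  assumes nonneg: "\<And>l. 0 \<le> x l" and unb: "\<And>B. \<exists>n. B < (\<Sum>l<n. x l)"
begin

lemma renewals_segment: "{n. (\<Sum>l\<le>n. x l) \<le> \<tau>} = {..<renewals x \<tau>}"
  and renewals_before_segment: "{n. (\<Sum>l\<le>n. x l) < \<tau>} = {..<renewals_before x \<tau>}"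
proof -
  have mono: "(\<Sum>l\<le>m. x l) \<le> (\<Sum>l\<le>n. x l)" if "m \<le> n" for m n
    using that nonneg by (auto intro!: sum_mono2)
  obtain N where N: "\<tau> < (\<Sum>l<N. x l)" using unb by blast
  have "n < N" if "(\<Sum>l\<le>n. x l) \<le> \<tau>" for n
  proof (rule ccontr)
    assume "\<not> n < N"
    then have "(\<Sum>l<N. x l) \<le> (\<Sum>l\<le>n. x l)" using nonneg by (auto intro!: sum_mono2)
    then show False using that N by linarith
  qed
  then have "{n. (\<Sum>l\<le>n. x l) \<le> \<tau>} \<subseteq> {..<N}" by blast
  then have fin: "finite {n. (\<Sum>l\<le>n. x l) \<le> \<tau>}" by (rule finite_subset) simp
  moreover have "{n. (\<Sum>l\<le>n. x l) < \<tau>} \<subseteq> {n. (\<Sum>l\<le>n. x l) \<le> \<tau>}" by auto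
  ultimately have fin': "finite {n. (\<Sum>l\<le>n. x l) < \<tau>}" by (rule rev_finite_subset)
  show "{n. (\<Sum>l\<le>n. x l) \<le> \<tau>} = {..<renewals x \<tau>}"
    unfolding renewals_def using fin
  proof (rule initial_segment)
    show "m \<in> {n. (\<Sum>l\<le>n. x l) \<le> \<tau>}" if "n \<in> {n. (\<Sum>l\<le>n. x l) \<le> \<tau>}" "m \<le> n" for m n
      using mono[OF that(2)] that(1) by simp
  qed
  show "{n. (\<Sum>l\<le>n. x l) < \<tau>} = {..<renewals_before x \<tau>}"
    unfolding renewals_before_def using fin'
  proof (rule initial_segment)
    show "m \<in> {n. (\<Sum>l\<le>n. x l) < \<tau>}" if "n \<in> {n. (\<Sum>l\<le>n. x l) < \<tau>}" "m \<le> n" for m n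
      using mono[OF that(2)] that(1) by simp
  qed
qed

lemma renewals_eq_iff:
  assumes "0 \<le> \<tau>"
  shows "renewals x \<tau> = n \<longleftrightarrow> (\<Sum>l<n. x l) \<le> \<tau> \<and> \<tau> < (\<Sum>l<Suc n. x l)"
proof -
  have lt: "(\<Sum>l<Suc k. x l) \<le> \<tau> \<longleftrightarrow> k < renewals x \<tau>" for k
    using renewals_segment by (auto simp: lessThan_Suc_atMost set_eq_iff)
  show ?thesis
  proof (cases n)
    case 0
    then show ?thesis using lt[of 0] assms by auto
  next
    case (Suc m)
    then show ?thesis using lt[of m] lt[of n] by auto
  qed
qed

lemma renewals_before_eq:
  assumes "\<And>n. (\<Sum>l\<le>n. x l) \<noteq> \<tau>"
  shows "renewals_before x \<tau> = renewals x \<tau>"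
proof -
  have "{n. (\<Sum>l\<le>n. x l) < \<tau>} = {n. (\<Sum>l\<le>n. x l) \<le> \<tau>}" using assms by (auto simp: less_le)
  then show ?thesis unfolding renewals_def renewals_before_def by simp
qed

end

lemma measurable_renewals:
  assumes [measurable]: "\<And>l. (\<lambda>w. x w l) \<in> borel_measurable N" "\<tau> \<in> borel_measurable N"
  shows "(\<lambda>w. renewals (x w) (\<tau> w)) \<in> measurable N (count_space UNIV)"
    "(\<lambda>w. renewals_before (x w) (\<tau> w)) \<in> measurable N (count_space UNIV)"
  unfolding renewals_def renewals_before_def by measurable

lemma (in prob_space) integral_sums_nat:
  fixes f :: "'a \<Rightarrow> 'b::{banach, second_countable_topology, real_normed_field}"
  assumes f: "integrable M f" and N[measurable]: "N \<in> measurable M (count_space (UNIV::nat set))"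
  shows "(\<lambda>n. \<integral>w. of_bool (N w = n) * f w \<partial>M) sums (\<integral>w. f w \<partial>M)"
proof -
  note [measurable] = borel_measurable_integrable[OF f]
  let ?s = "\<lambda>k w. (\<Sum>n<k. of_bool (N w = n) * f w)"
  have s: "?s k w = of_bool (N w < k) * f w" for k w
    by (induction k) (auto simp: less_Suc_eq)
  have int: "integrable M (\<lambda>w. of_bool (N w = n) * f w)" for n
    by (rule Bochner_Integration.integrable_bound[OF f]) (auto simp: norm_mult)
  have "(\<lambda>k. \<integral>w. ?s k w \<partial>M) \<longlonglongrightarrow> (\<integral>w. f w \<partial>M)"
  proof (rule integral_dominated_convergence[where w="\<lambda>w. norm (f w)"])
    show "AE w in M. (\<lambda>k. ?s k w) \<longlonglongrightarrow> f w"
    proof (rule AE_I2)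
      fix w
      have "eventually (\<lambda>k. ?s k w = f w) sequentially"
        unfolding s using eventually_gt_at_top[of "N w"] by eventually_elim simp
      then show "(\<lambda>k. ?s k w) \<longlonglongrightarrow> f w" by (rule tendsto_eventually)
    qed
    show "AE w in M. norm (?s k w) \<le> norm (f w)" for k
      unfolding s by (auto simp: norm_mult)
  qed (use f in auto)
  moreover have "(\<integral>w. ?s k w \<partial>M) = (\<Sum>n<k. \<integral>w. of_bool (N w = n) * f w \<partial>M)" for k
    by (rule Bochner_Integration.integral_sum) (rule int)
  ultimately show ?thesis by (simp only: sums_def)
qed

lemma poisson_pgf:
  fixes z :: complex and \<mu> :: real
  shows "(\<lambda>n. of_real (exp (- \<mu>) * \<mu> ^ n / fact n) * z ^ n) sums exp (- of_real \<mu> * (1 - z))"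
proof -
  have "(\<lambda>n. exp (- of_real \<mu>) * ((of_real \<mu> * z) ^ n /\<^sub>R fact n)) sums (exp (- of_real \<mu>) * exp (of_real \<mu> * z))"
    by (intro sums_mult exp_converges)
  also have "exp (- of_real \<mu>) * exp (of_real \<mu> * z) = exp (- of_real \<mu> * (1 - z))"
    by (simp add: exp_add[symmetric] algebra_simps)
  also have "(\<lambda>n. exp (- of_real \<mu>) * ((of_real \<mu> * z) ^ n /\<^sub>R fact n)) =
     (\<lambda>n. of_real (exp (- \<mu>) * \<mu> ^ n / fact n) * z ^ n)"
    unfolding of_real_minus[symmetric] exp_of_real
    by (auto simp: fun_eq_iff scaleR_conv_of_real power_mult_distrib divide_inverse)
  finally show ?thesis .
qed

context real_product_prob_space
begin

text \<open>
  Resample coordinate \<open>v\<close>, with \<open>h w\<close> fixed; an exponential law has no atoms.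
\<close>
lemma AE_no_tie:
  assumes v: "v \<in> I" "M v = density lborel (exponential_density \<rho>)" "0 < \<rho>"
    and h: "h \<in> borel_measurable (PiM I M)" "depends_on (- {v}) h"
  shows "AE w in PiM I M. w v \<noteq> h w"
proof -
  note [measurable] = h(1) measurable_coordinate[OF v(1)]
  let ?f = "\<lambda>w. of_bool (w v = h w) :: real"
  have m: "{w \<in> space (PiM I M). w v = h w} \<in> sets (PiM I M)"
    using h(1) measurable_coordinate[OF v(1)] by (intro borel_measurable_eq)
  then have [measurable]: "Measurable.pred (PiM I M) (\<lambda>w. w v = h w)" by (simp add: pred_def)
  have mf: "?f \<in> borel_measurable (PiM I M)" using v(1) by measurable
  have int: "integrable (PiM I M) ?f"
    by (rule P.integrable_const_bound[where B=1, OF _ mf]) auto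
  have hv: "h (w(v := x)) = h w" for w x by (rule depends_onD[OF h(2)]) auto
  have "(\<integral>w. ?f w \<partial>PiM I M) = (\<integral>w. \<integral>x. of_bool (x = h w) \<partial>M v \<partial>PiM I M)"
    by (subst integral_resample[OF int v(1)]) (simp add: hv)
  also have "\<dots> = (\<integral>w. 0 \<partial>PiM I M)"
  proof (rule Bochner_Integration.integral_cong[OF refl])
    fix w
    have "AE x in M v. x \<noteq> h w"
      unfolding v(2) by (subst AE_density) (use AE_lborel_singleton[of "h w"] in auto)
    then show "(\<integral>x. of_bool (x = h w) \<partial>M v) = (0::real)"
      by (intro integral_eq_zero_AE) auto
  qed
  finally have "(\<integral>w. ?f w \<partial>PiM I M) = 0" by simp
  then have "AE w in PiM I M. ?f w = 0"
    by (subst (asm) integral_nonneg_eq_0_iff_AE[OF int]) auto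
  then show ?thesis by eventually_elim (simp split: if_splits)
qed

lemma AE_exponential_pos:
  assumes v: "v \<in> I" "M v = density lborel (exponential_density \<rho>)" "0 < \<rho>"
  shows "AE w in PiM I M. 0 < w v"
proof (rule AE_component[OF v(1)])
  show "AE x in M v. 0 < x"
    unfolding v(2)
    by (subst AE_density) (use AE_lborel_singleton[of "0::real"] in \<open>auto simp: exponential_density_def elim!: eventually_mono\<close>)
qed

context
  fixes f :: "nat \<Rightarrow> 'i" and \<rho> :: real
  assumes inj: "inj f" and fI: "\<And>l. f l \<in> I" and \<rho>: "0 < \<rho>"
    and law: "\<And>l. M (f l) = density lborel (exponential_density \<rho>)"
begin

text \<open>
  The sum has an Erlang law.
\<close>
lemma prob_sum_le:
  assumes "0 \<le> \<tau>"
  shows "P.prob {w \<in> space (PiM I M). (\<Sum>l<n. w (f l)) \<le> \<tau>} = 1 - (\<Sum>k<n. exp (- \<rho> * \<tau>) * (\<rho> * \<tau>) ^ k / fact k)"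
proof (cases n)
  case 0
  then show ?thesis using assms P.prob_space by simp
next
  case (Suc m)
  have d: "distributed (PiM I M) lborel (\<lambda>w. w (f l)) (exponential_density \<rho>)" for l
  proof -
    have "distr (PiM I M) lborel (\<lambda>w. w (f l)) = distr (PiM I M) (M (f l)) (\<lambda>w. w (f l))"
      by (rule distr_cong) (simp_all add: sets_M)
    then show ?thesis
      using PiM_component[OF fI[of l]] law[of l] fI[of l] \<rho>
      by (simp add: distributed_def exponential_density_nonneg)
  qed
  have "P.indep_vars M (\<lambda>i w. w i) (f ` {..<n})"
    by (rule P.indep_vars_subset[OF indep_coordinates]) (use fI in auto)
  then have "P.indep_vars (\<lambda>_. borel) (\<lambda>i w. (\<lambda>x. x) (w i)) (f ` {..<n})"
    by (rule P.indep_vars_compose2) (auto simp: sets_M intro!: measurable_ident_sets)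
  then have ind: "P.indep_vars (\<lambda>_. borel) (\<lambda>i w. w i) (f ` {..<n})" by simp
  have inj': "inj_on f {..<n}" using inj by (rule inj_on_subset) auto
  have *: "distributed (PiM I M) lborel (\<lambda>w. \<Sum>i\<in>f ` {..<n}. w i) (erlang_density (card (f ` {..<n}) - 1) \<rho>)"
    using d \<rho> Suc ind by (intro P.exponential_distributed_sum) auto
  have ds: "distributed (PiM I M) lborel (\<lambda>w. \<Sum>l<n. w (f l)) (erlang_density m \<rho>)"
  proof -
    have "(\<lambda>w::'i \<Rightarrow> real. \<Sum>i\<in>f ` {..<n}. w i) = (\<lambda>w. \<Sum>l<n. w (f l))"
      by (simp add: sum.reindex[OF inj'] o_def)
    moreover have "card (f ` {..<n}) - 1 = m" using card_image[OF inj'] Suc by simp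
    ultimately show ?thesis using * by (simp only:)
  qed
  from P.erlang_distributed_le[OF ds \<rho> assms]
  show ?thesis using assms Suc
    by (simp add: erlang_CDF_def lessThan_Suc_atMost mult.commute)
qed

text \<open>
  The probability that \<open>n\<close> terms stay below a bound is the tail of the exponential series, so it
  vanishes in the limit.
\<close>
lemma AE_sum_unbounded: "AE w in PiM I M. \<forall>B. \<exists>n. B < (\<Sum>l<n. w (f l))"
proof -
  have fm[measurable]: "(\<lambda>w. w (f l)) \<in> borel_measurable (PiM I M)" for l using fI by measurable
  have "AE w in PiM I M. \<exists>n. real B < (\<Sum>l<n. w (f l))" for B :: nat
  proof -
    let ?A = "{w \<in> space (PiM I M). \<forall>n. (\<Sum>l<n. w (f l)) \<le> real B}"
    have A[measurable]: "?A \<in> sets (PiM I M)" by measurable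
    have "P.prob ?A \<le> 1 - (\<Sum>k<n. exp (- \<rho> * real B) * (\<rho> * real B) ^ k / fact k)" for n
      unfolding prob_sum_le[symmetric, of "real B" n, simplified]
      using prob_sum_le[of "real B" n, symmetric] by (auto intro!: P.finite_measure_mono)
    moreover have "(\<lambda>n. 1 - (\<Sum>k<n. exp (- \<rho> * real B) * (\<rho> * real B) ^ k / fact k)) \<longlonglongrightarrow> 1 - exp (- \<rho> * real B) * exp (\<rho> * real B)"
    proof -
      have "(\<lambda>k. exp (- \<rho> * real B) * ((\<rho> * real B) ^ k /\<^sub>R fact k)) sums (exp (- \<rho> * real B) * exp (\<rho> * real B))"
        by (intro sums_mult exp_converges)
      then show ?thesis unfolding sums_def
        by (intro tendsto_diff tendsto_const) (simp add: field_simps)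
    qed
    ultimately have "P.prob ?A \<le> 1 - exp (- \<rho> * real B) * exp (\<rho> * real B)"
      by (intro LIMSEQ_le_const) auto
    then have "P.prob ?A = 0" by (simp add: exp_add[symmetric] measure_le_0_iff)
    then have "AE w in PiM I M. w \<notin> ?A" using A by (intro AE_not_in) (auto simp: P.emeasure_eq_measure null_sets_def)
    then show ?thesis by (rule AE_mp) (auto simp: not_le intro!: AE_I2)
  qed
  then have "AE w in PiM I M. \<forall>B::nat. \<exists>n. real B < (\<Sum>l<n. w (f l))" by (simp add: AE_all_countable)
  then show ?thesis
  proof eventually_elim
    case (elim w)
    show ?case
    proof
      fix B :: real
      obtain N :: nat where "B \<le> real N" using real_arch_simple by blast
      then show "\<exists>n. B < (\<Sum>l<n. w (f l))" using elim le_less_trans by blast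
    qed
  qed
qed

lemma AE_nonneg_unbounded: "AE w in PiM I M. (\<forall>l. 0 < w (f l)) \<and> (\<forall>B. \<exists>n. B < (\<Sum>l<n. w (f l)))"
  using AE_exponential_pos[OF fI law \<rho>] AE_sum_unbounded by (simp add: AE_all_countable)

text \<open>
  The difference of two consecutive Erlang distribution functions is a Poisson weight.
\<close>
lemma prob_renewals:
  assumes "0 \<le> \<tau>"
  shows "P.prob {w \<in> space (PiM I M). renewals (\<lambda>l. w (f l)) \<tau> = n} = exp (- \<rho> * \<tau>) * (\<rho> * \<tau>) ^ n / fact n"
proof -
  have fm[measurable]: "(\<lambda>w. w (f l)) \<in> borel_measurable (PiM I M)" for l using fI by measurable
  let ?S = "\<lambda>n. {w \<in> space (PiM I M). (\<Sum>l<n. w (f l)) \<le> \<tau>}"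
  have [measurable]: "(\<lambda>w. renewals (\<lambda>l. w (f l)) \<tau>) \<in> measurable (PiM I M) (count_space UNIV)"
    by (rule measurable_renewals) auto
  have "P.prob {w \<in> space (PiM I M). renewals (\<lambda>l. w (f l)) \<tau> = n} = P.prob (?S n - ?S (Suc n))"
  proof (rule P.finite_measure_eq_AE)
    show "AE w in PiM I M. (w \<in> {w \<in> space (PiM I M). renewals (\<lambda>l. w (f l)) \<tau> = n}) = (w \<in> ?S n - ?S (Suc n))"
      using AE_nonneg_unbounded AE_space
    proof eventually_elim
      case (elim w)
      then have "renewals (\<lambda>l. w (f l)) \<tau> = n \<longleftrightarrow> (\<Sum>l<n. w (f l)) \<le> \<tau> \<and> \<tau> < (\<Sum>l<Suc n. w (f l))"
        by (intro renewals_eq_iff assms) (auto simp: less_imp_le)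
      then show ?case using elim by auto
    qed
  qed measurable
  also have "\<dots> = P.prob (?S n) - P.prob (?S n \<inter> ?S (Suc n))"
    by (rule P.finite_measure_Diff') measurable
  also have "P.prob (?S n \<inter> ?S (Suc n)) = P.prob (?S (Suc n))"
  proof (rule P.finite_measure_eq_AE)
    show "AE w in PiM I M. (w \<in> ?S n \<inter> ?S (Suc n)) = (w \<in> ?S (Suc n))"
      using AE_nonneg_unbounded
    proof eventually_elim
      case (elim w)
      then have "0 < w (f n)" by simp
      then show ?case by auto
    qed
  qed measurable
  also have "P.prob (?S n) - P.prob (?S (Suc n)) = exp (- \<rho> * \<tau>) * (\<rho> * \<tau>) ^ n / fact n"
    unfolding prob_sum_le[OF assms] by simp
  finally show ?thesis .
qed

lemma pgf_renewals:
  fixes z :: complex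
  assumes \<tau>: "0 \<le> \<tau>" and z: "norm z \<le> 1"
  shows "(\<integral>w. z ^ renewals (\<lambda>l. w (f l)) \<tau> \<partial>PiM I M) = exp (- of_real (\<rho> * \<tau>) * (1 - z))"
proof -
  have fm[measurable]: "(\<lambda>w. w (f l)) \<in> borel_measurable (PiM I M)" for l using fI by measurable
  let ?N = "\<lambda>w. renewals (\<lambda>l. w (f l)) \<tau>"
  have N[measurable]: "?N \<in> measurable (PiM I M) (count_space UNIV)"
    by (rule measurable_renewals) auto
  have int: "integrable (PiM I M) (\<lambda>w. z ^ ?N w)"
    by (rule P.integrable_const_bound[where B=1]) (auto simp: norm_power power_le_one z)
  have "(\<lambda>n. \<integral>w. of_bool (?N w = n) * z ^ ?N w \<partial>PiM I M) sums (\<integral>w. z ^ ?N w \<partial>PiM I M)"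
    by (rule P.integral_sums_nat[OF int N])
  also have "(\<lambda>n. \<integral>w. of_bool (?N w = n) * z ^ ?N w \<partial>PiM I M) = (\<lambda>n. of_real (exp (- \<rho> * \<tau>) * (\<rho> * \<tau>) ^ n / fact n) * z ^ n)"
  proof
    fix n
    have "(\<integral>w. of_bool (?N w = n) * z ^ ?N w \<partial>PiM I M) = (\<integral>w. of_real (indicator {w \<in> space (PiM I M). ?N w = n} w) * z ^ n \<partial>PiM I M)"
      by (intro Bochner_Integration.integral_cong) (auto simp: indicator_def)
    also have "\<dots> = of_real (P.prob {w \<in> space (PiM I M). ?N w = n}) * z ^ n"
      by (simp add: Int_def cong: conj_cong)
    finally show "(\<integral>w. of_bool (?N w = n) * z ^ ?N w \<partial>PiM I M) = of_real (exp (- \<rho> * \<tau>) * (\<rho> * \<tau>) ^ n / fact n) * z ^ n"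
      by (simp only: prob_renewals[OF \<tau>])
  qed
  finally have "(\<lambda>n. of_real (exp (- \<rho> * \<tau>) * (\<rho> * \<tau>) ^ n / fact n) * z ^ n) sums (\<integral>w. z ^ ?N w \<partial>PiM I M)" .
  moreover have "(\<lambda>n. of_real (exp (- \<rho> * \<tau>) * (\<rho> * \<tau>) ^ n / fact n) * z ^ n) sums exp (- of_real (\<rho> * \<tau>) * (1 - z))"
    using poisson_pgf[of "\<rho> * \<tau>" z] by simp
  ultimately show ?thesis by (rule sums_unique2)
qed

end

text \<open>
  Independence of the increments of a Poisson process. That \<open>m\<close> renewals occur before \<open>G\<close> means that
  the first \<open>m\<close> intervals end by \<open>G\<close> and that the next one, of age \<open>G\<close> minus their sum, goes on; so
  \<open>memoryless\<close> restarts the sequence at \<open>G\<close>. Ties with \<open>G\<close> have probability 0, so that counting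
  renewals before \<open>G\<close> or up to \<open>G\<close> makes no difference.
\<close>
lemma pgf_renewals_two_times:
  fixes f :: "nat \<Rightarrow> 'i" and z :: complex
  assumes inj: "inj f" and fI: "\<And>l. f l \<in> I" and \<rho>: "0 < \<rho>"
    and law: "\<And>l. M (f l) = density lborel (exponential_density \<rho>)"
    and G: "0 \<le> G" and u: "0 \<le> u" and z: "norm z \<le> 1"
  shows "(\<integral>w. of_bool (renewals_before (\<lambda>l. w (f l)) G = m) * z ^ (renewals (\<lambda>l. w (f l)) (G + u) - m) \<partial>PiM I M)
       = of_real (exp (- \<rho> * G) * (\<rho> * G) ^ m / fact m) * exp (- of_real (\<rho> * u) * (1 - z))"
proof -
  have fm[measurable]: "(\<lambda>w. w (f l)) \<in> borel_measurable (PiM I M)" for l using fI by measurable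
  let ?A = "f ` {..<m}" and ?S = "\<lambda>n w. \<Sum>l<n. w (f l)"
  let ?g = "\<lambda>(v::'i) w. G - ?S m w"
  define Q where "Q w = (of_bool (?S m w \<le> G) :: complex)" for w
  define F where "F w = z ^ renewals (\<lambda>l. w (f (m + l))) u" for w
  have [measurable]: "(\<lambda>w. renewals (\<lambda>l. w (f (m + l))) u) \<in> measurable (PiM I M) (count_space UNIV)"
    by (rule measurable_renewals) auto
  have Qm: "Q \<in> borel_measurable (PiM I M)" unfolding Q_def by measurable
  have Fm: "F \<in> borel_measurable (PiM I M)" unfolding F_def by measurable
  have dS: "depends_on ?A (?S m)"
    by (intro depends_onI sum.cong refl) auto
  have dQ: "depends_on ?A Q" "depends_on ?A (?g v)" for v
    using dS unfolding depends_on_def Q_def by metis+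
  have dF: "depends_on (- ?A) F"
  proof (rule depends_onI)
    fix w w' :: "'i \<Rightarrow> real" assume *: "\<And>s. s \<in> - ?A \<Longrightarrow> w s = w' s"
    have "f (m + l) \<in> - ?A" for l using inj by (auto simp: inj_def)
    then have "(\<lambda>l. w (f (m + l))) = (\<lambda>l. w' (f (m + l)))" using * by blast
    then show "F w = F w'" by (simp add: F_def)
  qed
  have AEties: "AE w in PiM I M. \<forall>n. ?S (Suc n) w \<noteq> G"
  proof (subst AE_all_countable, rule allI)
    fix n
    have "AE w in PiM I M. w (f n) \<noteq> G - ?S n w"
      by (rule AE_no_tie[OF fI law \<rho>])
         (use inj in \<open>auto simp: depends_on_def inj_def intro!: sum.cong\<close>)
    then show "AE w in PiM I M. ?S (Suc n) w \<noteq> G" by eventually_elim auto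
  qed
  have key: "AE w in PiM I M. of_bool (renewals_before (\<lambda>l. w (f l)) G = m) * z ^ (renewals (\<lambda>l. w (f l)) (G + u) - m)
     = (if \<forall>v\<in>{f m}. ?g v w < w v then Q w * F (age_shift {f m} ?g w) else 0)"
    using AE_nonneg_unbounded[of f, OF inj fI \<rho> law] AEties
  proof eventually_elim
    case (elim w)
    let ?x = "\<lambda>l. w (f l)"
    have nn: "\<And>l. 0 \<le> ?x l" and unb: "\<And>B. \<exists>n. B < (\<Sum>l<n. ?x l)" using elim by (auto simp: less_imp_le)
    have "renewals_before ?x G = renewals ?x G"
      using elim by (intro renewals_before_eq[OF nn unb]) (auto simp: lessThan_Suc_atMost)
    then have iff: "renewals_before ?x G = m \<longleftrightarrow> ?S m w \<le> G \<and> G < ?S (Suc m) w"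
      using renewals_eq_iff[OF nn unb G] by simp
    show ?case
    proof (cases "?S m w \<le> G \<and> G < ?S (Suc m) w")
      case True
      let ?y = "\<lambda>l. age_shift {f m} ?g w (f (m + l))"
      have y: "(\<Sum>l\<le>n. ?y l) = ?S (m + Suc n) w - G" for n
        by (induction n) (auto simp: age_shift_def inj_eq[OF inj])
      have "{n. (\<Sum>l\<le>n. ?x l) \<le> G + u} = {..<m} \<union> (\<lambda>n. m + n) ` {n. (\<Sum>l\<le>n. ?y l) \<le> u}"
      proof -
        have "n \<in> {n. (\<Sum>l\<le>n. ?x l) \<le> G + u} \<longleftrightarrow> n \<in> {..<m} \<union> (\<lambda>n. m + n) ` {n. (\<Sum>l\<le>n. ?y l) \<le> u}" for n
        proof (cases "n < m")
          case True
          then have "(\<Sum>l\<le>n. ?x l) \<le> ?S m w" using nn by (auto intro!: sum_mono2)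
          then show ?thesis using True \<open>?S m w \<le> G \<and> _\<close> u by auto
        next
          case False
          then obtain k where k: "n = m + k" using le_Suc_ex not_less by blast
          have "(\<Sum>l\<le>n. ?x l) = ?S (m + Suc k) w" by (simp add: k lessThan_Suc_atMost)
          then show ?thesis unfolding y using k by auto
        qed
        then show ?thesis by blast
      qed
      moreover have "finite {n. (\<Sum>l\<le>n. ?x l) \<le> G + u}"
        using renewals_segment[OF nn unb, of "G + u"] by simp
      moreover have "finite {n. (\<Sum>l\<le>n. ?y l) \<le> u}"
      proof (rule finite_imageD[of "\<lambda>n. m + n"])
        show "finite ((\<lambda>n. m + n) ` {n. (\<Sum>l\<le>n. ?y l) \<le> u})"
          using calculation by (metis (no_types, lifting) finite_Un)
      qed (simp add: inj_on_def)
      ultimately have "renewals ?x (G + u) = m + renewals ?y u"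
      proof -
        have "card ({..<m} \<union> (\<lambda>n. m + n) ` K) = m + card K" if "finite K" for K
          using that by (subst card_Un_disjoint) (auto simp: card_image)
        then show ?thesis
          using \<open>{n. (\<Sum>l\<le>n. ?x l) \<le> G + u} = _\<close> \<open>finite {n. (\<Sum>l\<le>n. ?y l) \<le> u}\<close>
          unfolding renewals_def by simp
      qed
      then show ?thesis using True iff by (simp add: Q_def F_def algebra_simps)
    next
      case False
      then show ?thesis using iff by (auto simp: Q_def algebra_simps)
    qed
  qed
  have gm: "?g v \<in> borel_measurable (PiM I M)" for v by measurable
  have "(\<integral>w. of_bool (renewals_before (\<lambda>l. w (f l)) G = m) * z ^ (renewals (\<lambda>l. w (f l)) (G + u) - m) \<partial>PiM I M)
     = (\<integral>w. (if \<forall>v\<in>{f m}. ?g v w < w v then Q w * F (age_shift {f m} ?g w) else 0) \<partial>PiM I M)"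
  proof (rule integral_cong_AE[OF _ _ key])
    have [measurable]: "(\<lambda>w. renewals_before (\<lambda>l. w (f l)) G) \<in> measurable (PiM I M) (count_space UNIV)"
      "(\<lambda>w. renewals (\<lambda>l. w (f l)) (G + u)) \<in> measurable (PiM I M) (count_space UNIV)"
      by (rule measurable_renewals; simp)+
    show "(\<lambda>w. of_bool (renewals_before (\<lambda>l. w (f l)) G = m) * z ^ (renewals (\<lambda>l. w (f l)) (G + u) - m)) \<in> borel_measurable (PiM I M)"
      by measurable
    have [measurable]: "age_shift {f m} ?g \<in> measurable (PiM I M) (PiM I M)"
      by (rule measurable_age_shift) (use fI in auto)
    show "(\<lambda>w. if \<forall>v\<in>{f m}. ?g v w < w v then Q w * F (age_shift {f m} ?g w) else 0) \<in> borel_measurable (PiM I M)"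
      using Qm Fm by simp
  qed
  also have "\<dots> = (\<integral>w. (if \<forall>v\<in>{f m}. ?g v w < w v then Q w else 0) \<partial>PiM I M) * (\<integral>w. F w \<partial>PiM I M)"
  proof (rule memoryless[where A="?A" and rate="\<lambda>_. \<rho>" and BQ=1 and BF=1])
    show "{f m} \<inter> ?A = {}" using inj by (auto simp: inj_def)
    show "norm (F w) \<le> 1" for w unfolding F_def by (simp add: norm_power power_le_one z)
    show "norm (Q w) \<le> 1" for w by (simp add: Q_def)
    show "0 \<le> G - ?S m w" if "Q w \<noteq> 0" for w using that by (simp add: Q_def split: if_splits)
  qed (use fI \<rho> law Qm Fm dQ dF in auto)
  also have "(\<integral>w. F w \<partial>PiM I M) = exp (- of_real (\<rho> * u) * (1 - z))"
    unfolding F_def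
    by (rule pgf_renewals[where f="\<lambda>l. f (m + l)", OF _ fI \<rho> law u z]) (auto intro!: injI dest: injD[OF inj])
  also have "(\<integral>w. (if \<forall>v\<in>{f m}. ?g v w < w v then Q w else 0) \<partial>PiM I M)
     = (\<integral>w. of_real (indicator {w \<in> space (PiM I M). renewals (\<lambda>l. w (f l)) G = m} w) \<partial>PiM I M)"
  proof (rule integral_cong_AE)
    show "AE w in PiM I M. (if \<forall>v\<in>{f m}. ?g v w < w v then Q w else 0) =
       of_real (indicator {w \<in> space (PiM I M). renewals (\<lambda>l. w (f l)) G = m} w)"
      using AE_nonneg_unbounded[of f, OF inj fI \<rho> law] AE_space
    proof eventually_elim
      case (elim w)
      then have "renewals (\<lambda>l. w (f l)) G = m \<longleftrightarrow> ?S m w \<le> G \<and> G < ?S (Suc m) w"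
        by (intro renewals_eq_iff G) (auto simp: less_imp_le)
      then show ?case using elim by (auto simp: Q_def indicator_def)
    qed
    have [measurable]: "(\<lambda>w. renewals (\<lambda>l. w (f l)) G) \<in> measurable (PiM I M) (count_space UNIV)"
      by (rule measurable_renewals) auto
    show "(\<lambda>w. complex_of_real (indicator {w \<in> space (PiM I M). renewals (\<lambda>l. w (f l)) G = m} w)) \<in> borel_measurable (PiM I M)"
      by measurable
    show "(\<lambda>w. if \<forall>v\<in>{f m}. ?g v w < w v then Q w else 0) \<in> borel_measurable (PiM I M)"
      using Qm by simp
  qed
  also have "\<dots> = of_real (P.prob {w \<in> space (PiM I M). renewals (\<lambda>l. w (f l)) G = m})"
    by (simp add: Int_def cong: conj_cong)
  also have "\<dots> = of_real (exp (- \<rho> * G) * (\<rho> * G) ^ m / fact m)"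
    by (simp only: prob_renewals[OF inj fI \<rho> law G])
  finally show ?thesis .
qed

end

section \<open>The probability space of the sources\<close>

text \<open>
  The sum over an infinite set is 0 by convention; over a finite set it is a series.
\<close>
lemma borel_measurable_sum_random_set:
  fixes g :: "nat \<Rightarrow> 'a \<Rightarrow> real"
  assumes S: "\<And>c. Measurable.pred N (\<lambda>x. c \<in> S x)" and g: "\<And>c. g c \<in> borel_measurable N"
  shows "(\<lambda>x. \<Sum>c\<in>S x. g c x) \<in> borel_measurable N"
proof -
  have [measurable]: "\<And>c. {x \<in> space N. c \<in> S x} \<in> sets N" using S by (simp add: pred_def)
  note [measurable] = S g
  have "(\<Sum>c\<in>S x. g c x) = (if finite (S x) then suminf (\<lambda>c. if c \<in> S x then g c x else 0) else 0)" for x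
  proof (cases "finite (S x)")
    case True
    then have "suminf (\<lambda>c. if c \<in> S x then g c x else 0) = (\<Sum>c\<in>S x. if c \<in> S x then g c x else 0)"
      by (rule suminf_finite) auto
    then show ?thesis using True by simp
  qed simp
  then show ?thesis by simp
qed

lemma (in prob_space) integral_eq_by_partition:
  fixes f g :: "'a \<Rightarrow> complex"
  assumes f: "integrable M f" and g: "integrable M g"
    and Z: "countable Z" and Y: "\<And>y. y \<in> Z \<Longrightarrow> {w \<in> space M. Y w = y} \<in> sets M" "AE w in M. Y w \<in> Z"
    and eq: "\<And>y. y \<in> Z \<Longrightarrow> (\<integral>w. of_bool (Y w = y) * f w \<partial>M) = (\<integral>w. of_bool (Y w = y) * g w \<partial>M)"
  shows "(\<integral>w. f w \<partial>M) = (\<integral>w. g w \<partial>M)"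
proof -
  \<comment> \<open>number the classes; 0 is for the exceptional points\<close>
  define N where "N w = (if Y w \<in> Z then Suc (to_nat_on Z (Y w)) else 0)" for w
  define h where "h w = f w - g w" for w
  have h: "integrable M h" unfolding h_def using f g by simp
  have inj: "to_nat_on Z y = to_nat_on Z y' \<longleftrightarrow> y = y'" if "y \<in> Z" "y' \<in> Z" for y y'
    using that Z by (simp add: to_nat_on_inj)
  have N_Suc: "(\<exists>y\<in>Z. \<forall>w. (N w = Suc m) = (Y w = y)) \<or> (\<forall>w. N w \<noteq> Suc m)" for m
  proof (cases "\<exists>y\<in>Z. to_nat_on Z y = m")
    case True
    then obtain y where "y \<in> Z" "to_nat_on Z y = m" by blast
    then have "\<forall>w. (N w = Suc m) = (Y w = y)" using inj by (auto simp: N_def)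
    then show ?thesis using \<open>y \<in> Z\<close> by blast
  qed (auto simp: N_def)
  have N: "N \<in> measurable M (count_space UNIV)"
    unfolding measurable_count_space_eq2_countable
  proof safe
    fix n
    have "{w \<in> space M. N w = n} \<in> sets M"
    proof (cases n)
      case 0
      have "{w \<in> space M. N w = n} = space M - (\<Union>y\<in>Z. {w \<in> space M. Y w = y})"
        using 0 by (auto simp: N_def)
      then show ?thesis using Y(1) Z by (auto intro!: sets.countable_UN')
    next
      case (Suc m)
      from N_Suc[of m] show ?thesis
      proof
        assume "\<exists>y\<in>Z. \<forall>w. (N w = Suc m) = (Y w = y)"
        then obtain y where "y \<in> Z" "\<forall>w. (N w = Suc m) = (Y w = y)" by blast
        then show ?thesis using Y(1)[of y] Suc by simp
      next
        assume "\<forall>w. N w \<noteq> Suc m"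
        then show ?thesis using Suc by simp
      qed
    qed
    then show "N -` {n} \<inter> space M \<in> sets M" by (simp add: vimage_def Int_def conj_commute)
  qed simp_all
  have int: "integrable M (\<lambda>w. of_bool (Y w = y) * k w)" if "y \<in> Z" "integrable M k" for y and k :: "'a \<Rightarrow> complex"
  proof (rule Bochner_Integration.integrable_bound[OF that(2)])
    have [measurable]: "Measurable.pred M (\<lambda>w. Y w = y)" "k \<in> borel_measurable M"
      using Y(1)[OF that(1)] that(2) by (auto simp: pred_def)
    show "(\<lambda>w. of_bool (Y w = y) * k w) \<in> borel_measurable M" by measurable
  qed (auto simp: norm_mult)
  have zero: "(\<integral>w. of_bool (N w = n) * h w \<partial>M) = 0" for n
  proof (cases n)
    case 0
    have "(\<integral>w. of_bool (N w = n) * h w \<partial>M) = (\<integral>w. 0 \<partial>M)"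
    proof (rule integral_cong_AE)
      show "(\<lambda>w. of_bool (N w = n) * h w) \<in> borel_measurable M" using N h by measurable
      show "AE w in M. of_bool (N w = n) * h w = 0" using Y(2) by eventually_elim (simp add: N_def 0)
    qed simp
    then show ?thesis by simp
  next
    case (Suc m)
    from N_Suc[of m] show ?thesis
    proof
      assume "\<exists>y\<in>Z. \<forall>w. (N w = Suc m) = (Y w = y)"
      then obtain y where y: "y \<in> Z" "\<forall>w. (N w = Suc m) = (Y w = y)" by blast
      have "(\<integral>w. of_bool (N w = n) * h w \<partial>M) = (\<integral>w. of_bool (Y w = y) * f w - of_bool (Y w = y) * g w \<partial>M)"
        using y Suc by (simp add: h_def algebra_simps)
      also have "\<dots> = 0" using eq[OF y(1)] int[OF y(1)] f g by simp
      finally show ?thesis .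
    qed (use Suc in simp)
  qed
  have "(\<lambda>n. \<integral>w. of_bool (N w = n) * h w \<partial>M) sums (\<integral>w. h w \<partial>M)"
    by (rule integral_sums_nat[OF h N])
  then have "(\<lambda>n::nat. 0::complex) sums (\<integral>w. h w \<partial>M)" by (simp only: zero)
  then have "(\<integral>w. h w \<partial>M) = 0" using sums_zero sums_unique2 by blast
  then show ?thesis unfolding h_def using f g by simp
qed

lemma (in product_prob_space) integral_prod_indep:
  fixes f :: "'k \<Rightarrow> ('i \<Rightarrow> 'a) \<Rightarrow> complex"
  assumes "finite K" "\<And>k. k \<in> K \<Longrightarrow> f k \<in> borel_measurable (PiM I M)" "\<And>k w. k \<in> K \<Longrightarrow> norm (f k w) \<le> 1"
    and "\<And>k. k \<in> K \<Longrightarrow> depends_on (A k) (f k)" "disjoint_family_on A K"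
  shows "(\<integral>w. (\<Prod>k\<in>K. f k w) \<partial>PiM I M) = (\<Prod>k\<in>K. \<integral>w. f k w \<partial>PiM I M)"
  using assms
proof (induction K rule: finite_induct)
  case empty
  then show ?case by (simp add: P.prob_space)
next
  case (insert k K)
  have [measurable]: "k' \<in> insert k K \<Longrightarrow> f k' \<in> borel_measurable (PiM I M)" for k' by (rule insert.prems)
  have b: "norm (\<Prod>k\<in>K. f k w) \<le> 1" for w
    unfolding prod_norm[symmetric] using insert.prems by (intro prod_le_1) auto
  have m: "(\<lambda>w. \<Prod>k\<in>K. f k w) \<in> borel_measurable (PiM I M)"
    by (rule borel_measurable_prod) (use insert.prems in auto)
  have "(\<integral>w. (\<Prod>k\<in>insert k K. f k w) \<partial>PiM I M) = (\<integral>w. f k w * (\<Prod>k\<in>K. f k w) \<partial>PiM I M)"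
    using insert.hyps by simp
  also have "\<dots> = (\<integral>w. f k w \<partial>PiM I M) * (\<integral>w. (\<Prod>k\<in>K. f k w) \<partial>PiM I M)"
  proof (rule integral_indep[where A="A k" and B="\<Union>k\<in>K. A k"])
    have "norm (f k w * (\<Prod>k\<in>K. f k w)) \<le> 1 * 1" for w
      unfolding norm_mult using insert.prems(2)[of k w] b[of w] by (intro mult_mono) auto
    then show "integrable (PiM I M) (\<lambda>w. f k w * (\<Prod>k\<in>K. f k w))"
      using m insert.prems(1)[of k] by (intro P.integrable_const_bound[where B="1 * 1"] borel_measurable_times AE_I2) auto
    show "depends_on (\<Union>k\<in>K. A k) (\<lambda>w. \<Prod>k\<in>K. f k w)"
    proof (rule depends_onI, rule prod.cong[OF refl])
      fix w w' :: "'i \<Rightarrow> 'a" and k' assume *: "\<And>s. s \<in> (\<Union>k\<in>K. A k) \<Longrightarrow> w s = w' s" "k' \<in> K"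
      show "f k' w = f k' w'"
        by (rule depends_onD[OF insert.prems(3)[of k']]) (use * in auto)
    qed
    show "A k \<inter> (\<Union>k\<in>K. A k) = {}"
      using insert.prems(4) insert.hyps by (auto simp: disjoint_family_on_def)
  qed (use insert.prems in auto)
  also have "(\<integral>w. (\<Prod>k\<in>K. f k w) \<partial>PiM I M) = (\<Prod>k\<in>K. \<integral>w. f k w \<partial>PiM I M)"
    using insert.prems by (intro insert.IH) (auto simp: disjoint_family_on_def)
  finally show ?case using insert.hyps by simp
qed

context polling_system
begin

text \<open>
  The value outside \<open>sources P\<close> is arbitrary; it makes \<open>law\<close> a family of probability measures over
  all indices.
\<close>
definition law :: "source \<Rightarrow> real measure" where
  "law s = (if s \<in> sources P then source_law P s else return borel 0)"

abbreviation Om :: "(source \<Rightarrow> real) measure" where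
  "Om \<equiv> PiM (sources P) law"

lemma rates_pos: "j \<in> types \<Longrightarrow> 0 < arr_rate P j" "j \<in> types \<Longrightarrow> 0 < retr_rate P j"
  using valid by (auto simp: valid_polling_def)

lemma dists: "j \<in> types \<Longrightarrow> nonneg_dist (serv P j)" "j \<in> types \<Longrightarrow> nonneg_dist (switch P j)"
  using valid by (auto simp: valid_polling_def)

lemma law_simps:
  "j \<in> types \<Longrightarrow> law (Arr j n) = density lborel (exponential_density (arr_rate P j))"
  "j \<in> types \<Longrightarrow> law (Retr j c q) = density lborel (exponential_density (retr_rate P j))"
  "j \<in> types \<Longrightarrow> law (Serv j c) = serv P j"
  "law (Switch k) = switch P (queue P k)"
  by (simp_all add: law_def)

lemma sets_law: "sets (law s) = sets borel"
proof (cases "s \<in> sources P")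
  case True
  then show ?thesis using dists queue_types
    by (cases s) (auto simp: law_simps nonneg_dist_def)
qed (simp add: law_def)

lemma prob_space_law: "prob_space (law s)"
proof (cases "s \<in> sources P")
  case True
  then show ?thesis using dists queue_types rates_pos
    by (cases s) (auto simp: law_simps nonneg_dist_def intro!: prob_space_exponential_density)
qed (simp add: law_def prob_space_return)

sublocale src: real_product_prob_space law "sources P"
  by (intro real_product_prob_space.intro real_product_prob_space_axioms.intro product_prob_spaceI prob_space_law sets_law)

end

section \<open>Almost sure regularity and measurability\<close>

context polling_system
begin

lemma countable_sources: "countable (sources P)"
  unfolding sources_def by auto

lemma AE_nonneg: "AE w in Om. \<forall>s\<in>sources P. 0 \<le> w s"
proof (subst AE_ball_countable[OF countable_sources], rule ballI)
  fix s assume s: "s \<in> sources P"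
  have "AE x in law s. 0 \<le> x"
  proof -
    have e: "AE x in density lborel (exponential_density \<rho>). 0 \<le> x" for \<rho> :: real
      by (subst AE_density) (auto simp: exponential_density_def)
    have d: "AE x in D. 0 \<le> x" if "nonneg_dist D" for D using that by (simp add: nonneg_dist_def)
    have "\<exists>D. law s = D \<and> (AE x in D. 0 \<le> x)"
      using s e d dists queue_types by (cases s) (simp_all add: law_simps)
    then show ?thesis by blast
  qed
  then show "AE w in Om. 0 \<le> w s" by (rule src.AE_component[OF s])
qed

lemma AE_regular: "AE w in Om. regular P w"
proof -
  have arr: "AE w in Om. (\<forall>l. 0 < w (Arr j l)) \<and> (\<forall>B. \<exists>n. B < (\<Sum>l<n. w (Arr j l)))" if "j \<in> types" for j
    using that by (intro src.AE_nonneg_unbounded[of "Arr j" "arr_rate P j"]) (auto simp: inj_def law_simps rates_pos)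
  have retr: "AE w in Om. (\<forall>l. 0 < w (Retr j c l)) \<and> (\<forall>B. \<exists>n. B < (\<Sum>l<n. w (Retr j c l)))" if "j \<in> types" for j c
    using that by (intro src.AE_nonneg_unbounded[of "Retr j c" "retr_rate P j"]) (auto simp: inj_def law_simps rates_pos)
  have "AE w in Om. \<forall>j\<in>types. ((\<forall>l. 0 < w (Arr j l)) \<and> (\<forall>B. \<exists>n. B < (\<Sum>l<n. w (Arr j l)))) \<and>
      (\<forall>c. (\<forall>l. 0 < w (Retr j c l)) \<and> (\<forall>B. \<exists>n. B < (\<Sum>l<n. w (Retr j c l))))"
    using arr retr by (intro AE_finite_allI AE_conjI) (auto simp: AE_all_countable)
  with AE_nonneg show ?thesis
    by eventually_elim (auto simp: regular_def)
qed

lemma measurable_source: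
  assumes "s \<in> sources P" shows "(\<lambda>w. w s) \<in> borel_measurable Om"
  using src.measurable_coordinate[OF assms] .

context
  fixes N :: "'b measure" and v :: "'b \<Rightarrow> source \<Rightarrow> real"
  assumes v: "\<And>s. s \<in> sources P \<Longrightarrow> (\<lambda>x. v x s) \<in> borel_measurable N"
begin

lemma measurable_entry: "j \<in> types \<Longrightarrow> (\<lambda>x. entry x0 (v x) j c) \<in> borel_measurable N"
  unfolding entry_def using v by (auto intro!: borel_measurable_sum)

lemma measurable_point: "j \<in> types \<Longrightarrow> (\<lambda>x. point x0 (v x) j c q) \<in> borel_measurable N"
  unfolding point_def using v measurable_entry by (intro borel_measurable_add borel_measurable_sum) auto

lemma measurable_start: "s \<in> sources P \<Longrightarrow> (\<lambda>x. start x0 s (v x)) \<in> borel_measurable N"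
  using v measurable_point by (cases s) (auto intro!: borel_measurable_sum)

lemma measurable_stage_time:
  assumes "\<And>j c. (j, c) \<in> J \<Longrightarrow> j \<in> types" shows "(\<lambda>x. stage_time P J k (v x)) \<in> borel_measurable N"
  unfolding stage_time_def using v assms
  by (intro borel_measurable_add borel_measurable_sum borel_measurable_const) auto

lemma measurable_stage_conj:
  "(\<lambda>x. fst (stage P x0 (v x) k)) \<in> borel_measurable N \<and>
   (\<forall>j c. Measurable.pred N (\<lambda>x. (j, c) \<in> snd (stage P x0 (v x) k)))"
proof (induction k)
  case (Suc k)
  let ?i = "queue P k"
  have [measurable]: "(\<lambda>x. attempt x0 (v x) ?i c m) \<in> borel_measurable N" for c m
    unfolding attempt_point by (rule measurable_point[OF queue_types])
  have [measurable]: "(\<lambda>x. fst (stage P x0 (v x) k)) \<in> borel_measurable N"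
    "Measurable.pred N (\<lambda>x. (j, c) \<in> snd (stage P x0 (v x) k))" for j c using Suc by auto
  have jm[measurable]: "Measurable.pred N (\<lambda>x. c \<in> joining (v x) k)" for c
    unfolding joining_def mem_Collect_eq by measurable
  have sw[measurable]: "(\<lambda>x. v x (Switch k)) \<in> borel_measurable N" by (rule v) simp
  have [measurable]: "(\<lambda>x. \<Sum>c\<in>joining (v x) k. v x (Serv ?i c)) \<in> borel_measurable N"
    by (rule borel_measurable_sum_random_set[OF jm]) (rule v, use queue_types[of k] in simp)
  have "(\<lambda>x. fst (stage P x0 (v x) (Suc k))) \<in> borel_measurable N"
    unfolding stage_Suc fst_conv by measurable
  moreover have "(j, c) \<in> snd (stage P x0 (v x) (Suc k)) \<longleftrightarrow> (j, c) \<in> snd (stage P x0 (v x) k) \<or> (j = ?i \<and> c \<in> joining (v x) k)" for x j c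
    unfolding stage_Suc snd_conv by auto
  then have "Measurable.pred N (\<lambda>x. (j, c) \<in> snd (stage P x0 (v x) (Suc k)))" for j c by simp
  ultimately show ?case by blast
qed simp

lemma measurable_stage:
  "(\<lambda>x. fst (stage P x0 (v x) k)) \<in> borel_measurable N"
  "Measurable.pred N (\<lambda>x. (j, c) \<in> snd (stage P x0 (v x) k))"
  using measurable_stage_conj by auto

lemma measurable_num_at:
  assumes j: "j \<in> types" shows "(\<lambda>x. num_at P x0 (v x) k j) \<in> measurable N (count_space UNIV)"
proof -
  note [measurable] = measurable_stage measurable_entry[OF j]
  have "num_at P x0 (v x) k j = card {c. entry x0 (v x) j c \<le> fst (stage P x0 (v x) k) \<and> (j, c) \<notin> snd (stage P x0 (v x) k)}" for x
    by (simp add: num_at_def case_prod_beta)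
  then show ?thesis by simp
qed

lemma measurable_past: 
  assumes "s \<in> sources P" shows "Measurable.pred N (\<lambda>x. s \<in> past P x0 (v x) k)"
proof -
  note [measurable] = measurable_stage
  show ?thesis
  proof (cases s)
    case (Arr j n)
    have [measurable]: "(\<lambda>x. start x0 (Arr j (Suc n)) (v x)) \<in> borel_measurable N"
      using assms Arr by (intro measurable_start) auto
    show ?thesis unfolding Arr past_simps by measurable
  next
    case (Retr j c q)
    have [measurable]: "(\<lambda>x. point x0 (v x) j c (Suc q)) \<in> borel_measurable N"
      using assms Retr by (intro measurable_point) auto
    show ?thesis unfolding Retr past_simps by measurable
  qed (simp_all add: measurable_stage(2))
qed

end

text \<open>
  The start of the stage is \<open>stage_time P J k w\<close> for one of countably many sets \<open>J\<close>, and this sum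
  contains service and switchover times only. A ringing time contains an exponential variable, which
  is independent of it.
\<close>
lemma AE_untied: "AE w in Om. untied P x0 w k"
proof -
  let ?Js = "{J. finite J \<and> J \<subseteq> types \<times> UNIV} :: (nat \<times> nat) set set"
  have cJ: "countable ?Js"
    by (rule countable_subset[OF _ countable_Collect_finite]) auto
  have "AE w in Om. \<forall>J\<in>?Js. \<forall>j\<in>types. \<forall>n c. start x0 (Arr j (Suc n)) w \<noteq> stage_time P J k w \<and>
      start x0 (Retr j c (Suc n)) w \<noteq> stage_time P J k w"
  proof (subst AE_ball_countable[OF cJ], rule ballI, rule AE_finite_allI)
    fix J j assume J: "J \<in> ?Js" and j: "j \<in> types"
    have tm: "(\<lambda>w. stage_time P J k w) \<in> borel_measurable Om"
      using J by (intro measurable_stage_time measurable_source) auto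
    have "AE w in Om. start x0 (Arr j (Suc n)) w \<noteq> stage_time P J k w \<and>
      start x0 (Retr j c (Suc n)) w \<noteq> stage_time P J k w" for n c
    proof (rule AE_conjI)
      have "AE w in Om. w (Arr j n) \<noteq> stage_time P J k w - start x0 (Arr j n) w"
      proof (rule src.AE_no_tie[where \<rho>="arr_rate P j"])
        show "(\<lambda>w. stage_time P J k w - start x0 (Arr j n) w) \<in> borel_measurable Om"
          using tm j by (intro borel_measurable_diff measurable_start measurable_source) auto
        show "depends_on (- {Arr j n}) (\<lambda>w. stage_time P J k w - start x0 (Arr j n) w)"
          by (rule depends_onI) (auto simp: stage_time_def intro!: arg_cong2[where f="(-)"] arg_cong2[where f="(+)"] sum.cong)
      qed (use j in \<open>auto simp: law_simps rates_pos\<close>)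
      then show "AE w in Om. start x0 (Arr j (Suc n)) w \<noteq> stage_time P J k w"
        by eventually_elim auto
      have "AE w in Om. w (Retr j c n) \<noteq> stage_time P J k w - start x0 (Retr j c n) w"
      proof (rule src.AE_no_tie[where \<rho>="retr_rate P j"])
        show "(\<lambda>w. stage_time P J k w - start x0 (Retr j c n) w) \<in> borel_measurable Om"
          using tm j by (intro borel_measurable_diff measurable_start measurable_source) auto
        show "depends_on (- {Retr j c n}) (\<lambda>w. stage_time P J k w - start x0 (Retr j c n) w)"
          by (rule depends_onI) (auto simp: stage_time_def point_def entry_def
              intro!: arg_cong2[where f="(-)"] arg_cong2[where f="(+)"] sum.cong)
      qed (use j in \<open>auto simp: law_simps rates_pos\<close>)
      then show "AE w in Om. start x0 (Retr j c (Suc n)) w \<noteq> stage_time P J k w"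
        by eventually_elim (auto simp: point_Suc)
    qed
    then show "AE w in Om. \<forall>n c. start x0 (Arr j (Suc n)) w \<noteq> stage_time P J k w \<and>
      start x0 (Retr j c (Suc n)) w \<noteq> stage_time P J k w"
      unfolding AE_all_countable by blast
  qed simp
  then show ?thesis using AE_regular
  proof eventually_elim
    case (elim w)
    have "finite (snd (stage P x0 w k))" by (rule finite_stage[OF elim(2)])
    moreover have "snd (stage P x0 w k) \<subseteq> types \<times> UNIV" using stage_types by auto
    ultimately have "snd (stage P x0 w k) \<in> ?Js" by blast
    with elim(1) show ?case
      unfolding untied_def fst_stage[OF \<open>finite _\<close>] by blast
  qed
qed

lemma past_sources: "past P x0 w k \<subseteq> sources P"
proof
  fix s assume "s \<in> past P x0 w k"
  then show "s \<in> sources P" using stage_types by (cases s) auto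
qed

lemma measurable_past_eq: "{w \<in> space Om. past P x0 w k = I} \<in> sets Om"
proof (cases "I \<subseteq> sources P")
  case True
  have "{w \<in> space Om. past P x0 w k = I} = (\<Inter>s\<in>sources P. {w \<in> space Om. s \<in> past P x0 w k \<longleftrightarrow> s \<in> I})"
    using True past_sources sources_simps(4)[of 0] by blast
  also have "\<dots> \<in> sets Om"
  proof (rule sets.countable_INT'[OF countable_sources])
    show "sources P \<noteq> {}" using sources_simps(4)[of 0] by blast
    show "(\<lambda>s. {w \<in> space Om. s \<in> past P x0 w k \<longleftrightarrow> s \<in> I}) ` sources P \<subseteq> sets Om"
    proof clarify
      fix s assume "s \<in> sources P"
      then have [measurable]: "Measurable.pred Om (\<lambda>w. s \<in> past P x0 w k)"
        by (intro measurable_past measurable_source)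
      show "{w \<in> space Om. s \<in> past P x0 w k \<longleftrightarrow> s \<in> I} \<in> sets Om" by measurable
    qed
  qed
  finally show ?thesis .
next
  case False
  then have "{w \<in> space Om. past P x0 w k = I} = {}" using past_sources by blast
  then show ?thesis by (simp only: sets.empty_sets)
qed

lemma AE_in_progress_exists: "AE w in Om. \<exists>a r J. snapshot P x0 a r J \<and> in_progress a r J k w"
  using AE_regular AE_untied[of k] by eventually_elim (metis in_progress_exists)

end

section \<open>Transforms of the ingredients of a stage\<close>

lemma sum_Pow_binomial:
  fixes p q s t :: "'a::comm_semiring_1"
  assumes "finite A"
  shows "(\<Sum>D\<in>Pow A. p ^ card D * q ^ card (A - D) * (s ^ card (A - D) * t ^ card D)) = (p * t + q * s) ^ card A"
proof -
  have "(p * t + q * s) ^ card A = (\<Prod>x\<in>A. p * t + q * s)" by simp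
  also have "\<dots> = (\<Sum>D\<in>Pow A. (\<Prod>x\<in>D. p * t) * (\<Prod>x\<in>A - D. q * s))"
    by (rule prod_add[OF assms])
  also have "\<dots> = (\<Sum>D\<in>Pow A. p ^ card D * q ^ card (A - D) * (s ^ card (A - D) * t ^ card D))"
    by (intro sum.cong refl) (simp add: power_mult_distrib ac_simps)
  finally show ?thesis by simp
qed

context polling_system
begin

text \<open>
  The exponent per unit of time for the arrivals of all types; \<open>beta\<close> and \<open>sigma\<close> are transforms
  at this point.
\<close>
definition arrival_exponent :: "(nat \<Rightarrow> complex) \<Rightarrow> complex" where
  "arrival_exponent z = (\<Sum>j=1..nq P. of_real (arr_rate P j) * (1 - z j))"

definition stage_factor :: "nat \<Rightarrow> (nat \<Rightarrow> complex) \<Rightarrow> complex" where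
  "stage_factor k z = sigma P (queue P k) z * exp (- of_real (glue P (queue P k)) *
     ((\<Sum>j\<in>types - {queue P k}. of_real (arr_rate P j) * (1 - z j)) +
       of_real (arr_rate P (queue P k)) * (1 - beta P (queue P k) z)))"

text \<open>
  The monomial of the numbers one stage later, with \<open>D\<close> and \<open>m\<close> still free.
\<close>
definition next_weight :: "(nat \<Rightarrow> complex) \<Rightarrow> (nat \<Rightarrow> nat) \<Rightarrow> (nat \<Rightarrow> nat \<Rightarrow> nat) \<Rightarrow> (nat \<times> nat) set \<Rightarrow> nat \<Rightarrow> nat set \<Rightarrow> nat \<Rightarrow> (source \<Rightarrow> real) \<Rightarrow> complex" where
  "next_weight z a r J k D m w = (\<Prod>j\<in>types. z j ^ next_num a J k D m (busy k (joined a k D m) w) j w)"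

lemma finite_orbit: "finite (orbit a J j)"
  by (simp add: orbit_def)

lemma measurable_new_arrivals [measurable (raw)]:
  assumes j: "j \<in> types" and \<tau>: "\<tau> \<in> borel_measurable Om"
  shows "(\<lambda>w. new_arrivals a j (\<tau> w) w) \<in> measurable Om (count_space UNIV)"
    "(\<lambda>w. new_arrivals_before a j (\<tau> w) w) \<in> measurable Om (count_space UNIV)"
  unfolding new_arrivals_def new_arrivals_before_def using j
  by (intro measurable_renewals measurable_source \<tau>; simp)+

lemma measurable_busy: "(\<lambda>w. busy k B w) \<in> borel_measurable Om"
  unfolding busy_def using queue_types[of k]
  by (intro borel_measurable_add borel_measurable_sum measurable_source) simp_all

lemma measurable_next_num:
  assumes "j \<in> types" "u \<in> borel_measurable Om"
  shows "(\<lambda>w. next_num a J k D m (u w) j w) \<in> measurable Om (count_space UNIV)"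
proof -
  have [measurable]: "(\<lambda>w. new_arrivals a j (glue P (queue P k) + u w) w) \<in> measurable Om (count_space UNIV)"
    using assms by (intro measurable_new_arrivals) auto
  show ?thesis unfolding next_num_def by measurable
qed

lemma measurable_pow_nat:
  fixes z :: complex
  assumes [measurable]: "n \<in> measurable N (count_space UNIV)"
  shows "(\<lambda>w. z ^ n w) \<in> borel_measurable N"
  by measurable

lemma measurable_next_weight: "next_weight z a r J k D m \<in> borel_measurable Om"
  unfolding next_weight_def[abs_def]
  by (intro borel_measurable_prod measurable_pow_nat measurable_next_num measurable_busy) auto

lemma measurable_sticking: "Measurable.pred Om (\<lambda>w. sticking a r J k w = D)"
proof -
  have [measurable]: "(\<lambda>w. w (Retr (queue P k) c q)) \<in> borel_measurable Om" for c q
    using queue_types[of k] by (intro measurable_source) simp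
  let ?o = "orbit a J (queue P k)"
  have "sticking a r J k w = D \<longleftrightarrow> D \<subseteq> ?o \<and> (\<forall>c\<in>?o. w (Retr (queue P k) c (r (queue P k) c)) < glue P (queue P k) \<longleftrightarrow> c \<in> D)" for w
    unfolding sticking_def by blast
  moreover have "Measurable.pred Om (\<lambda>w. D \<subseteq> ?o \<and> (\<forall>c\<in>?o. w (Retr (queue P k) c (r (queue P k) c)) < glue P (queue P k) \<longleftrightarrow> c \<in> D))"
    by measurable
  ultimately show ?thesis by simp
qed

text \<open>
  The customers stick independently, each with the probability that its fresh retrial interval is
  shorter than the glue period.
\<close>
lemma prob_sticking:
  assumes D: "D \<subseteq> orbit a J (queue P k)"
  defines "q \<equiv> exp (- retr_rate P (queue P k) * glue P (queue P k))"
  shows "(\<integral>w. of_bool (sticking a r J k w = D) \<partial>Om) = complex_of_real ((1 - q) ^ card D * q ^ card (orbit a J (queue P k) - D))"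
proof -
  let ?i = "queue P k" let ?o = "orbit a J ?i" and ?G = "glue P ?i" and ?R = "\<lambda>c. Retr ?i c (r ?i c)"
  let ?E = "density lborel (exponential_density (retr_rate P ?i))"
  have i: "?i \<in> types" by (rule queue_types)
  \<comment> \<open>only retrial intervals occur below; the value 0 elsewhere is a dummy\<close>
  define \<phi> where "\<phi> s x = (case s of Retr j c n \<Rightarrow> complex_of_real (of_bool ((x < ?G) = (c \<in> D))) | _ \<Rightarrow> 0)" for s and x :: real
  have inj: "inj_on ?R ?o" by (simp add: inj_on_def)
  have "of_bool (sticking a r J k w = D) = (\<Prod>s\<in>?R ` ?o. \<phi> s (w s))" for w
  proof -
    have "sticking a r J k w = D \<longleftrightarrow> (\<forall>c\<in>?o. (w (?R c) < ?G) = (c \<in> D))"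
      using D unfolding sticking_def by blast
    then show ?thesis
      by (auto simp: prod.reindex[OF inj] \<phi>_def finite_orbit intro!: prod.neutral prod_zero[symmetric])
  qed
  then have "(\<integral>w. of_bool (sticking a r J k w = D) \<partial>Om) = (\<integral>w. (\<Prod>s\<in>?R ` ?o. \<phi> s (w s)) \<partial>Om)" by simp
  also have "\<dots> = (\<Prod>s\<in>?R ` ?o. \<integral>x. \<phi> s x \<partial>law s)"
  proof (rule src.integral_prod_components)
    fix s assume "s \<in> ?R ` ?o"
    then obtain c where c: "s = ?R c" by blast
    show m: "\<phi> s \<in> borel_measurable borel" unfolding \<phi>_def c source.case by measurable
    show "integrable (law s) (\<phi> s)"
      using m by (intro finite_measure.integrable_const_bound[OF prob_space.finite_measure[OF prob_space_law], where B=1]) (auto simp: \<phi>_def c sets_law cong: measurable_cong_sets)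
  qed (use i in \<open>auto simp: finite_orbit\<close>)
  also have "\<dots> = (\<Prod>c\<in>?o. complex_of_real (if c \<in> D then 1 - q else q))"
  proof (subst prod.reindex[OF inj], unfold o_def, rule prod.cong[OF refl])
    fix c
    interpret E: prob_space ?E by (rule prob_space_exponential_density) (rule rates_pos(2)[OF i])
    have G: "0 \<le> ?G" using glue_pos[OF i] by simp
    have d: "distributed ?E lborel (\<lambda>x. x) (exponential_density (retr_rate P ?i))"
    proof -
      have "distr ?E lborel (\<lambda>x. x) = ?E" by (intro distr_id2) simp
      then show ?thesis using rates_pos(2)[OF i]
        by (simp add: distributed_def exponential_density_nonneg)
    qed
    have pG: "E.prob {x \<in> space ?E. x \<le> ?G} = 1 - q"
      using E.erlang_distributed_le[OF d rates_pos(2)[OF i] G] G by (simp add: erlang_CDF_def q_def)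
    have ae: "AE x in ?E. x \<noteq> ?G" by (subst AE_density) (use AE_lborel_singleton[of ?G] in auto)
    have pG': "E.prob {x \<in> space ?E. x < ?G} = 1 - q"
      unfolding pG[symmetric] by (rule E.finite_measure_eq_AE) (use ae in \<open>auto elim!: eventually_mono\<close>)
    have pG'': "E.prob {x \<in> space ?E. \<not> x < ?G} = q"
      using E.prob_neg[of "\<lambda>x. x < ?G"] pG' by simp
    have "(\<integral>x. \<phi> (?R c) x \<partial>law (?R c)) = (\<integral>x. complex_of_real (indicator {x \<in> space ?E. (x < ?G) = (c \<in> D)} x) \<partial>?E)"
      unfolding law_simps(2)[OF i] by (intro Bochner_Integration.integral_cong) (auto simp: \<phi>_def indicator_def)
    also have "\<dots> = complex_of_real (E.prob {x \<in> space ?E. (x < ?G) = (c \<in> D)})"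
      by (simp add: Int_def)
    also have "\<dots> = complex_of_real (if c \<in> D then 1 - q else q)"
      using pG' pG'' by (cases "c \<in> D") simp_all
    finally show "(\<integral>x. \<phi> (?R c) x \<partial>law (?R c)) = complex_of_real (if c \<in> D then 1 - q else q)" .
  qed
  also have "\<dots> = (\<Prod>c\<in>D. complex_of_real (1 - q)) * (\<Prod>c\<in>?o - D. complex_of_real q)"
    by (subst prod.subset_diff[OF D finite_orbit]) (auto simp: mult.commute intro!: arg_cong2[where f="(*)"] prod.cong)
  finally show ?thesis by simp
qed

lemma integrable_lst:
  assumes D: "nonneg_dist D" and s: "0 \<le> Re s"
  shows "integrable D (\<lambda>x. exp (- s * of_real x))"
proof -
  interpret prob_space D using D by (simp add: nonneg_dist_def)
  have "(\<lambda>x::real. exp (- s * of_real x)) \<in> borel_measurable borel"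
    by (intro borel_measurable_continuous_onI continuous_intros)
  then have m: "(\<lambda>x. exp (- s * of_real x)) \<in> borel_measurable D"
    using D by (simp add: nonneg_dist_def cong: measurable_cong_sets)
  show ?thesis
  proof (rule integrable_const_bound[where B=1])
    have "AE x in D. 0 \<le> x" using D by (simp add: nonneg_dist_def)
    then show "AE x in D. norm (exp (- s * of_real x)) \<le> 1"
      by eventually_elim (use s in \<open>simp add: norm_exp_eq_Re\<close>)
  qed (rule m)
qed

lemma busy_transform:
  assumes B: "finite B" and s: "0 \<le> Re s"
  shows "(\<integral>w. exp (- s * of_real (busy k B w)) \<partial>Om) = lst (serv P (queue P k)) s ^ card B * lst (switch P (queue P k)) s"
proof -
  let ?i = "queue P k" and ?S = "insert (Switch k) (Serv (queue P k) ` B)"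
  have i: "?i \<in> types" by (rule queue_types)
  have inj: "inj_on (Serv ?i) B" by (simp add: inj_on_def)
  have "exp (- s * of_real (busy k B w)) = (\<Prod>x\<in>?S. exp (- s * of_real (w x)))" for w
  proof -
    have "(\<Prod>x\<in>?S. exp (- s * of_real (w x))) = exp (\<Sum>x\<in>?S. - s * of_real (w x))"
      using B by (subst exp_sum) auto
    also have "(\<Sum>x\<in>?S. - s * of_real (w x)) = - s * of_real (busy k B w)"
      using B by (subst sum.insert) (auto simp: busy_def sum.reindex[OF inj] sum_distrib_left algebra_simps sum_negf)
    finally show ?thesis by simp
  qed
  then have "(\<integral>w. exp (- s * of_real (busy k B w)) \<partial>Om) = (\<integral>w. (\<Prod>x\<in>?S. exp (- s * of_real (w x))) \<partial>Om)" by simp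
  also have "\<dots> = (\<Prod>x\<in>?S. \<integral>y. exp (- s * of_real y) \<partial>law x)"
  proof (rule src.integral_prod_components)
    fix x assume "x \<in> ?S"
    then have "nonneg_dist (law x)" using i dists[OF i] by (auto simp: law_simps)
    then show "integrable (law x) (\<lambda>y. exp (- s * of_real y))" using s by (rule integrable_lst)
  qed (use B i in auto)
  also have "\<dots> = lst (serv P ?i) s ^ card B * lst (switch P ?i) s"
    using B i by (subst prod.insert) (auto simp: prod.reindex[OF inj] law_simps lst_def)
  finally show ?thesis .
qed

text \<open>
  The arrival processes of the types are independent. Only for the served type do the glue period and
  the rest of the stage have to be distinguished, since arrivals in the glue period join.
\<close>
lemma arrivals_transform:
  fixes k :: nat
  assumes z: "\<And>j. j \<in> types \<Longrightarrow> norm (z j) \<le> 1" and u: "0 \<le> u"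
  defines "i \<equiv> queue P k"
  defines "G \<equiv> glue P i"
  shows "(\<integral>w. of_bool (new_arrivals_before a i G w = m) * (\<Prod>j\<in>types. z j ^ next_num a J k D m u j w) \<partial>Om)
    = z i ^ card (orbit a J i - D) * (\<Prod>j\<in>types - {i}. z j ^ card (orbit a J j))
      * exp (- of_real G * (\<Sum>j\<in>types - {i}. of_real (arr_rate P j) * (1 - z j)))
      * of_real (exp (- arr_rate P i * G) * (arr_rate P i * G) ^ m / fact m) * exp (- arrival_exponent z * of_real u)"
proof -
  have i: "i \<in> types" unfolding i_def by (rule queue_types)
  have G: "0 \<le> G" using glue_pos[OF i] by (simp add: G_def)
  define \<psi> where "\<psi> j w = (if j = i then of_bool (new_arrivals_before a i G w = m) * z i ^ (new_arrivals a i (G + u) w - m)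
      else z j ^ new_arrivals a j (G + u) w)" for j w
  define e where "e j = (if j = i then z i ^ card (orbit a J i - D) else z j ^ card (orbit a J j))" for j
  have split: "(\<Prod>j\<in>types. g j) = g i * (\<Prod>j\<in>types - {i}. g j)" for g :: "nat \<Rightarrow> complex"
    using i by (simp add: prod.remove)
  have "of_bool (new_arrivals_before a i G w = m) * (\<Prod>j\<in>types. z j ^ next_num a J k D m u j w)
      = (\<Prod>j\<in>types. e j) * (\<Prod>j\<in>types. \<psi> j w)" for w
  proof -
    have "(\<Prod>j\<in>types - {i}. z j ^ next_num a J k D m u j w) = (\<Prod>j\<in>types - {i}. e j) * (\<Prod>j\<in>types - {i}. \<psi> j w)"
      unfolding prod.distrib[symmetric]
      by (intro prod.cong) (auto simp: next_num_def e_def \<psi>_def power_add i_def G_def)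
    then show ?thesis unfolding split
      by (simp add: e_def \<psi>_def next_num_def power_add G_def[symmetric] i_def[symmetric])
  qed
  then have "(\<integral>w. of_bool (new_arrivals_before a i G w = m) * (\<Prod>j\<in>types. z j ^ next_num a J k D m u j w) \<partial>Om)
     = (\<Prod>j\<in>types. e j) * (\<integral>w. (\<Prod>j\<in>types. \<psi> j w) \<partial>Om)" by simp
  also have "(\<integral>w. (\<Prod>j\<in>types. \<psi> j w) \<partial>Om) = (\<Prod>j\<in>types. \<integral>w. \<psi> j w \<partial>Om)"
  proof (rule src.integral_prod_indep[where A="\<lambda>j. range (Arr j)"])
    fix j assume j: "j \<in> types"
    have [measurable]: "(\<lambda>w. new_arrivals_before a i G w) \<in> measurable Om (count_space UNIV)"
       "(\<lambda>w. new_arrivals a j (G + u) w) \<in> measurable Om (count_space UNIV)"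
       "(\<lambda>w. new_arrivals a i (G + u) w) \<in> measurable Om (count_space UNIV)"
      using i j by (intro measurable_new_arrivals; simp)+
    show "\<psi> j \<in> borel_measurable Om" unfolding \<psi>_def by measurable
    show "norm (\<psi> j w) \<le> 1" for w
      unfolding \<psi>_def using z[OF i] z[OF j] by (auto simp: norm_mult norm_power intro: power_le_one)
    show "depends_on (range (Arr j)) (\<psi> j)"
    proof (rule depends_onI)
      fix w w' :: "source \<Rightarrow> real" assume *: "\<And>s. s \<in> range (Arr j) \<Longrightarrow> w s = w' s"
      then have "(\<lambda>l. w (Arr j (a j + l))) = (\<lambda>l. w' (Arr j (a j + l)))" by simp
      then show "\<psi> j w = \<psi> j w'"
        unfolding \<psi>_def new_arrivals_def new_arrivals_before_def by (cases "j = i") simp_all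
    qed
  qed (auto simp: disjoint_family_on_def)
  also have "\<dots> = (\<integral>w. \<psi> i w \<partial>Om) * (\<Prod>j\<in>types - {i}. \<integral>w. \<psi> j w \<partial>Om)" by (rule split)
  also have "(\<integral>w. \<psi> i w \<partial>Om) = of_real (exp (- arr_rate P i * G) * (arr_rate P i * G) ^ m / fact m) * exp (- of_real (arr_rate P i * u) * (1 - z i))"
    unfolding \<psi>_def new_arrivals_def new_arrivals_before_def if_P[OF refl]
    by (rule src.pgf_renewals_two_times) (use i G u z in \<open>auto simp: inj_def law_simps rates_pos\<close>)
  also have "(\<Prod>j\<in>types - {i}. \<integral>w. \<psi> j w \<partial>Om) = (\<Prod>j\<in>types - {i}. exp (- of_real (arr_rate P j * (G + u)) * (1 - z j)))"
  proof (rule prod.cong[OF refl])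
    fix j assume j: "j \<in> types - {i}"
    then have "(\<integral>w. \<psi> j w \<partial>Om) = (\<integral>w. z j ^ renewals (\<lambda>l. w (Arr j (a j + l))) (G + u) \<partial>Om)"
      unfolding \<psi>_def new_arrivals_def by simp
    also have "\<dots> = exp (- of_real (arr_rate P j * (G + u)) * (1 - z j))"
      by (rule src.pgf_renewals) (use j G u z in \<open>auto simp: inj_def law_simps rates_pos\<close>)
    finally show "(\<integral>w. \<psi> j w \<partial>Om) = exp (- of_real (arr_rate P j * (G + u)) * (1 - z j))" .
  qed
  also have "\<dots> = exp (\<Sum>j\<in>types - {i}. - of_real (arr_rate P j * (G + u)) * (1 - z j))"
    by (simp add: exp_sum)
  also have "(\<Sum>j\<in>types - {i}. - of_real (arr_rate P j * (G + u)) * (1 - z j))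
     = - of_real (G + u) * (\<Sum>j\<in>types - {i}. of_real (arr_rate P j) * (1 - z j))"
    unfolding sum_distrib_left by (intro sum.cong) (auto simp: algebra_simps)
  also have "(\<Prod>j\<in>types. e j) = z i ^ card (orbit a J i - D) * (\<Prod>j\<in>types - {i}. z j ^ card (orbit a J j))"
    unfolding split by (simp add: e_def)
  finally have *: "(\<integral>w. of_bool (new_arrivals_before a i G w = m) * (\<Prod>j\<in>types. z j ^ next_num a J k D m u j w) \<partial>Om)
    = z i ^ card (orbit a J i - D) * (\<Prod>j\<in>types - {i}. z j ^ card (orbit a J j)) *
     (of_real (exp (- arr_rate P i * G) * (arr_rate P i * G) ^ m / fact m) * exp (- of_real (arr_rate P i * u) * (1 - z i)) *
      exp (- of_real (G + u) * (\<Sum>j\<in>types - {i}. of_real (arr_rate P j) * (1 - z j))))" .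
  define S where "S = (\<Sum>j\<in>types - {i}. of_real (arr_rate P j) * (1 - z j))"
  have ae: "arrival_exponent z = of_real (arr_rate P i) * (1 - z i) + S"
    unfolding arrival_exponent_def S_def using i by (simp add: sum.remove)
  have "exp (- of_real (arr_rate P i * u) * (1 - z i)) * exp (- of_real (G + u) * (\<Sum>j\<in>types - {i}. of_real (arr_rate P j) * (1 - z j)))
    = exp (- of_real G * (\<Sum>j\<in>types - {i}. of_real (arr_rate P j) * (1 - z j))) * exp (- arrival_exponent z * of_real u)"
    unfolding exp_add[symmetric] S_def[symmetric] ae by (simp add: algebra_simps)
  then show ?thesis unfolding * by (simp only: mult.assoc mult.left_commute)
qed

lemma Re_arrival_exponent:
  assumes "\<And>j. j \<in> types \<Longrightarrow> norm (z j) \<le> 1" shows "0 \<le> Re (arrival_exponent z)"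
proof -
  have "0 \<le> arr_rate P j * (1 - Re (z j))" if "j \<in> types" for j
    using assms[OF that] complex_Re_le_cmod[of "z j"] rates_pos(1)[OF that] by simp
  then show ?thesis unfolding arrival_exponent_def by (auto intro!: sum_nonneg)
qed

end

section \<open>The expected weight after one stage\<close>

context polling_system
begin

text \<open>
  The monomial of the numbers one stage later, with the actual \<open>D\<close> and \<open>m\<close> of the residual path.
\<close>
definition resolved_weight :: "(nat \<Rightarrow> complex) \<Rightarrow> (nat \<Rightarrow> nat) \<Rightarrow> (nat \<Rightarrow> nat \<Rightarrow> nat) \<Rightarrow> (nat \<times> nat) set \<Rightarrow> nat \<Rightarrow> (source \<Rightarrow> real) \<Rightarrow> complex" where
  "resolved_weight z a r J k w =
     next_weight z a r J k (sticking a r J k w) (new_arrivals_before a (queue P k) (glue P (queue P k)) w) w"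

context
  fixes z :: "nat \<Rightarrow> complex" and a :: "nat \<Rightarrow> nat" and r :: "nat \<Rightarrow> nat \<Rightarrow> nat" and J :: "(nat \<times> nat) set" and k :: nat
  assumes z: "\<And>j. j \<in> types \<Longrightarrow> norm (z j) \<le> 1"
begin

abbreviation (input) "\<iota> \<equiv> queue P k"
abbreviation (input) "G \<equiv> glue P \<iota>"
abbreviation (input) "old \<equiv> orbit a J \<iota>"
abbreviation (input) "p \<equiv> exp (- retr_rate P \<iota> * G)"

lemma next_weight_norm: "norm (next_weight z a r J k D m w) \<le> 1"
  unfolding next_weight_def prod_norm[symmetric] norm_power
  using z by (intro prod_le_1) (auto intro: power_le_one)

text \<open>
  Take the arrivals from one copy of the path and the service and switchover times from another. Then
  the former can be averaged first, for a fixed length of visit and switchover, and what remains is the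
  transform of that length.
\<close>
lemma next_weight_integral_joined:
  assumes B: "finite D"
  shows "(\<integral>w. of_bool (new_arrivals_before a \<iota> G w = m) * next_weight z a r J k D m w \<partial>Om)
    = z \<iota> ^ card (old - D) * (\<Prod>j\<in>types - {\<iota>}. z j ^ card (orbit a J j))
      * exp (- of_real G * (\<Sum>j\<in>types - {\<iota>}. of_real (arr_rate P j) * (1 - z j)))
      * of_real (exp (- arr_rate P \<iota> * G) * (arr_rate P \<iota> * G) ^ m / fact m)
      * (beta P \<iota> z ^ card (joined a k D m) * sigma P \<iota> z)" (is "?L = ?C * _")
proof -
  \<comment> \<open>all coordinates except the interarrival times\<close>
  let ?A = "- (\<Union>j. range (Arr j))" and ?B = "joined a k D m"
  have i: "\<iota> \<in> types" by (rule queue_types)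
  have [measurable]: "(\<lambda>w. new_arrivals_before a \<iota> G w) \<in> measurable Om (count_space UNIV)"
    using i by (intro measurable_new_arrivals) auto
  note [measurable] = measurable_next_weight
  have int: "integrable Om (\<lambda>w. of_bool (new_arrivals_before a \<iota> G w = m) * next_weight z a r J k D m w)"
  proof (rule src.P.integrable_const_bound[where B=1])
    show "AE w in Om. norm (of_bool (new_arrivals_before a \<iota> G w = m) * next_weight z a r J k D m w) \<le> 1"
      using next_weight_norm by (auto simp: norm_mult)
  qed measurable
  have sp: "new_arrivals_before a j \<tau> (splice ?A w w') = new_arrivals_before a j \<tau> w'"
    "new_arrivals a j \<tau> (splice ?A w w') = new_arrivals a j \<tau> w'" "busy k D' (splice ?A w w') = busy k D' w" for j \<tau> w w' D'
  proof -
    have "splice ?A w w' (Arr j n) = w' (Arr j n)" "splice ?A w w' (Serv j n) = w (Serv j n)"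
      "splice ?A w w' (Switch n) = w (Switch n)" for j n by (auto simp: splice_def)
    then show "new_arrivals_before a j \<tau> (splice ?A w w') = new_arrivals_before a j \<tau> w'"
      "new_arrivals a j \<tau> (splice ?A w w') = new_arrivals a j \<tau> w'" "busy k D' (splice ?A w w') = busy k D' w"
      by (simp_all add: new_arrivals_def new_arrivals_before_def busy_def)
  qed
  have sp': "next_weight z a r J k D m (splice ?A w w') = (\<Prod>j\<in>types. z j ^ next_num a J k D m (busy k ?B w) j w')" for w w'
    unfolding next_weight_def next_num_def sp ..
  have bm[measurable]: "(\<lambda>w. busy k ?B w) \<in> borel_measurable Om" by (rule measurable_busy)
  have "?L = (\<integral>w. (\<integral>w'. of_bool (new_arrivals_before a \<iota> G w' = m) * (\<Prod>j\<in>types. z j ^ next_num a J k D m (busy k ?B w) j w') \<partial>Om) \<partial>Om)"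
    by (subst src.integral_splice[OF int, of ?A]) (simp only: sp sp')
  also have "\<dots> = (\<integral>w. ?C * exp (- arrival_exponent z * of_real (busy k ?B w)) \<partial>Om)"
  proof (rule integral_cong_AE)
    show "AE w in Om. (\<integral>w'. of_bool (new_arrivals_before a \<iota> G w' = m) * (\<Prod>j\<in>types. z j ^ next_num a J k D m (busy k ?B w) j w') \<partial>Om)
      = ?C * exp (- arrival_exponent z * of_real (busy k ?B w))"
      using AE_nonneg
    proof eventually_elim
      case (elim w)
      then have "0 \<le> busy k ?B w" using i unfolding busy_def by (auto intro!: add_nonneg_nonneg sum_nonneg)
      then show ?case by (rule arrivals_transform[rotated]) (rule z)
    qed
    have "(\<lambda>x::real. ?C * exp (- arrival_exponent z * of_real x)) \<in> borel_measurable borel"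
      by (intro borel_measurable_continuous_onI continuous_intros)
    from measurable_compose[OF bm this]
    show "(\<lambda>w. ?C * exp (- arrival_exponent z * of_real (busy k ?B w))) \<in> borel_measurable Om" .
    have "integrable (distr (Om \<Otimes>\<^sub>M Om) Om (\<lambda>x. splice ?A (fst x) (snd x)))
        (\<lambda>w. of_bool (new_arrivals_before a \<iota> G w = m) * next_weight z a r J k D m w)"
      unfolding src.distr_splice by (rule int)
    from integrable_distr[OF src.measurable_splice this]
    have "(\<lambda>x. of_bool (new_arrivals_before a \<iota> G (snd x) = m) * (\<Prod>j\<in>types. z j ^ next_num a J k D m (busy k ?B (fst x)) j (snd x))) \<in> borel_measurable (Om \<Otimes>\<^sub>M Om)"
      unfolding sp sp' by (rule borel_measurable_integrable)
    then have "(\<lambda>(x, y). of_bool (new_arrivals_before a \<iota> G y = m) * (\<Prod>j\<in>types. z j ^ next_num a J k D m (busy k ?B x) j y)) \<in> borel_measurable (Om \<Otimes>\<^sub>M Om)"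
      by (simp add: case_prod_beta')
    then show "(\<lambda>w. \<integral>w'. of_bool (new_arrivals_before a \<iota> G w' = m) * (\<Prod>j\<in>types. z j ^ next_num a J k D m (busy k ?B w) j w') \<partial>Om) \<in> borel_measurable Om"
      by (rule src.P.borel_measurable_lebesgue_integral)
  qed
  also have "\<dots> = ?C * (\<integral>w. exp (- arrival_exponent z * of_real (busy k ?B w)) \<partial>Om)"
    by (rule integral_mult_right_zero)
  also have "(\<integral>w. exp (- arrival_exponent z * of_real (busy k ?B w)) \<partial>Om) = beta P \<iota> z ^ card ?B * sigma P \<iota> z"
    unfolding beta_def sigma_def arrival_exponent_def[symmetric]
    by (rule busy_transform) (use B Re_arrival_exponent[OF z] in \<open>auto simp: joined_def\<close>)
  finally show ?thesis .
qed

lemma resolved_weight_split: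
  "resolved_weight z a r J k w = (\<Sum>D\<in>Pow old. of_bool (sticking a r J k w = D) * next_weight z a r J k D (new_arrivals_before a \<iota> G w) w)"
proof -
  have "(\<Sum>D\<in>Pow old. of_bool (sticking a r J k w = D) * next_weight z a r J k D (new_arrivals_before a \<iota> G w) w)
     = (\<Sum>D\<in>Pow old. if D = sticking a r J k w then resolved_weight z a r J k w else 0)"
    by (intro sum.cong) (auto simp: resolved_weight_def)
  also have "\<dots> = resolved_weight z a r J k w"
    by (subst sum.delta) (auto simp: finite_orbit sticking_def)
  finally show ?thesis by simp
qed

lemma measurable_next_weight_random:
  "(\<lambda>w. next_weight z a r J k D (new_arrivals_before a \<iota> G w) w) \<in> borel_measurable Om"
proof -
  have [measurable]: "(\<lambda>w. new_arrivals_before a \<iota> G w) \<in> measurable Om (count_space UNIV)"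
    using queue_types by (intro measurable_new_arrivals) auto
  show ?thesis
    by (rule measurable_compose_countable[where f="\<lambda>m w. next_weight z a r J k D m w", OF measurable_next_weight]) measurable
qed

lemma measurable_resolved_weight: "resolved_weight z a r J k \<in> borel_measurable Om"
proof -
  note [measurable] = measurable_next_weight_random measurable_sticking
  have "(\<lambda>w. \<Sum>D\<in>Pow old. of_bool (sticking a r J k w = D) * next_weight z a r J k D (new_arrivals_before a \<iota> G w) w) \<in> borel_measurable Om"
    by (rule borel_measurable_sum) measurable
  then show ?thesis by (simp add: resolved_weight_split[symmetric])
qed

lemma resolved_weight_norm: "norm (resolved_weight z a r J k w) \<le> 1"
  unfolding resolved_weight_def by (rule next_weight_norm)

text \<open>
  Which old customers stick depends on retrial intervals only and is independent of the rest. Each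
  of the \<open>m\<close> arrivals in the glue period contributes a factor \<open>beta\<close>, so that summing over \<open>m\<close> gives
  an exponential.
\<close>
lemma integral_sticking_weight:
  assumes D: "D \<subseteq> old"
  defines "C \<equiv> (\<Prod>j\<in>types - {\<iota>}. z j ^ card (orbit a J j)) * stage_factor k z"
  shows "(\<integral>w. of_bool (sticking a r J k w = D) * next_weight z a r J k D (new_arrivals_before a \<iota> G w) w \<partial>Om)
    = of_real (1 - p) ^ card D * of_real p ^ card (old - D) * (z \<iota> ^ card (old - D) * beta P \<iota> z ^ card D) * C"
proof -
  have i: "\<iota> \<in> types" by (rule queue_types)
  have finD: "finite D" using D finite_orbit finite_subset by blast
  have nbm[measurable]: "(\<lambda>w. new_arrivals_before a \<iota> G w) \<in> measurable Om (count_space UNIV)"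
    using i by (intro measurable_new_arrivals) auto
  note [measurable] = measurable_next_weight_random measurable_sticking measurable_next_weight
  define E where "E = exp (- of_real G * (\<Sum>j\<in>types - {\<iota>}. of_real (arr_rate P j) * (1 - z j)))"
  define \<pi> where "\<pi> m = exp (- (arr_rate P \<iota> * G)) * (arr_rate P \<iota> * G) ^ m / fact m" for m
  define c where "c = complex_of_real ((1 - p) ^ card D * p ^ card (old - D)) *
     (z \<iota> ^ card (old - D) * (\<Prod>j\<in>types - {\<iota>}. z j ^ card (orbit a J j)) * E * (beta P \<iota> z ^ card D * sigma P \<iota> z))"
  let ?f = "\<lambda>w. of_bool (sticking a r J k w = D) * next_weight z a r J k D (new_arrivals_before a \<iota> G w) w"
  have int: "integrable Om ?f"
  proof (rule src.P.integrable_const_bound[where B=1])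
    show "AE w in Om. norm (?f w) \<le> 1" using next_weight_norm by (auto simp: norm_mult)
  qed measurable
  have "(\<lambda>m. \<integral>w. of_bool (new_arrivals_before a \<iota> G w = m) * ?f w \<partial>Om) sums (\<integral>w. ?f w \<partial>Om)"
    by (rule src.P.integral_sums_nat[OF int nbm])
  also have "(\<lambda>m. \<integral>w. of_bool (new_arrivals_before a \<iota> G w = m) * ?f w \<partial>Om) = (\<lambda>m. c * (of_real (\<pi> m) * beta P \<iota> z ^ m))"
  proof
    fix m
    let ?g = "\<lambda>w. of_bool (new_arrivals_before a \<iota> G w = m) * next_weight z a r J k D m w"
    have "(\<integral>w. of_bool (new_arrivals_before a \<iota> G w = m) * ?f w \<partial>Om) = (\<integral>w. of_bool (sticking a r J k w = D) * ?g w \<partial>Om)"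
      by (intro Bochner_Integration.integral_cong) auto
    also have "\<dots> = (\<integral>w. of_bool (sticking a r J k w = D) \<partial>Om) * (\<integral>w. ?g w \<partial>Om)"
    proof (rule src.integral_indep)
      show "integrable Om (\<lambda>w. of_bool (sticking a r J k w = D) * ?g w)"
      proof (rule src.P.integrable_const_bound[where B=1])
        show "AE w in Om. norm (of_bool (sticking a r J k w = D) * ?g w) \<le> 1"
          using next_weight_norm by (auto simp: norm_mult)
      qed measurable
      let ?R = "\<Union>j c. range (Retr j c)"
      show "depends_on ?R (\<lambda>w. of_bool (sticking a r J k w = D) :: complex)"
      proof (rule depends_onI)
        fix w w' :: "source \<Rightarrow> real" assume "\<And>s. s \<in> ?R \<Longrightarrow> w s = w' s"
        then have "w (Retr j c q) = w' (Retr j c q)" for j c q by blast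
        then show "(of_bool (sticking a r J k w = D) :: complex) = of_bool (sticking a r J k w' = D)"
          by (simp add: sticking_def)
      qed
      show "depends_on (- ?R) ?g"
      proof (rule depends_onI)
        fix w w' :: "source \<Rightarrow> real" assume *: "\<And>s. s \<in> - ?R \<Longrightarrow> w s = w' s"
        have "w (Arr j n) = w' (Arr j n)" "w (Serv j c) = w' (Serv j c)" "w (Switch l) = w' (Switch l)" for j n c l
          using * by auto
        then have e: "new_arrivals a j \<tau> w = new_arrivals a j \<tau> w'"
          "new_arrivals_before a j \<tau> w = new_arrivals_before a j \<tau> w'" "busy k D' w = busy k D' w'" for j \<tau> D'
          by (simp_all add: busy_def new_arrivals_def new_arrivals_before_def)
        show "?g w = ?g w'" unfolding next_weight_def next_num_def e ..
      qed
    qed auto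
    also have "(\<integral>w. of_bool (sticking a r J k w = D) \<partial>Om) = complex_of_real ((1 - p) ^ card D * p ^ card (old - D))"
      by (rule prob_sticking[OF D])
    also have "(\<integral>w. ?g w \<partial>Om) = z \<iota> ^ card (old - D) * (\<Prod>j\<in>types - {\<iota>}. z j ^ card (orbit a J j)) * E * of_real (\<pi> m)
      * (beta P \<iota> z ^ card (joined a k D m) * sigma P \<iota> z)"
      unfolding next_weight_integral_joined[OF finD] E_def \<pi>_def by simp
    also have "card (joined a k D m) = card D + m"
      unfolding joined_def using D finD by (subst card_Un_disjoint) (auto simp: orbit_def)
    finally show "(\<integral>w. of_bool (new_arrivals_before a \<iota> G w = m) * ?f w \<partial>Om) = c * (of_real (\<pi> m) * beta P \<iota> z ^ m)"
      unfolding c_def power_add by (simp only: mult_ac)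
  qed
  finally have s1: "(\<lambda>m. c * (of_real (\<pi> m) * beta P \<iota> z ^ m)) sums (\<integral>w. ?f w \<partial>Om)" .
  have s2: "(\<lambda>m. c * (of_real (\<pi> m) * beta P \<iota> z ^ m)) sums (c * exp (- of_real (arr_rate P \<iota> * G) * (1 - beta P \<iota> z)))"
    unfolding \<pi>_def by (intro sums_mult poisson_pgf)
  have "(\<integral>w. ?f w \<partial>Om) = c * exp (- of_real (arr_rate P \<iota> * G) * (1 - beta P \<iota> z))"
    using s1 s2 by (rule sums_unique2)
  also have "\<dots> = of_real (1 - p) ^ card D * of_real p ^ card (old - D) * (z \<iota> ^ card (old - D) * beta P \<iota> z ^ card D) *
     ((\<Prod>j\<in>types - {\<iota>}. z j ^ card (orbit a J j)) * (sigma P \<iota> z * (E * exp (- of_real (arr_rate P \<iota> * G) * (1 - beta P \<iota> z)))))"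
    unfolding c_def of_real_mult of_real_power by (simp only: mult_ac)
  also have "E * exp (- of_real (arr_rate P \<iota> * G) * (1 - beta P \<iota> z)) = exp (- of_real G *
     ((\<Sum>j\<in>types - {\<iota>}. of_real (arr_rate P j) * (1 - z j)) + of_real (arr_rate P \<iota>) * (1 - beta P \<iota> z)))"
    unfolding E_def exp_add[symmetric] by (simp add: algebra_simps)
  finally show ?thesis unfolding C_def stage_factor_def by simp
qed

text \<open>
  An old customer of the served type contributes \<open>beta\<close> if it sticks and \<open>z\<^sub>i\<close> otherwise. By the
  binomial theorem over the sets of sticking customers, these choices add up to a power of \<open>f\<^sub>i(z)\<close>.
\<close>
lemma integral_resolved_weight:
  "(\<integral>w. resolved_weight z a r J k w \<partial>Om) = stage_factor k z * (\<Prod>j\<in>types. (z(\<iota> := f_fun P \<iota> z)) j ^ card (orbit a J j))"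
proof -
  have i: "\<iota> \<in> types" by (rule queue_types)
  note [measurable] = measurable_next_weight_random measurable_sticking
  let ?f = "\<lambda>D w. of_bool (sticking a r J k w = D) * next_weight z a r J k D (new_arrivals_before a \<iota> G w) w"
  let ?C = "(\<Prod>j\<in>types - {\<iota>}. z j ^ card (orbit a J j)) * stage_factor k z"
  have int: "integrable Om (?f D)" for D
  proof (rule src.P.integrable_const_bound[where B=1])
    show "AE w in Om. norm (?f D w) \<le> 1" using next_weight_norm by (auto simp: norm_mult)
  qed measurable
  have "(\<integral>w. resolved_weight z a r J k w \<partial>Om) = (\<Sum>D\<in>Pow old. \<integral>w. ?f D w \<partial>Om)"
    unfolding resolved_weight_split using int by (rule Bochner_Integration.integral_sum)
  also have "\<dots> = (\<Sum>D\<in>Pow old. of_real (1 - p) ^ card D * of_real p ^ card (old - D) *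
      (z \<iota> ^ card (old - D) * beta P \<iota> z ^ card D) * ?C)"
    by (intro sum.cong refl integral_sticking_weight) auto
  also have "\<dots> = (of_real (1 - p) * beta P \<iota> z + of_real p * z \<iota>) ^ card old * ?C"
    unfolding sum_distrib_right[symmetric] sum_Pow_binomial[OF finite_orbit] ..
  also have "of_real (1 - p) * beta P \<iota> z + of_real p * z \<iota> = f_fun P \<iota> z"
    by (simp add: f_fun_def)
  also have "(f_fun P \<iota> z) ^ card old * ?C = stage_factor k z * (\<Prod>j\<in>types. (z(\<iota> := f_fun P \<iota> z)) j ^ card (orbit a J j))"
    using i by (subst (2) prod.remove[of _ \<iota>]) (auto intro!: prod.cong)
  finally show ?thesis .
qed

end

end

section \<open>The recursion over stages and cycles\<close>

context polling_system
begin

lemma norm_lst_le_1: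
  assumes D: "nonneg_dist D" and s: "0 \<le> Re s"
  shows "norm (lst D s) \<le> 1"
proof -
  have p: "prob_space D" and ae: "AE x in D. 0 \<le> x" using D by (auto simp: nonneg_dist_def)
  have "norm (lst D s) \<le> (\<integral>x. norm (exp (- s * of_real x)) \<partial>D)"
    unfolding lst_def by (rule integral_norm_bound)
  also have "\<dots> \<le> (\<integral>x. 1 \<partial>D)"
  proof (rule integral_mono_AE)
    show "integrable D (\<lambda>x. norm (exp (- s * of_real x)))" using integrable_lst[OF D s] by (rule integrable_norm)
    show "integrable D (\<lambda>x. 1 :: real)" using p by (simp add: prob_space.finite_measure finite_measure.integrable_const)
    show "AE x in D. norm (exp (- s * of_real x)) \<le> 1"
      using ae by eventually_elim (use s in \<open>simp add: norm_exp_eq_Re\<close>)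
  qed
  also have "\<dots> = 1" using p by (simp add: prob_space.prob_space)
  finally show ?thesis .
qed

lemma norm_f_fun_le_1:
  assumes i: "i \<in> types" and z: "\<And>j. j \<in> types \<Longrightarrow> norm (z j) \<le> 1"
  shows "norm (f_fun P i z) \<le> 1"
proof -
  let ?p = "exp (- retr_rate P i * glue P i)"
  have "0 \<le> retr_rate P i * glue P i" using i rates_pos glue_pos by (simp add: less_imp_le)
  then have p: "?p \<le> 1" by simp
  have b: "norm (beta P i z) \<le> 1"
    unfolding beta_def arrival_exponent_def[symmetric]
    by (rule norm_lst_le_1[OF dists(1)[OF i] Re_arrival_exponent[OF z]])
  have "norm (f_fun P i z) \<le> norm (complex_of_real (1 - ?p) * beta P i z) + norm (complex_of_real ?p * z i)"
    unfolding f_fun_def by (rule norm_triangle_ineq)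
  also have "\<dots> = (1 - ?p) * norm (beta P i z) + ?p * norm (z i)"
    using p unfolding norm_mult norm_of_real by simp
  also have "\<dots> \<le> (1 - ?p) * 1 + ?p * 1"
    using p b z[OF i] by (intro add_mono mult_left_mono) auto
  finally show ?thesis by simp
qed

lemma depends_on_past_cond: "depends_on (used P a r J k) (past_cond a r J k)"
proof (rule depends_onI)
  fix w w' :: "source \<Rightarrow> real" assume "\<And>s. s \<in> used P a r J k \<Longrightarrow> w s = w' s"
  then have eq: "\<forall>s\<in>used P a r J k. w s = w' s" by blast
  have t: "stage_time P J k w = stage_time P J k w'" by (rule stage_time_used[OF eq])
  have "stopped a r J k w = stopped a r J k w'" using eq t by (auto simp: stopped_def)
  then show "past_cond a r J k w = past_cond a r J k w'"
    unfolding past_cond_def t using start_used[OF eq] by auto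
qed

lemma measurable_past_cond:
  assumes "snapshot P x0 a r J" shows "Measurable.pred Om (past_cond a r J k)"
proof -
  have Jt: "\<And>j c. (j, c) \<in> J \<Longrightarrow> j \<in> types" using assms unfolding snapshot_def by blast
  have t[measurable]: "(\<lambda>w. stage_time P J k w) \<in> borel_measurable Om"
    using Jt by (intro measurable_stage_time measurable_source)
  have fr: "(\<lambda>w. stopped a r J k w s) \<in> borel_measurable Om" if "s \<in> sources P" for s
    unfolding stopped_def using t measurable_source[OF that] by (cases "s \<in> used P a r J k") auto
  have [measurable]: "Measurable.pred Om (\<lambda>w. (j, c) \<in> snd (stage P x0 (stopped a r J k w) k))" for j c
    by (rule measurable_stage(2)[where v="stopped a r J k", OF fr])
  have "Measurable.pred Om (\<lambda>w. \<forall>v\<in>running P x0 a r. start x0 v w = 0 \<or> start x0 v w < stage_time P J k w)"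
  proof (rule pred_intros_finite(3)[OF finite_running])
    fix v assume "v \<in> running P x0 a r"
    then have "v \<in> sources P" by (rule subsetD[OF running_sources])
    then have [measurable]: "(\<lambda>w. start x0 v w) \<in> borel_measurable Om"
      by (intro measurable_start measurable_source)
    show "Measurable.pred Om (\<lambda>w. start x0 v w = 0 \<or> start x0 v w < stage_time P J k w)" by measurable
  qed
  moreover have "snd (stage P x0 (stopped a r J k w) k) = J \<longleftrightarrow>
      (\<forall>j c. (j, c) \<in> snd (stage P x0 (stopped a r J k w) k) \<longleftrightarrow> (j, c) \<in> J)" for w
    by auto
  ultimately show ?thesis unfolding past_cond_def[abs_def] by simp
qed

lemma depends_on_resolved_weight:
  assumes "snapshot P x0 a r J"
  shows "depends_on (- used P a r J k) (resolved_weight z a r J k)"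
proof (rule depends_onI)
  fix w w' :: "source \<Rightarrow> real" assume *: "\<And>s. s \<in> - used P a r J k \<Longrightarrow> w s = w' s"
  have arr: "w (Arr j (a j + l)) = w' (Arr j (a j + l))" for j l by (rule *) simp
  have st: "sticking a r J k w = sticking a r J k w'"
    using * by (auto simp: sticking_def)
  have n: "new_arrivals a j \<tau> w = new_arrivals a j \<tau> w'" "new_arrivals_before a j \<tau> w = new_arrivals_before a j \<tau> w'" for j \<tau>
    by (simp_all add: new_arrivals_def new_arrivals_before_def arr)
  have b: "busy k (joined a k (sticking a r J k w') m) w = busy k (joined a k (sticking a r J k w') m) w'" for m
  proof -
    have "(queue P k, c) \<notin> J" if "c \<in> joined a k (sticking a r J k w') m" for c
      using that assms unfolding joined_def sticking_def orbit_def snapshot_def by fastforce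
    then show ?thesis unfolding busy_def using * by (intro arg_cong2[where f="(+)"] sum.cong) auto
  qed
  show "resolved_weight z a r J k w = resolved_weight z a r J k w'"
    unfolding resolved_weight_def next_weight_def next_num_def st n b ..
qed

lemma running_law:
  assumes "v \<in> running P x0 a r"
  defines "\<rho> \<equiv> case v of Arr j n \<Rightarrow> arr_rate P j | Retr j c q \<Rightarrow> retr_rate P j | _ \<Rightarrow> 1"
  shows "0 < \<rho>" "law v = density lborel (exponential_density \<rho>)"
  using assms rates_pos by (cases v; simp add: law_simps)+

definition num_gf :: "nat \<Rightarrow> (nat \<Rightarrow> complex) \<Rightarrow> complex" where
  "num_gf k z = (\<integral>w. (\<Prod>j\<in>types. z j ^ num_at P x0 w k j) \<partial>Om)"

lemma integrable_num_weight:
  assumes z: "\<And>j. j \<in> types \<Longrightarrow> norm (z j) \<le> 1"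
  shows "integrable Om (\<lambda>w. \<Prod>j\<in>types. (z j :: complex) ^ num_at P x0 w k j)"
proof (rule src.P.integrable_const_bound[where B=1])
  show "AE w in Om. norm (\<Prod>j\<in>types. z j ^ num_at P x0 w k j) \<le> 1"
    unfolding prod_norm[symmetric] norm_power
    using z by (intro AE_I2 prod_le_1) (auto intro: power_le_one)
  show "(\<lambda>w. \<Prod>j\<in>types. z j ^ num_at P x0 w k j) \<in> borel_measurable Om"
    by (intro borel_measurable_prod measurable_pow_nat measurable_num_at measurable_source)
qed

text \<open>
  On the event that the past is \<open>A\<close>, the orbits are fixed and the numbers one stage later are a
  function of the residual path, so \<open>memoryless\<close> separates the probability of the event from the
  expectation over one stage.
\<close>
lemma snapshot_recursion:
  fixes k :: nat
  assumes z: "\<And>j. j \<in> types \<Longrightarrow> norm (z j) \<le> 1" and snap: "snapshot P x0 a r J"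
  defines "A \<equiv> used P a r J k" and "z' \<equiv> z(queue P k := f_fun P (queue P k) z)"
  shows "(\<integral>w. of_bool (past P x0 w k = A) * (\<Prod>j\<in>types. z j ^ num_at P x0 w (Suc k) j) \<partial>Om)
    = (\<integral>w. of_bool (past P x0 w k = A) * (stage_factor k z * (\<Prod>j\<in>types. z' j ^ num_at P x0 w k j)) \<partial>Om)"
proof -
  let ?V = "running P x0 a r"
  define g where "g v w = stage_time P J k w - start x0 v w" for v w
  define Q where "Q w = (of_bool (past_cond a r J k w) :: complex)" for w
  let ?F = "resolved_weight z a r J k"
  have Jt: "\<And>j c. (j, c) \<in> J \<Longrightarrow> j \<in> types" using snap unfolding snapshot_def by blast
  have gm: "g v \<in> borel_measurable Om" if "v \<in> ?V" for v
    unfolding g_def using Jt subsetD[OF running_sources that]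
    by (intro borel_measurable_diff measurable_stage_time measurable_start measurable_source) auto
  have pm[measurable]: "Measurable.pred Om (\<lambda>w. past P x0 w k = A)"
    using measurable_past_eq[of k A] by (simp add: pred_def)
  have Qm[measurable]: "Q \<in> borel_measurable Om"
    unfolding Q_def using measurable_past_cond[OF snap, of k] by measurable
  have Fm[measurable]: "?F \<in> borel_measurable Om" by (rule measurable_resolved_weight[OF z])
  have asm[measurable]: "age_shift ?V g \<in> measurable Om Om"
    by (rule src.measurable_age_shift[OF gm running_sources])
  have cm[measurable]: "Measurable.pred Om (\<lambda>w. \<forall>v\<in>?V. g v w < w v)"
  proof (rule pred_intros_finite(3)[OF finite_running])
    fix v assume v: "v \<in> ?V"
    note [measurable] = gm[OF v] measurable_source[OF subsetD[OF running_sources v]]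
    show "Measurable.pred Om (\<lambda>w. g v w < w v)" by measurable
  qed
  have nm: "(\<lambda>w. \<Prod>j\<in>types. y j ^ num_at P x0 w l j) \<in> borel_measurable Om" for y :: "nat \<Rightarrow> complex" and l
    by (intro borel_measurable_prod measurable_pow_nat measurable_num_at measurable_source)
  note nm[measurable]
  have ae: "AE w in Om. regular P w \<and> (past P x0 w k = A \<longleftrightarrow> in_progress a r J k w) \<and>
      (in_progress a r J k w \<longleftrightarrow> past_cond a r J k w \<and> (\<forall>v\<in>?V. g v w < w v))"
    using AE_regular AE_untied[of k]
    by eventually_elim (simp add: past_eq_used_iff snap in_progress_iff A_def g_def)
  have "(\<integral>w. of_bool (past P x0 w k = A) * (\<Prod>j\<in>types. z j ^ num_at P x0 w (Suc k) j) \<partial>Om)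
    = (\<integral>w. (if \<forall>v\<in>?V. g v w < w v then Q w * ?F (age_shift ?V g w) else 0) \<partial>Om)"
  proof (rule integral_cong_AE)
    show "AE w in Om. of_bool (past P x0 w k = A) * (\<Prod>j\<in>types. z j ^ num_at P x0 w (Suc k) j)
       = (if \<forall>v\<in>?V. g v w < w v then Q w * ?F (age_shift ?V g w) else 0)"
      using ae
    proof eventually_elim
      case (elim w)
      show ?case
      proof (cases "in_progress a r J k w")
        case True
        have "age_shift ?V g w = residual a r J k w" unfolding residual_def g_def ..
        then have "?F (age_shift ?V g w) = (\<Prod>j\<in>types. z j ^ num_at P x0 w (Suc k) j)"
          using one_step[OF _ snap True] elim
          unfolding resolved_weight_def next_weight_def by (intro prod.cong) auto
        then show ?thesis using True elim by (simp add: Q_def)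
      next
        case False
        then show ?thesis using elim by (auto simp: Q_def)
      qed
    qed
  qed measurable
  also have "\<dots> = (\<integral>w. (if \<forall>v\<in>?V. g v w < w v then Q w else 0) \<partial>Om) * (\<integral>w. ?F w \<partial>Om)"
  proof (rule src.memoryless[where A=A and BQ=1 and BF=1])
    show "finite ?V" "?V \<subseteq> sources P" by (rule finite_running, rule running_sources)
    show "?V \<inter> A = {}" unfolding A_def by (rule running_used_disjoint)
    show "depends_on A Q"
    proof (rule depends_onI)
      fix w w' :: "source \<Rightarrow> real" assume "\<And>s. s \<in> A \<Longrightarrow> w s = w' s"
      then have "past_cond a r J k w = past_cond a r J k w'"
        unfolding A_def by (rule depends_onD[OF depends_on_past_cond])
      then show "Q w = Q w'" by (simp add: Q_def)
    qed
    show "depends_on A (g v)" if "v \<in> ?V" for v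
    proof (rule depends_onI)
      fix w w' :: "source \<Rightarrow> real" assume "\<And>s. s \<in> A \<Longrightarrow> w s = w' s"
      then have eq: "\<forall>s\<in>used P a r J k. w s = w' s" unfolding A_def by blast
      show "g v w = g v w'" unfolding g_def stage_time_used[OF eq] start_used[OF eq that] ..
    qed
    show "0 \<le> g v w" if "v \<in> ?V" "Q w \<noteq> 0" for v w
    proof -
      have "past_cond a r J k w" using that(2) by (simp add: Q_def split: if_splits)
      then have "0 \<le> stage_time P J k w" "start x0 v w = 0 \<or> start x0 v w < stage_time P J k w"
        using that(1) unfolding past_cond_def by blast+
      then show ?thesis unfolding g_def by auto
    qed
    show "norm (?F w) \<le> 1" for w by (rule resolved_weight_norm[OF z])
    show "depends_on (- A) ?F" unfolding A_def by (rule depends_on_resolved_weight[OF snap])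
    show "norm (Q w) \<le> 1" for w by (simp add: Q_def)
  qed (use gm running_law in auto)
  also have "(\<integral>w. ?F w \<partial>Om) = stage_factor k z * (\<Prod>j\<in>types. z' j ^ card (orbit a J j))"
    unfolding z'_def by (rule integral_resolved_weight[OF z])
  also have "(\<integral>w. (if \<forall>v\<in>?V. g v w < w v then Q w else 0) \<partial>Om) * (stage_factor k z * (\<Prod>j\<in>types. z' j ^ card (orbit a J j)))
    = (\<integral>w. (if \<forall>v\<in>?V. g v w < w v then Q w else 0) * (stage_factor k z * (\<Prod>j\<in>types. z' j ^ card (orbit a J j))) \<partial>Om)"
    by (rule integral_mult_left_zero[symmetric])
  also have "\<dots> = (\<integral>w. of_bool (past P x0 w k = A) * (stage_factor k z * (\<Prod>j\<in>types. z' j ^ num_at P x0 w k j)) \<partial>Om)"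
  proof (rule integral_cong_AE)
    show "AE w in Om. (if \<forall>v\<in>?V. g v w < w v then Q w else 0) * (stage_factor k z * (\<Prod>j\<in>types. z' j ^ card (orbit a J j)))
      = of_bool (past P x0 w k = A) * (stage_factor k z * (\<Prod>j\<in>types. z' j ^ num_at P x0 w k j))"
      using ae
    proof eventually_elim
      case (elim w)
      show ?case
      proof (cases "in_progress a r J k w")
        case True
        have "num_at P x0 w k j = card (orbit a J j)" if "j \<in> types" for j
          using num_at_in_progress[OF _ True that] elim by blast
        then have "(\<Prod>j\<in>types. z' j ^ num_at P x0 w k j) = (\<Prod>j\<in>types. z' j ^ card (orbit a J j))"
          by (intro prod.cong) auto
        then show ?thesis using True elim by (simp add: Q_def)
      next
        case False
        then show ?thesis using elim by (auto simp: Q_def)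
      qed
    qed
  qed measurable
  finally show ?thesis .
qed

text \<open>
  The values of \<open>past\<close> partition almost all paths into countably many events, and
  \<open>snapshot_recursion\<close> settles each of them.
\<close>
lemma stage_recursion:
  assumes z: "\<And>j. j \<in> types \<Longrightarrow> norm (z j) \<le> 1"
  shows "num_gf (Suc k) z = stage_factor k z * num_gf k (z(queue P k := f_fun P (queue P k) z))"
proof -
  let ?z = "z(queue P k := f_fun P (queue P k) z)"
  let ?Z = "{I. finite I \<and> I \<subseteq> sources P}"
  have z': "norm (?z j) \<le> 1" if "j \<in> types" for j
    using norm_f_fun_le_1[OF queue_types[of k] z] z[OF that] by simp
  have aeu: "AE w in Om. \<exists>a r J. snapshot P x0 a r J \<and> past P x0 w k = used P a r J k"
    using AE_regular AE_in_progress_exists[of k] by eventually_elim (metis in_progress_past)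
  have "num_gf (Suc k) z = (\<integral>w. stage_factor k z * (\<Prod>j\<in>types. ?z j ^ num_at P x0 w k j) \<partial>Om)"
    unfolding num_gf_def
  proof (rule src.P.integral_eq_by_partition[where Y="\<lambda>w. past P x0 w k" and Z="?Z"])
    show "integrable Om (\<lambda>w. \<Prod>j\<in>types. z j ^ num_at P x0 w (Suc k) j)"
      by (rule integrable_num_weight[OF z])
    show "integrable Om (\<lambda>w. stage_factor k z * (\<Prod>j\<in>types. ?z j ^ num_at P x0 w k j))"
      by (intro integrable_mult_right integrable_num_weight z')
    show "countable ?Z" by (rule countable_Collect_finite_subset[OF countable_sources])
    show "{w \<in> space Om. past P x0 w k = I} \<in> sets Om" for I by (rule measurable_past_eq)
    show "AE w in Om. past P x0 w k \<in> ?Z"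
      using aeu by eventually_elim (use past_sources finite_used in fastforce)
    fix I
    let ?f = "\<lambda>w. of_bool (past P x0 w k = I) * (\<Prod>j\<in>types. z j ^ num_at P x0 w (Suc k) j)"
    let ?g = "\<lambda>w. of_bool (past P x0 w k = I) * (stage_factor k z * (\<Prod>j\<in>types. ?z j ^ num_at P x0 w k j))"
    show "(\<integral>w. ?f w \<partial>Om) = (\<integral>w. ?g w \<partial>Om)"
    proof (cases "\<exists>a r J. snapshot P x0 a r J \<and> used P a r J k = I")
      case True
      then obtain a r J where s: "snapshot P x0 a r J" and I: "used P a r J k = I" by blast
      show ?thesis using snapshot_recursion[where k=k, OF z s] unfolding I .
    next
      case False
      have "AE w in Om. past P x0 w k \<noteq> I" using aeu by eventually_elim (use False in blast)
      then have "AE w in Om. ?f w = 0" "AE w in Om. ?g w = 0" by (auto elim: eventually_mono)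
      then show ?thesis by (simp only: integral_eq_zero_AE)
    qed
  qed
  then show ?thesis unfolding num_gf_def by simp
qed

lemma num_gf_0:
  "num_gf 0 z = (\<Prod>j\<in>types. z j ^ x0 j)"
proof -
  have "num_gf 0 z = (\<integral>w. (\<Prod>j\<in>types. z j ^ x0 j) \<partial>Om)"
    unfolding num_gf_def
  proof (rule integral_cong_AE)
    show "AE w in Om. (\<Prod>j\<in>types. z j ^ num_at P x0 w 0 j) = (\<Prod>j\<in>types. z j ^ x0 j)"
      using AE_regular
    proof eventually_elim
      case (elim w)
      have "num_at P x0 w 0 j = x0 j" if j: "j \<in> types" for j
      proof -
        have "entry x0 w j c \<le> 0 \<longleftrightarrow> c < x0 j" for c
        proof (cases "c < x0 j")
          case False
          have "0 < w (Arr j 0)" by (rule regular_Arr[OF elim j])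
          also have "\<dots> = entry x0 w j (x0 j)" using entry_arr[of x0 w j 0] by simp
          also have "\<dots> \<le> entry x0 w j c" using False by (intro entry_mono[OF regular_nonneg[OF elim] j]) simp
          finally show ?thesis using False by simp
        qed (simp add: entry_old)
        then show ?thesis by (simp add: num_at_def)
      qed
      then show ?case by simp
    qed
  qed (auto intro!: borel_measurable_prod measurable_pow_nat measurable_num_at measurable_source)
  then show ?thesis by (simp add: src.P.prob_space)
qed

lemma num_gf_cong: "(\<And>j. j \<in> types \<Longrightarrow> z j = z' j) \<Longrightarrow> num_gf k z = num_gf k z'"
proof -
  assume "\<And>j. j \<in> types \<Longrightarrow> z j = z' j"
  then have "(\<Prod>j\<in>types. z j ^ num_at P x0 w k j) = (\<Prod>j\<in>types. z' j ^ num_at P x0 w k j)" for w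
    by (intro prod.cong) auto
  then show ?thesis unfolding num_gf_def by (simp only:)
qed

lemma h_fun_hvec: "h_fun P i z = f_fun P i (hvec P i z)"
  by (subst h_fun.simps) (simp add: hvec_def)

lemma norm_h_fun_le_1:
  assumes z: "\<And>j. j \<in> types \<Longrightarrow> norm (z j) \<le> 1"
  shows "i \<in> types \<Longrightarrow> norm (h_fun P i z) \<le> 1"
proof (induction "nq P - i" arbitrary: i rule: less_induct)
  case less
  have "norm (hvec P i z j) \<le> 1" if "j \<in> types" for j
    unfolding hvec_def using less that z by auto
  then show ?case unfolding h_fun_hvec using less.prems by (intro norm_f_fun_le_1) auto
qed

lemma norm_hvec_le_1:
  assumes "\<And>j. j \<in> types \<Longrightarrow> norm (z j) \<le> 1" "j \<in> types"
  shows "norm (hvec P i z j) \<le> 1"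
  unfolding hvec_def using norm_h_fun_le_1[OF assms(1)] assms by auto

text \<open>
  The substitution made by the stage of \<open>Q\<^sub>i\<^sub>+\<^sub>1\<close> leads from one of the vectors \<open>hvec\<close> to the previous one.
\<close>
lemma hvec_step: "i < nq P \<Longrightarrow> (hvec P (Suc i) z)(Suc i := f_fun P (Suc i) (hvec P (Suc i) z)) = hvec P i z"
  unfolding h_fun_hvec[symmetric] by (auto simp: hvec_def fun_eq_iff)

lemma stage_factor_hvec:
  assumes i: "queue P k = i"
  shows "stage_factor k (hvec P i z) = sigma P i (hvec P i z) * exp (- of_real (glue P i) * D_fun P i z)"
proof -
  have it: "i \<in> types" using queue_types[of k] i by simp
  have e: "types - {i} = {1..<i} \<union> {i<..nq P}" using it by auto
  have "(\<Sum>j\<in>types - {i}. of_real (arr_rate P j) * (1 - hvec P i z j))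
    = (\<Sum>j\<in>{1..<i}. of_real (arr_rate P j) * (1 - hvec P i z j)) + (\<Sum>j\<in>{i<..nq P}. of_real (arr_rate P j) * (1 - hvec P i z j))"
    unfolding e by (rule sum.union_disjoint) auto
  also have "\<dots> = (\<Sum>j\<in>{1..<i}. of_real (arr_rate P j) * (1 - z j)) + (\<Sum>j\<in>{i<..nq P}. of_real (arr_rate P j) * (1 - h_fun P j z))"
    by (intro arg_cong2[where f="(+)"] sum.cong) (auto simp: hvec_def)
  finally show ?thesis unfolding stage_factor_def i D_fun_def by (simp add: algebra_simps)
qed

text \<open>
  Start with \<open>hvec P (nq P) z\<close>, which agrees with \<open>z\<close>, and go backwards through the stages of the
  cycle until \<open>hvec P 0 z\<close>, which agrees with \<open>h(z)\<close>.
\<close>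
lemma cycle_recursion:
  assumes z: "\<And>j. j \<in> types \<Longrightarrow> norm (z j) \<le> 1"
  shows "num_gf (Suc n * nq P) z = K_fun P z * num_gf (n * nq P) (\<lambda>j. h_fun P j z)"
proof -
  let ?F = "\<lambda>i. sigma P i (hvec P i z) * exp (- of_real (glue P i) * D_fun P i z)"
  have "num_gf (n * nq P + nq P) z = (\<Prod>j\<in>{i<..nq P}. ?F j) * num_gf (n * nq P + i) (hvec P i z)" if "i \<le> nq P" for i
    using that
  proof (induction rule: inc_induct)
    case base
    have "num_gf (n * nq P + nq P) z = num_gf (n * nq P + nq P) (hvec P (nq P) z)"
      by (rule num_gf_cong) (simp add: hvec_def)
    then show ?case by simp
  next
    case (step i)
    have q: "queue P (n * nq P + i) = Suc i" using step.hyps by (simp add: queue_def)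
    have "num_gf (n * nq P + Suc i) (hvec P (Suc i) z) = ?F (Suc i) * num_gf (n * nq P + i) (hvec P i z)"
      using stage_recursion[of "hvec P (Suc i) z" "n * nq P + i"] norm_hvec_le_1[OF z]
      unfolding q hvec_step[OF step.hyps(2)] stage_factor_hvec[OF q] by simp
    moreover have "{i<..nq P} = insert (Suc i) {Suc i<..nq P}" using step.hyps by auto
    ultimately show ?case using step.IH by simp
  qed
  from this[of 0] have "num_gf (n * nq P + nq P) z = (\<Prod>j\<in>{0<..nq P}. ?F j) * num_gf (n * nq P) (hvec P 0 z)" by simp
  also have "num_gf (n * nq P) (hvec P 0 z) = num_gf (n * nq P) (\<lambda>j. h_fun P j z)"
    by (rule num_gf_cong) (simp add: hvec_def)
  also have "(\<Prod>j\<in>{0<..nq P}. ?F j) = K_fun P z"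
  proof -
    have "{0<..nq P} = {1..nq P}" by auto
    then show ?thesis unfolding K_fun_def by (simp add: prod.distrib)
  qed
  finally show ?thesis by (simp add: add.commute)
qed

lemma norm_hiter_le_1:
  assumes z: "\<And>j. j \<in> types \<Longrightarrow> norm (z j) \<le> 1"
  shows "j \<in> types \<Longrightarrow> norm (hiter P n z j) \<le> 1"
  by (induction n arbitrary: j) (auto intro!: norm_h_fun_le_1 simp: z)

lemma num_gf_product:
  assumes z: "\<And>j. j \<in> types \<Longrightarrow> norm (z j) \<le> 1"
  shows "num_gf (n * nq P) z = (\<Prod>m<n. K_fun P (hiter P m z)) * (\<Prod>j\<in>types. hiter P n z j ^ x0 j)"
proof -
  have "num_gf (n * nq P) z = (\<Prod>m<l. K_fun P (hiter P m z)) * num_gf ((n - l) * nq P) (hiter P l z)" if "l \<le> n" for l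
    using that
  proof (induction l)
    case (Suc l)
    then have "n - l = Suc (n - Suc l)" by simp
    then have "num_gf ((n - l) * nq P) (hiter P l z) = K_fun P (hiter P l z) * num_gf ((n - Suc l) * nq P) (hiter P (Suc l) z)"
      using cycle_recursion[of "hiter P l z" "n - Suc l"] norm_hiter_le_1[OF z] by simp
    then show ?case using Suc by simp
  qed simp
  from this[of n] show ?thesis by (simp add: num_gf_0)
qed

end

section \<open>Contraction and convergence of the product\<close>

lemma norm_one_minus_exp_le:
  fixes s :: complex
  assumes "0 \<le> Re s"
  shows "norm (1 - exp (- s)) \<le> norm s"
proof -
  have "norm (exp 0 - exp (- s)) \<le> 1 * norm (0 - (- s))"
  proof (rule field_differentiable_bound[where S="{w. Re w \<le> 0}" and f'=exp])
    show "convex {w. Re w \<le> 0}" by (rule convex_halfspace_Re_le)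
    show "norm (exp w) \<le> 1" if "w \<in> {w. Re w \<le> 0}" for w using that by (simp add: norm_exp_eq_Re)
  qed (use assms in \<open>auto intro: DERIV_exp has_field_derivative_at_within\<close>)
  then show ?thesis by simp
qed

lemma norm_one_minus_mult_le:
  fixes x y :: complex
  assumes "norm x \<le> 1"
  shows "norm (1 - x * y) \<le> norm (1 - x) + norm (1 - y)"
proof -
  have "1 - x * y = (1 - x) + x * (1 - y)" by (simp add: algebra_simps)
  then have "norm (1 - x * y) \<le> norm (1 - x) + norm x * norm (1 - y)"
    by (metis norm_mult norm_triangle_ineq)
  also have "\<dots> \<le> norm (1 - x) + 1 * norm (1 - y)" using assms by (intro add_left_mono mult_right_mono) auto
  finally show ?thesis by simp
qed

text \<open>
  By Scheffe's lemma, the point probabilities converge in the \<open>l\<^sup>1\<close> norm.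
\<close>
lemma tendsto_integral_countable:
  fixes D :: "nat \<Rightarrow> 'c::countable measure" and D' :: "'c measure" and g :: "'c \<Rightarrow> complex"
  assumes D: "\<And>n. prob_space (D n)" "\<And>n. sets (D n) = UNIV" and D': "prob_space D'" "sets D' = UNIV"
    and lim: "\<And>x. (\<lambda>n. measure (D n) {x}) \<longlonglongrightarrow> measure D' {x}" and g: "\<And>x. norm (g x) \<le> B"
  shows "(\<lambda>n. \<integral>x. g x \<partial>D n) \<longlonglongrightarrow> (\<integral>x. g x \<partial>D')"
proof -
  let ?C = "count_space (UNIV :: 'c set)"
  have dens: "E = density ?C (\<lambda>x. ennreal (measure E {x}))" if E: "prob_space E" "sets E = UNIV" for E :: "'c measure"
  proof (rule measure_eqI_countable[where A=UNIV])
    interpret prob_space E by fact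
    show "emeasure E {a} = emeasure (density ?C (\<lambda>x. ennreal (measure E {x}))) {a}" for a
      by (subst emeasure_density) (simp_all add: nn_integral_indicator_singleton emeasure_eq_measure)
  qed (use E in auto)
  have one: "(\<integral>\<^sup>+x. ennreal (measure E {x}) \<partial>?C) = 1" if E: "prob_space E" "sets E = UNIV" for E :: "'c measure"
  proof -
    have "(\<integral>\<^sup>+x. ennreal (measure E {x}) \<partial>?C) = emeasure (density ?C (\<lambda>x. ennreal (measure E {x}))) UNIV"
      by (subst emeasure_density) auto
    also have "\<dots> = emeasure E UNIV" using dens[OF E] by simp
    also have "\<dots> = 1" using prob_space.emeasure_space_1[OF E(1)] E(2) sets_eq_imp_space_eq[of E ?C] by simp
    finally show ?thesis .
  qed
  have int: "integrable ?C (\<lambda>x. measure E {x})" if E: "prob_space E" "sets E = UNIV" for E :: "'c measure"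
    using one[OF E] by (simp add: integrable_iff_bounded)
  have intg: "(\<integral>x. g x \<partial>E) = (\<integral>x. of_real (measure E {x}) * g x \<partial>?C)" "integrable ?C (\<lambda>x. of_real (measure E {x}) * g x)"
    if E: "prob_space E" "sets E = UNIV" for E :: "'c measure"
  proof -
    have "(\<integral>x. g x \<partial>E) = (\<integral>x. g x \<partial>density ?C (\<lambda>x. ennreal (measure E {x})))" using dens[OF E] by simp
    also have "\<dots> = (\<integral>x. measure E {x} *\<^sub>R g x \<partial>?C)" by (rule integral_density) auto
    finally show "(\<integral>x. g x \<partial>E) = (\<integral>x. of_real (measure E {x}) * g x \<partial>?C)" by (simp add: scaleR_conv_of_real)
    show "integrable ?C (\<lambda>x. of_real (measure E {x}) * g x)"
      using g by (intro Bochner_Integration.integrable_bound[OF integrable_mult_left[OF int[OF E], of B]])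
        (auto simp: norm_mult intro!: AE_I2 order_trans[OF mult_left_mono abs_ge_self])
  qed
  have B0: "0 \<le> B" using g[of undefined] norm_ge_zero order_trans by blast
  have "(\<lambda>n. \<integral>\<^sup>+x. norm (measure (D n) {x} - measure D' {x}) \<partial>?C) \<longlonglongrightarrow> 0"
    by (rule Scheffe_lemma2) (use lim int[OF D'] one[OF D] one[OF D'] in auto)
  then have "(\<lambda>n. enn2real (\<integral>\<^sup>+x. norm (measure (D n) {x} - measure D' {x}) \<partial>?C)) \<longlonglongrightarrow> 0"
    by (intro tendsto_enn2real) (simp_all only: ennreal_0 order_refl)
  then have "(\<lambda>n. \<integral>x. norm (measure (D n) {x} - measure D' {x}) \<partial>?C) \<longlonglongrightarrow> 0"
    by (subst integral_eq_nn_integral) auto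
  then have lim0: "(\<lambda>n. (\<integral>x. norm (measure (D n) {x} - measure D' {x}) \<partial>?C) * B) \<longlonglongrightarrow> 0"
    by (auto intro: tendsto_mult_left_zero)
  have "norm ((\<integral>x. g x \<partial>D n) - (\<integral>x. g x \<partial>D')) \<le> (\<integral>x. norm (measure (D n) {x} - measure D' {x}) \<partial>?C) * B" for n
  proof -
    have "(\<integral>x. g x \<partial>D n) - (\<integral>x. g x \<partial>D') = (\<integral>x. of_real (measure (D n) {x}) * g x - of_real (measure D' {x}) * g x \<partial>?C)"
      unfolding intg(1)[OF D] intg(1)[OF D'] using intg(2)[OF D] intg(2)[OF D'] by simp
    also have "norm \<dots> \<le> (\<integral>x. norm (of_real (measure (D n) {x}) * g x - of_real (measure D' {x}) * g x) \<partial>?C)"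
      by (rule integral_norm_bound)
    also have "\<dots> \<le> (\<integral>x. norm (measure (D n) {x} - measure D' {x}) * B \<partial>?C)"
    proof (rule integral_mono)
      show "integrable ?C (\<lambda>x. norm (of_real (measure (D n) {x}) * g x - of_real (measure D' {x}) * g x))"
        using intg(2)[OF D] intg(2)[OF D'] by simp
      show "integrable ?C (\<lambda>x. norm (measure (D n) {x} - measure D' {x}) * B)"
        using int[OF D] int[OF D'] by simp
      fix x
      have "of_real (measure (D n) {x}) * g x - of_real (measure D' {x}) * g x = of_real (measure (D n) {x} - measure D' {x}) * g x"
        by (simp add: algebra_simps)
      then have "norm (of_real (measure (D n) {x}) * g x - of_real (measure D' {x}) * g x) = norm (measure (D n) {x} - measure D' {x}) * norm (g x)"
        by (simp only: norm_mult norm_of_real real_norm_def)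
      also have "\<dots> \<le> norm (measure (D n) {x} - measure D' {x}) * B" using g by (intro mult_left_mono) auto
      finally show "norm (of_real (measure (D n) {x}) * g x - of_real (measure D' {x}) * g x) \<le> norm (measure (D n) {x} - measure D' {x}) * B" .
    qed
    finally show ?thesis by simp
  qed
  then have "(\<lambda>n. (\<integral>x. g x \<partial>D n) - (\<integral>x. g x \<partial>D')) \<longlonglongrightarrow> 0"
    by (intro Lim_null_comparison[OF _ lim0] always_eventually) auto
  then show ?thesis by (simp add: LIM_zero_iff)
qed

context polling_system
begin

lemma norm_one_minus_lst_le:
  assumes D: "nonneg_dist D" and s: "0 \<le> Re s"
  shows "norm (1 - lst D s) \<le> norm s * mean D"
proof -
  have p: "prob_space D" and ae: "AE x in D. 0 \<le> x" and i: "integrable D (\<lambda>x. x)" using D by (auto simp: nonneg_dist_def)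
  have c: "integrable D (\<lambda>x. 1 :: complex)" using p by (simp add: prob_space.finite_measure finite_measure.integrable_const)
  have "1 - lst D s = (\<integral>x. 1 - exp (- s * of_real x) \<partial>D)"
    unfolding lst_def using c integrable_lst[OF D s] p by (simp add: prob_space.prob_space)
  also have "norm \<dots> \<le> (\<integral>x. norm (1 - exp (- s * of_real x)) \<partial>D)" by (rule integral_norm_bound)
  also have "\<dots> \<le> (\<integral>x. norm s * x \<partial>D)"
  proof (rule integral_mono_AE)
    show "integrable D (\<lambda>x. norm (1 - exp (- s * of_real x)))"
      using c integrable_lst[OF D s] by (intro integrable_norm Bochner_Integration.integrable_diff)
    show "integrable D (\<lambda>x. norm s * x)" using i by simp
    show "AE x in D. norm (1 - exp (- s * of_real x)) \<le> norm s * x"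
      using ae
    proof eventually_elim
      case (elim x)
      then show ?case using norm_one_minus_exp_le[of "s * of_real x"] s by (simp add: norm_mult)
    qed
  qed
  also have "\<dots> = norm s * mean D" by (simp add: mean_def)
  finally show ?thesis .
qed

text \<open>
  The mean service times are the right weights: if each customer of type \<open>j\<close> is charged at most \<open>c\<close>
  times its mean service time, then the arrivals during a service of mean \<open>b\<close> are charged at most
  \<open>c * total_load * b\<close>.
\<close>
definition near_one :: "real \<Rightarrow> (nat \<Rightarrow> complex) \<Rightarrow> bool" where
  "near_one c z \<longleftrightarrow> (\<forall>j\<in>types. norm (z j) \<le> 1 \<and> norm (1 - z j) \<le> c * mean (serv P j))"

abbreviation total_load :: real where "total_load \<equiv> (\<Sum>i=1..nq P. load P i)"

lemma mean_serv_pos: "j \<in> types \<Longrightarrow> 0 < mean (serv P j)"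
  using valid by (auto simp: valid_polling_def)

lemma total_load_nonneg: "0 \<le> total_load"
  using rates_pos mean_serv_pos by (intro sum_nonneg) (auto simp: load_def less_imp_le)

lemma norm_arrival_exponent_le:
  assumes "near_one c z" shows "norm (arrival_exponent z) \<le> c * total_load"
proof -
  have "norm (arrival_exponent z) \<le> (\<Sum>j=1..nq P. norm (of_real (arr_rate P j) * (1 - z j)))"
    unfolding arrival_exponent_def by (rule norm_sum)
  also have "\<dots> \<le> (\<Sum>j=1..nq P. c * load P j)"
  proof (rule sum_mono)
    fix j assume j: "j \<in> types"
    then have "arr_rate P j * norm (1 - z j) \<le> arr_rate P j * (c * mean (serv P j))"
      using assms rates_pos(1)[OF j] unfolding near_one_def by (intro mult_left_mono) auto
    then show "norm (of_real (arr_rate P j) * (1 - z j)) \<le> c * load P j"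
      using rates_pos(1)[OF j] by (simp add: norm_mult load_def mult_ac)
  qed
  finally show ?thesis by (simp add: sum_distrib_left)
qed

lemma near_one_norm: "near_one c z \<Longrightarrow> j \<in> types \<Longrightarrow> norm (z j) \<le> 1"
  by (simp add: near_one_def)

lemma near_one_beta:
  assumes "near_one c z" "i \<in> types"
  shows "norm (1 - beta P i z) \<le> c * total_load * mean (serv P i)"
proof -
  have "norm (1 - beta P i z) \<le> norm (arrival_exponent z) * mean (serv P i)"
    unfolding beta_def arrival_exponent_def[symmetric]
    using near_one_norm[OF assms(1)] by (intro norm_one_minus_lst_le dists(1)[OF assms(2)] Re_arrival_exponent)
  also have "\<dots> \<le> c * total_load * mean (serv P i)"
    using norm_arrival_exponent_le[OF assms(1)] mean_serv_pos[OF assms(2)] by (intro mult_right_mono) auto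
  finally show ?thesis .
qed

lemma near_one_sigma:
  assumes "near_one c z" "i \<in> types"
  shows "norm (1 - sigma P i z) \<le> c * total_load * mean (switch P i)"
proof -
  have "0 \<le> mean (switch P i)"
    unfolding mean_def using dists(2)[OF assms(2)] by (intro integral_nonneg_AE) (simp add: nonneg_dist_def)
  have "norm (1 - sigma P i z) \<le> norm (arrival_exponent z) * mean (switch P i)"
    unfolding sigma_def arrival_exponent_def[symmetric]
    using near_one_norm[OF assms(1)] by (intro norm_one_minus_lst_le dists(2)[OF assms(2)] Re_arrival_exponent)
  also have "\<dots> \<le> c * total_load * mean (switch P i)"
    using norm_arrival_exponent_le[OF assms(1)] \<open>0 \<le> mean (switch P i)\<close> by (intro mult_right_mono) auto
  finally show ?thesis .
qed

definition stick_prob :: "nat \<Rightarrow> real" where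
  "stick_prob i = 1 - exp (- retr_rate P i * glue P i)"

lemma stick_prob_bounds: "i \<in> types \<Longrightarrow> 0 < stick_prob i" "stick_prob i < 1"
  using rates_pos glue_pos by (auto simp: stick_prob_def)

definition contraction :: real where
  "contraction = Max ((\<lambda>i. 1 - stick_prob i * (1 - total_load)) ` types)"

lemma types_nonempty: "types \<noteq> {}" "finite types"
  using valid by (auto simp: valid_polling_def)

lemma contraction_bounds:
  assumes "total_load < 1"
  shows "0 \<le> contraction" "contraction < 1" "i \<in> types \<Longrightarrow> 1 - stick_prob i * (1 - total_load) \<le> contraction"
proof -
  let ?A = "(\<lambda>i. 1 - stick_prob i * (1 - total_load)) ` types"
  have A: "finite ?A" "?A \<noteq> {}" using types_nonempty by auto
  show up: "i \<in> types \<Longrightarrow> 1 - stick_prob i * (1 - total_load) \<le> contraction" for i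
    unfolding contraction_def using A by (intro Max_ge) auto
  show "contraction < 1"
    unfolding contraction_def using A assms stick_prob_bounds by (subst Max_less_iff) auto
  obtain i where i: "i \<in> types" using types_nonempty by blast
  have "stick_prob i * (1 - total_load) \<le> 1 * 1"
    using stick_prob_bounds[of i] i assms total_load_nonneg by (intro mult_mono) auto
  then show "0 \<le> contraction" using up[OF i] by simp
qed

text \<open>
  A customer that does not join keeps its charge, and one that joins is replaced by its arrivals, whose
  charge is smaller by the factor \<open>total_load\<close>.
\<close>
lemma near_one_f_fun:
  assumes z: "near_one c z" and c: "0 \<le> c" and i: "i \<in> types" and load: "total_load < 1"
  shows "norm (1 - f_fun P i z) \<le> contraction * c * mean (serv P i)"
proof -
  let ?p = "stick_prob i"
  note p = stick_prob_bounds(1)[OF i] stick_prob_bounds(2)[of i]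
  have "1 - f_fun P i z = of_real ?p * (1 - beta P i z) + of_real (1 - ?p) * (1 - z i)"
    by (simp add: f_fun_def stick_prob_def algebra_simps)
  then have "norm (1 - f_fun P i z) \<le> norm (of_real ?p * (1 - beta P i z)) + norm (of_real (1 - ?p) * (1 - z i))"
    by (metis norm_triangle_ineq)
  also have "\<dots> = ?p * norm (1 - beta P i z) + (1 - ?p) * norm (1 - z i)"
    unfolding norm_mult norm_of_real using p by simp
  also have "\<dots> \<le> ?p * (c * total_load * mean (serv P i)) + (1 - ?p) * (c * mean (serv P i))"
    using p z i near_one_beta[OF z i] unfolding near_one_def by (intro add_mono mult_left_mono) auto
  also have "\<dots> = (1 - ?p * (1 - total_load)) * (c * mean (serv P i))" by (simp add: algebra_simps)
  also have "\<dots> \<le> contraction * (c * mean (serv P i))"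
    using c mean_serv_pos[OF i] contraction_bounds(3)[OF load i] by (intro mult_right_mono) auto
  finally show ?thesis by simp
qed

lemma near_one_mono: "near_one c z \<Longrightarrow> c \<le> c' \<Longrightarrow> near_one c' z"
  unfolding near_one_def using mean_serv_pos by (meson less_imp_le mult_right_mono order_trans)

text \<open>
  Downward induction over the queues: the components that are already substituted are even closer to
  1 than the original ones.
\<close>
lemma near_one_h_fun:
  assumes z: "near_one c z" and c: "0 \<le> c" and load: "total_load < 1"
  shows "near_one (contraction * c) (\<lambda>j. h_fun P j z)"
proof -
  have le: "contraction * c \<le> c" using contraction_bounds[OF load] c by (simp add: mult_left_le_one_le)
  have "norm (1 - h_fun P i z) \<le> contraction * c * mean (serv P i)" if "i \<in> types" for i
    using that
  proof (induction "nq P - i" arbitrary: i rule: less_induct)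
    case less
    have "near_one c (hvec P i z)"
      unfolding near_one_def
    proof
      fix j assume j: "j \<in> types"
      show "norm (hvec P i z j) \<le> 1 \<and> norm (1 - hvec P i z j) \<le> c * mean (serv P j)"
      proof (cases "i < j \<and> j \<le> nq P")
        case True
        then have "norm (1 - h_fun P j z) \<le> contraction * c * mean (serv P j)"
          using less.hyps[of j] j by auto
        also have "\<dots> \<le> c * mean (serv P j)" using le mean_serv_pos[OF j] by (intro mult_right_mono) auto
        finally show ?thesis using norm_h_fun_le_1[OF near_one_norm[OF z] j] True by (simp add: hvec_def)
      next
        case False
        then have "hvec P i z j = z j" by (auto simp: hvec_def)
        then show ?thesis using z j by (simp add: near_one_def)
      qed
    qed
    then show ?case unfolding h_fun_hvec by (rule near_one_f_fun[OF _ c less.prems load])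
  qed
  moreover have "norm (h_fun P i z) \<le> 1" if "i \<in> types" for i
    using near_one_norm[OF z] that by (rule norm_h_fun_le_1)
  ultimately show ?thesis unfolding near_one_def by blast
qed

lemma near_one_hvec:
  assumes z: "near_one c z" and c: "0 \<le> c" and load: "total_load < 1"
  shows "near_one c (hvec P i z)"
proof -
  have le: "contraction * c \<le> c" using contraction_bounds[OF load] c by (simp add: mult_left_le_one_le)
  then have "near_one c (\<lambda>j. h_fun P j z)" using near_one_h_fun[OF z c load] near_one_mono by blast
  with z show ?thesis by (simp add: near_one_def hvec_def)
qed

lemma near_one_hiter:
  assumes z: "near_one c z" and c: "0 \<le> c" and load: "total_load < 1"
  shows "near_one (contraction ^ n * c) (hiter P n z)"
proof (induction n)
  case (Suc n)
  have "near_one (contraction * (contraction ^ n * c)) (\<lambda>j. h_fun P j (hiter P n z))"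
    using Suc c contraction_bounds(1)[OF load] by (intro near_one_h_fun load) auto
  then show ?case by (simp add: mult.assoc)
qed (use z in simp)

definition K_lipschitz :: real where
  "K_lipschitz = (\<Sum>i=1..nq P. total_load * mean (switch P i) + glue P i)"

text \<open>
  All factors of \<open>K\<close> have norm at most 1, so that the deviations from 1 add up.
\<close>
lemma near_one_K_fun:
  assumes z: "near_one c z" and c: "0 \<le> c" and load: "total_load < 1"
  shows "norm (K_fun P z - 1) \<le> c * K_lipschitz"
proof -
  let ?w = "\<lambda>i. hvec P i z" let ?s = "\<lambda>i. sigma P i (?w i)"
  let ?e = "\<lambda>i. exp (- of_real (glue P i) * D_fun P i z)"
  have w: "near_one c (?w i)" for i by (rule near_one_hvec[OF z c load])
  have h: "norm (h_fun P j z) \<le> 1" "norm (1 - h_fun P j z) \<le> c * mean (serv P j)" if "j \<in> types" for j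
    using near_one_hvec[OF z c load, of 0] that by (auto simp: near_one_def hvec_def)
  have sn: "norm (?s i) \<le> 1" if i: "i \<in> types" for i
    unfolding sigma_def arrival_exponent_def[symmetric]
    using near_one_norm[OF w] by (intro norm_lst_le_1 dists(2)[OF i] Re_arrival_exponent)
  have D: "D_fun P i z = (\<Sum>j\<in>types. of_real (arr_rate P j) * (1 - (if j < i then z j else if j = i then beta P i (?w i) else h_fun P j z)))"
    (is "_ = (\<Sum>j\<in>types. of_real (arr_rate P j) * (1 - ?y i j))") if i: "i \<in> types" for i
  proof -
    have e: "types - {i} = {1..<i} \<union> {i<..nq P}" using i by auto
    have "(\<Sum>j\<in>types. of_real (arr_rate P j) * (1 - ?y i j)) =
        of_real (arr_rate P i) * (1 - ?y i i) + (\<Sum>j\<in>types - {i}. of_real (arr_rate P j) * (1 - ?y i j))"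
      by (rule sum.remove) (use i in auto)
    also have "(\<Sum>j\<in>types - {i}. of_real (arr_rate P j) * (1 - ?y i j)) = (\<Sum>j\<in>{1..<i}. of_real (arr_rate P j) * (1 - ?y i j))
      + (\<Sum>j\<in>{i<..nq P}. of_real (arr_rate P j) * (1 - ?y i j))"
      unfolding e by (rule sum.union_disjoint) auto
    finally have "(\<Sum>j\<in>types. of_real (arr_rate P j) * (1 - ?y i j)) = of_real (arr_rate P i) * (1 - ?y i i) +
      ((\<Sum>j\<in>{1..<i}. of_real (arr_rate P j) * (1 - ?y i j)) + (\<Sum>j\<in>{i<..nq P}. of_real (arr_rate P j) * (1 - ?y i j)))" .
    moreover have "(\<Sum>j\<in>{1..<i}. of_real (arr_rate P j) * (1 - ?y i j)) = (\<Sum>j\<in>{1..<i}. of_real (arr_rate P j) * (1 - z j))"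
      by (intro sum.cong) auto
    moreover have "(\<Sum>j\<in>{i<..nq P}. of_real (arr_rate P j) * (1 - ?y i j)) = (\<Sum>j\<in>{i<..nq P}. of_real (arr_rate P j) * (1 - h_fun P j z))"
      by (intro sum.cong) auto
    ultimately show ?thesis by (simp add: D_fun_def)
  qed
  have y: "near_one c (?y i)" if i: "i \<in> types" for i
  proof -
    have b: "norm (beta P i (?w i)) \<le> 1"
      unfolding beta_def arrival_exponent_def[symmetric]
      using near_one_norm[OF w] by (intro norm_lst_le_1 dists(1)[OF i] Re_arrival_exponent)
    have "norm (1 - beta P i (?w i)) \<le> c * total_load * mean (serv P i)" by (rule near_one_beta[OF w i])
    also have "\<dots> \<le> c * 1 * mean (serv P i)"
      using load c mean_serv_pos[OF i] by (intro mult_right_mono mult_left_mono) auto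
    finally show ?thesis using b h z by (auto simp: near_one_def)
  qed
  have DRe: "0 \<le> Re (D_fun P i z)" and Dn: "norm (D_fun P i z) \<le> c" if i: "i \<in> types" for i
  proof -
    have e: "D_fun P i z = arrival_exponent (?y i)" unfolding D[OF i] arrival_exponent_def ..
    show "0 \<le> Re (D_fun P i z)" unfolding e using near_one_norm[OF y[OF i]] by (rule Re_arrival_exponent)
    have "norm (D_fun P i z) \<le> c * total_load" unfolding e by (rule norm_arrival_exponent_le[OF y[OF i]])
    also have "\<dots> \<le> c * 1" using load c by (intro mult_left_mono) auto
    finally show "norm (D_fun P i z) \<le> c" by simp
  qed
  have en: "norm (?e i) \<le> 1" "norm (1 - ?e i) \<le> glue P i * c" if i: "i \<in> types" for i
  proof -
    have G: "0 \<le> glue P i" using glue_pos[OF i] by simp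
    show "norm (?e i) \<le> 1" using DRe[OF i] G by (simp add: norm_exp_eq_Re)
    have "norm (1 - ?e i) \<le> norm (of_real (glue P i) * D_fun P i z)"
      using norm_one_minus_exp_le[of "of_real (glue P i) * D_fun P i z"] DRe[OF i] G by simp
    also have "\<dots> \<le> glue P i * c" using G Dn[OF i] by (simp add: norm_mult mult_left_mono)
    finally show "norm (1 - ?e i) \<le> glue P i * c" .
  qed
  have "norm (K_fun P z - 1) = norm ((\<Prod>i\<in>types. ?s i * ?e i) - (\<Prod>i\<in>types. 1))"
    unfolding K_fun_def by (simp add: prod.distrib)
  also have "\<dots> \<le> (\<Sum>i\<in>types. norm (?s i * ?e i - 1))"
    using sn en(1) by (intro norm_prod_diff) (auto simp: norm_mult mult_le_one)
  also have "\<dots> \<le> (\<Sum>i\<in>types. c * (total_load * mean (switch P i) + glue P i))"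
  proof (rule sum_mono)
    fix i assume i: "i \<in> types"
    have "norm (?s i * ?e i - 1) = norm (1 - ?s i * ?e i)" by (rule norm_minus_commute)
    also have "\<dots> \<le> norm (1 - ?s i) + norm (1 - ?e i)" by (rule norm_one_minus_mult_le[OF sn[OF i]])
    also have "\<dots> \<le> c * total_load * mean (switch P i) + glue P i * c"
      by (intro add_mono near_one_sigma[OF w i] en(2)[OF i])
    finally show "norm (?s i * ?e i - 1) \<le> c * (total_load * mean (switch P i) + glue P i)"
      by (simp add: algebra_simps)
  qed
  finally show ?thesis by (simp add: K_lipschitz_def sum_distrib_left)
qed

lemma near_one_exists:
  assumes z: "\<And>j. j \<in> types \<Longrightarrow> norm (z j) \<le> 1"
  obtains c where "0 \<le> c" "near_one c z"
proof -
  \<comment> \<open>the distance between 1 and a component is at most 2\<close>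
  define c where "c = (\<Sum>j\<in>types. 2 / mean (serv P j))"
  have c0: "0 \<le> c" unfolding c_def using mean_serv_pos by (intro sum_nonneg) (auto simp: less_imp_le)
  have "norm (1 - z j) \<le> c * mean (serv P j)" if j: "j \<in> types" for j
  proof -
    have "norm (1 - z j) \<le> 2" using norm_triangle_ineq4[of 1 "z j"] z[OF j] by simp
    also have "\<dots> = 2 / mean (serv P j) * mean (serv P j)" using mean_serv_pos[OF j] by simp
    also have "\<dots> \<le> c * mean (serv P j)"
      unfolding c_def using mean_serv_pos j
      by (intro mult_right_mono member_le_sum) (auto simp: less_imp_le)
    finally show ?thesis .
  qed
  then have "near_one c z" using z by (simp add: near_one_def)
  with c0 show ?thesis by (rule that)
qed

text \<open>
  The deviations of the factors from 1 are dominated by a geometric series.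
\<close>
lemma K_fun_product:
  assumes z: "\<And>j. j \<in> types \<Longrightarrow> norm (z j) \<le> 1" and load: "total_load < 1"
  shows "(\<lambda>m. K_fun P (hiter P m z)) has_prod (\<Prod>m. K_fun P (hiter P m z))"
    and "(\<lambda>n. num_gf (n * nq P) z) \<longlonglongrightarrow> (\<Prod>m. K_fun P (hiter P m z))"
proof -
  let ?K = "\<lambda>m. K_fun P (hiter P m z)"
  obtain c where c: "0 \<le> c" "near_one c z" by (rule near_one_exists[OF z])
  note r = contraction_bounds[OF load]
  have near: "near_one (contraction ^ m * c) (hiter P m z)" for m by (rule near_one_hiter[OF c(2,1) load])
  have "summable (\<lambda>m. norm (?K m - 1))"
  proof (rule summable_comparison_test)
    show "summable (\<lambda>m. contraction ^ m * (c * K_lipschitz))"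
      using r by (intro summable_mult2 summable_geometric) simp
    have "norm (?K m - 1) \<le> contraction ^ m * c * K_lipschitz" for m
      using near c r by (intro near_one_K_fun load) auto
    then show "\<exists>N. \<forall>n\<ge>N. norm (norm (?K n - 1)) \<le> contraction ^ n * (c * K_lipschitz)" by (simp add: mult.assoc)
  qed
  then have "abs_convergent_prod ?K" by (rule summable_imp_abs_convergent_prod)
  then have conv: "convergent_prod ?K" by (rule abs_convergent_prod_imp_convergent_prod)
  then show "?K has_prod (\<Prod>m. ?K m)" by (rule convergent_prod_has_prod)
  have "(\<lambda>n. \<Prod>m<n. ?K m) \<longlonglongrightarrow> (\<Prod>m. ?K m)"
    using convergent_prod_LIMSEQ[OF conv] by (simp add: LIMSEQ_lessThan_iff_atMost)
  moreover have "(\<lambda>n. \<Prod>j\<in>types. hiter P n z j ^ x0 j) \<longlonglongrightarrow> (\<Prod>j\<in>types. 1 ^ x0 j)"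
  proof (intro tendsto_prod tendsto_power)
    fix j assume j: "j \<in> types"
    have "(\<lambda>n. 1 - hiter P n z j) \<longlonglongrightarrow> 0"
    proof (rule Lim_null_comparison)
      show "(\<lambda>n. contraction ^ n * (c * mean (serv P j))) \<longlonglongrightarrow> 0"
        using r by (intro tendsto_mult_left_zero LIMSEQ_power_zero) simp
      show "eventually (\<lambda>n. norm (1 - hiter P n z j) \<le> contraction ^ n * (c * mean (serv P j))) sequentially"
        using near j by (simp add: near_one_def mult.assoc)
    qed
    then have "(\<lambda>n. 1 - (1 - hiter P n z j)) \<longlonglongrightarrow> 1 - 0" by (intro tendsto_diff tendsto_const)
    then show "(\<lambda>n. hiter P n z j) \<longlonglongrightarrow> 1" by simp
  qed
  ultimately have "(\<lambda>n. (\<Prod>m<n. ?K m) * (\<Prod>j\<in>types. hiter P n z j ^ x0 j)) \<longlonglongrightarrow> (\<Prod>m. ?K m) * (\<Prod>j\<in>types. 1 ^ x0 j)"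
    by (rule tendsto_mult)
  moreover have "num_gf (n * nq P) z = (\<Prod>m<n. ?K m) * (\<Prod>j\<in>types. hiter P n z j ^ x0 j)" for n
    using z by (rule num_gf_product)
  ultimately show "(\<lambda>n. num_gf (n * nq P) z) \<longlonglongrightarrow> (\<Prod>m. ?K m)" by simp
qed

end

section \<open>Passage to the limit distribution\<close>

context polling_system
begin

lemma stage_cong:
  assumes "\<And>s. s \<in> sources P \<Longrightarrow> w s = w' s"
  shows "stage P x0 w k = stage P x0 w' k"
proof (induction k)
  case (Suc k)
  let ?i = "queue P k"
  have i: "?i \<in> types" by (rule queue_types)
  have "attempt x0 w ?i c m = attempt x0 w' ?i c m" for c m
    using assms i unfolding attempt_def entry_def by (intro arg_cong2[where f="(+)"] if_cong sum.cong refl) auto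
  then have j: "joining w k = joining w' k" unfolding joining_def Suc by simp
  have "(\<Sum>c\<in>joining w' k. w (Serv ?i c)) = (\<Sum>c\<in>joining w' k. w' (Serv ?i c))"
    using assms i by (intro sum.cong) auto
  moreover have "w (Switch k) = w' (Switch k)" using assms by simp
  ultimately show ?case unfolding stage_Suc j Suc by simp
qed simp

lemma num_at_cong:
  assumes "\<And>s. s \<in> sources P \<Longrightarrow> w s = w' s" "j \<in> types"
  shows "num_at P x0 w k j = num_at P x0 w' k j"
proof -
  have "entry x0 w j c = entry x0 w' j c" for c
    using assms unfolding entry_def by (intro if_cong sum.cong refl) auto
  moreover have "stage P x0 w k = stage P x0 w' k" using assms(1) by (rule stage_cong)
  ultimately show ?thesis unfolding num_at_def by simp
qed

lemma distr_sources:
  fixes M :: "'a measure"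
  assumes "polling_sources P M W"
  shows "distr M Om (\<lambda>\<omega>. \<lambda>s\<in>sources P. W s \<omega>) = Om"
    and "(\<lambda>\<omega>. \<lambda>s\<in>sources P. W s \<omega>) \<in> measurable M Om"
proof -
  interpret prob_space M using assms by (simp add: polling_sources_def)
  have ind: "indep_vars (\<lambda>_. borel) W (sources P)" and d: "\<And>s. s \<in> sources P \<Longrightarrow> distr M borel (W s) = law s"
    using assms by (auto simp: polling_sources_def law_def)
  have ne: "sources P \<noteq> {}" using sources_simps(4)[of 0] by blast
  have rv: "\<And>s. s \<in> sources P \<Longrightarrow> W s \<in> borel_measurable M" using ind by (simp add: indep_vars_def)
  have eq: "sets (PiM (sources P) (\<lambda>_. borel)) = sets Om" by (rule sets_PiM_cong) (simp_all add: sets_law)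
  have "distr M Om (\<lambda>\<omega>. \<lambda>s\<in>sources P. W s \<omega>) = distr M (PiM (sources P) (\<lambda>_. borel)) (\<lambda>\<omega>. \<lambda>s\<in>sources P. W s \<omega>)"
    by (rule distr_cong) (simp_all add: eq)
  also have "\<dots> = PiM (sources P) (\<lambda>s. distr M borel (W s))"
    using ind by (subst (asm) indep_vars_iff_distr_eq_PiM'[OF ne]) (simp_all add: rv)
  also have "\<dots> = Om" by (rule PiM_cong) (simp_all add: d)
  finally show "distr M Om (\<lambda>\<omega>. \<lambda>s\<in>sources P. W s \<omega>) = Om" .
  show "(\<lambda>\<omega>. \<lambda>s\<in>sources P. W s \<omega>) \<in> measurable M Om"
    by (rule src.measurable_into_PiM) (simp_all add: rv)
qed

text \<open>
  The vectors of numbers are encoded as lists, in order to have a countable type.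
\<close>
lemma steady_state_num_gf:
  fixes M :: "'a measure" and M' :: "'b measure" and X :: "nat \<Rightarrow> 'b \<Rightarrow> nat"
  assumes W: "polling_sources P M W" and ss: "steady_state P M W x0 M' X"
    and z: "\<And>j. j \<in> types \<Longrightarrow> norm (z j) \<le> 1"
  shows "(\<lambda>n. num_gf (n * nq P) z) \<longlonglongrightarrow> gen_fun P M' X z"
proof -
  interpret M: prob_space M using W by (simp add: polling_sources_def)
  interpret M': prob_space M' using ss by (simp add: steady_state_def)
  have X: "\<And>j. j \<in> types \<Longrightarrow> X j \<in> measurable M' (count_space UNIV)" using ss by (simp add: steady_state_def)
  define vec where "vec y = map y [1..<Suc (nq P)]" for y :: "nat \<Rightarrow> nat"
  define g where "g xs = (\<Prod>j\<in>types. z j ^ (xs ! (j - 1)))" for xs :: "nat list"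
  have vec_nth: "vec y ! (j - 1) = y j" if "j \<in> types" for y j
    using that by (auto simp: vec_def nth_upt simp del: upt_Suc)
  have vec_eq: "vec y = xs \<longleftrightarrow> length xs = nq P \<and> (\<forall>j\<in>types. y j = xs ! (j - 1))" for y xs
  proof
    show "length xs = nq P \<and> (\<forall>j\<in>types. y j = xs ! (j - 1))" if "vec y = xs"
      using that vec_nth by (auto simp: vec_def simp del: upt_Suc)
    assume *: "length xs = nq P \<and> (\<forall>j\<in>types. y j = xs ! (j - 1))"
    show "vec y = xs"
    proof (rule nth_equalityI)
      show "length (vec y) = length xs" using * by (simp add: vec_def del: upt_Suc)
      fix i assume "i < length (vec y)"
      then have "Suc i \<in> types" by (simp add: vec_def del: upt_Suc)
      then show "vec y ! i = xs ! i" using * vec_nth[of "Suc i" y] by simp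
    qed
  qed
  have meas: "(\<lambda>w. vec (\<lambda>j. Y j w)) \<in> measurable N (count_space UNIV)"
    if Y: "\<And>j. j \<in> types \<Longrightarrow> Y j \<in> measurable N (count_space UNIV)" for N :: "'z measure" and Y
    unfolding measurable_count_space_eq2_countable
  proof safe
    fix xs
    have "Measurable.pred N (\<lambda>w. length xs = nq P \<and> (\<forall>j\<in>types. Y j w = xs ! (j - 1)))"
    proof (intro pred_intros_logic pred_intros_finite(3))
      fix j assume "j \<in> types"
      note [measurable] = Y[OF this]
      show "Measurable.pred N (\<lambda>w. Y j w = xs ! (j - 1))" by measurable
    qed auto
    then have "{w \<in> space N. vec (\<lambda>j. Y j w) = xs} \<in> sets N"
      unfolding pred_def vec_eq .
    moreover have "(\<lambda>w. vec (\<lambda>j. Y j w)) -` {xs} \<inter> space N = {w \<in> space N. vec (\<lambda>j. Y j w) = xs}" by blast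
    ultimately show "(\<lambda>w. vec (\<lambda>j. Y j w)) -` {xs} \<inter> space N \<in> sets N" by (simp only:)
  qed simp_all
  define V where "V k w = vec (num_at P x0 w k)" for k w
  have Vm[measurable]: "V k \<in> measurable Om (count_space UNIV)" for k
    unfolding V_def[abs_def] by (rule meas[of "\<lambda>j w. num_at P x0 w k j"]) (intro measurable_num_at measurable_source)
  define VX where "VX \<omega> = vec (\<lambda>j. X j \<omega>)" for \<omega>
  have VXm[measurable]: "VX \<in> measurable M' (count_space UNIV)" unfolding VX_def[abs_def] by (rule meas[OF X])
  let ?D = "\<lambda>n. distr Om (count_space UNIV) (V (n * nq P))" and ?D' = "distr M' (count_space UNIV) VX"
  have lim: "(\<lambda>n. measure (?D n) {xs}) \<longlonglongrightarrow> measure ?D' {xs}" for xs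
  proof (cases "length xs = nq P")
    case False
    then have "vec y \<noteq> xs" for y using vec_eq[of y xs] by simp
    then have "V k -` {xs} \<inter> space Om = {}" "VX -` {xs} \<inter> space M' = {}" for k
      unfolding V_def VX_def by blast+
    then show ?thesis by (simp add: measure_distr)
  next
    case True
    let ?x = "\<lambda>i. xs ! (i - 1)" let ?R = "\<lambda>\<omega>. \<lambda>s\<in>sources P. W s \<omega>"
    have VV: "V k w = xs \<longleftrightarrow> (\<forall>i\<in>types. num_at P x0 w k i = ?x i)" for k w
      unfolding V_def vec_eq using True by simp
    have VV': "VX \<omega> = xs \<longleftrightarrow> (\<forall>i\<in>types. X i \<omega> = ?x i)" for \<omega>
      unfolding VX_def vec_eq using True by simp
    have "measure (?D n) {xs} = measure M {\<omega>\<in>space M. \<forall>i\<in>types. num_at P x0 (\<lambda>s. W s \<omega>) (n * nq P) i = ?x i}" for n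
    proof -
      have "measure (?D n) {xs} = measure Om (V (n * nq P) -` {xs} \<inter> space Om)"
        by (rule measure_distr) simp_all
      also have "\<dots> = measure (distr M Om ?R) (V (n * nq P) -` {xs} \<inter> space Om)"
        unfolding distr_sources(1)[OF W] ..
      also have "\<dots> = measure M (?R -` (V (n * nq P) -` {xs} \<inter> space Om) \<inter> space M)"
        by (rule measure_distr[OF distr_sources(2)[OF W]]) (rule measurable_sets[OF Vm], simp)
      also have "?R -` (V (n * nq P) -` {xs} \<inter> space Om) \<inter> space M
         = {\<omega>\<in>space M. \<forall>i\<in>types. num_at P x0 (\<lambda>s. W s \<omega>) (n * nq P) i = ?x i}"
      proof -
        have eq: "num_at P x0 (?R \<omega>) (n * nq P) i = num_at P x0 (\<lambda>s. W s \<omega>) (n * nq P) i" if "i \<in> types" for \<omega> i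
          by (rule num_at_cong[OF _ that]) simp
        have "?R \<omega> \<in> space Om" if "\<omega> \<in> space M" for \<omega>
          using measurable_space[OF distr_sources(2)[OF W] that] .
        then have "?R -` (V (n * nq P) -` {xs} \<inter> space Om) \<inter> space M = {\<omega>\<in>space M. V (n * nq P) (?R \<omega>) = xs}"
          by blast
        also have "\<dots> = {\<omega>\<in>space M. \<forall>i\<in>types. num_at P x0 (\<lambda>s. W s \<omega>) (n * nq P) i = ?x i}"
          unfolding VV using eq by simp
        finally show ?thesis .
      qed
      finally show ?thesis .
    qed
    moreover have "measure ?D' {xs} = measure M' {\<omega>\<in>space M'. \<forall>i\<in>types. X i \<omega> = ?x i}"
    proof -
      have "VX -` {xs} \<inter> space M' = {\<omega>\<in>space M'. VX \<omega> = xs}" by blast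
      then have "VX -` {xs} \<inter> space M' = {\<omega>\<in>space M'. \<forall>i\<in>types. X i \<omega> = ?x i}"
        unfolding VV' .
      then show ?thesis by (simp add: measure_distr)
    qed
    ultimately show ?thesis using ss unfolding steady_state_def by simp
  qed
  have gn: "norm (g xs) \<le> 1" for xs
    unfolding g_def prod_norm[symmetric] norm_power using z by (intro prod_le_1) (auto intro: power_le_one)
  have "(\<lambda>n. \<integral>x. g x \<partial>?D n) \<longlonglongrightarrow> (\<integral>x. g x \<partial>?D')"
    by (rule tendsto_integral_countable[OF _ _ _ _ lim gn])
       (auto intro!: src.P.prob_space_distr M'.prob_space_distr)
  moreover have "(\<integral>x. g x \<partial>?D n) = num_gf (n * nq P) z" for n
  proof -
    have "(\<integral>x. g x \<partial>?D n) = (\<integral>w. g (V (n * nq P) w) \<partial>Om)" by (rule integral_distr) auto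
    also have "\<dots> = num_gf (n * nq P) z"
      unfolding num_gf_def g_def V_def
      by (intro Bochner_Integration.integral_cong prod.cong refl) (simp add: vec_nth del: One_nat_def)
    finally show ?thesis .
  qed
  moreover have "(\<integral>x. g x \<partial>?D') = gen_fun P M' X z"
  proof -
    have "(\<integral>x. g x \<partial>?D') = (\<integral>\<omega>. g (VX \<omega>) \<partial>M')" by (rule integral_distr) auto
    also have "\<dots> = gen_fun P M' X z"
      unfolding gen_fun_def g_def VX_def
      by (intro Bochner_Integration.integral_cong prod.cong refl) (simp add: vec_nth del: One_nat_def)
    finally show ?thesis .
  qed
  ultimately show ?thesis by simp
qed

end

theorem theorem3:
  fixes P :: polling
    and M :: "'a measure" and W :: "source \<Rightarrow> 'a \<Rightarrow> real" and x0 :: "nat \<Rightarrow> nat"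
    and M' :: "'b measure" and X :: "nat \<Rightarrow> 'b \<Rightarrow> nat"
    and z :: "nat \<Rightarrow> complex"
  assumes "valid_polling P"
    and "polling_sources P M W"
    and "steady_state P M W x0 M' X"
    and "(\<Sum>i=1..nq P. load P i) < 1"
    and "\<forall>j\<in>{1..nq P}. norm (z j) \<le> 1"
  shows "(\<lambda>m. K_fun P (hiter P m z)) has_prod gen_fun P M' X z"
proof -
  interpret polling_system P x0 by unfold_locales (rule assms(1))
  have z: "norm (z j) \<le> 1" if "j \<in> {1..nq P}" for j using assms(5) that by blast
  have "(\<lambda>n. num_gf (n * nq P) z) \<longlonglongrightarrow> gen_fun P M' X z"
    using assms(2,3) z by (rule steady_state_num_gf)
  moreover have "(\<lambda>n. num_gf (n * nq P) z) \<longlonglongrightarrow> (\<Prod>m. K_fun P (hiter P m z))"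
    using z assms(4) by (rule K_fun_product(2))
  ultimately have "gen_fun P M' X z = (\<Prod>m. K_fun P (hiter P m z))" by (rule LIMSEQ_unique)
  moreover have "(\<lambda>m. K_fun P (hiter P m z)) has_prod (\<Prod>m. K_fun P (hiter P m z))"
    using z assms(4) by (rule K_fun_product(1))
  ultimately show ?thesis by simp
qed

end
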